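(* Let $n\in\mathbb{N}$ be a positive integer, let $0<s<1$ and $m\in\mathbb{R}$, and put $$ m_s=-\frac{ns}{2}-ns(1-s). $$ Let $\theta,\phi\in C_0^\infty(\mathbb{R}^n)$ be functions such that $$ \theta(\xi)=1 \text{ on } \{1/8\le|\xi|\le 8\},\qquad \operatorname{supp}\theta\subset\{1/10\le|\xi|\le 10\}, $$ $$ \phi(\xi)=1 \text{ on } \{|\xi|\le 2\},\qquad \operatorname{supp}\phi\subset\{|\xi|\le 3\}. $$ Suppose there is a constant $c>0$ such that $$ 2^{jm}\,\Big\| e^{i|D|^s}f\cdot e^{i|D|^s}\phi(2^{-j}D)g\cdot e^{i|D|^s}\theta(2^{-j}D)h\Big\|_{L^1(\mathbb{R}^n)}\le c\,\|f\|_{L^\infty}\|g\|_{L^\infty}\|h\|_{h^1} $$ for all $j\in\mathbb{N}=\{1,2,3,\dots\}$ and all $f,g,h\in\mathcal{S}(\mathbb{R}^n)$. Then $m\le m_s$.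
   Context: For a measurable function $\tau$ on $\mathbb{R}^n$ of at most polynomial growth, the Fourier multiplier operator is $\tau(D)f(x)=(2\pi)^{-n}\int_{\mathbb{R}^n}e^{ix\cdot\xi}\tau(\xi)\widehat f(\xi)\,d\xi$ for $f$ in the Schwartz class $\mathcal{S}(\mathbb{R}^n)$, where $\widehat f(\xi)=\int_{\mathbb{R}^n}e^{-i\xi\cdot x}f(x)\,dx$. Thus $e^{i|D|^s}$, $e^{i|D|^s}\phi(2^{-j}D)$ and $e^{i|D|^s}\theta(2^{-j}D)$ are the multiplier operators with symbols $e^{i|\xi|^s}$, $e^{i|\xi|^s}\phi(2^{-j}\xi)$ and $e^{i|\xi|^s}\theta(2^{-j}\xi)$. The dots in the $L^1$ norm denote pointwise products. $h^1=h^1(\mathbb{R}^n)$ is Goldberg's local Hardy space, with norm $\|h\|_{h^1}=\big\|\sup_{0<t<1}|\Phi_t*h|\,\big\|_{L^1}$, where $\Phi\in\mathcal{S}(\mathbb{R}^n)$ is a fixed function with $\int\Phi\neq 0$ and $\Phi_t(x)=t^{-n}\Phi(x/t)$ (different choices of $\Phi$ give equivalent norms). *)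

theory Defs
  imports "HOL-Analysis.Analysis" "HOL-Probability.Essential_Supremum"
begin

definition partial_deriv :: "'n \<Rightarrow> (real^'n \<Rightarrow> complex) \<Rightarrow> real^'n::finite \<Rightarrow> complex" where
  "partial_deriv i f x = frechet_derivative f (at x) (axis i 1)"

text \<open>The list \<open>is\<close> of directions plays the role of a multi-index.\<close>

definition partial_derivs :: "'n list \<Rightarrow> (real^'n \<Rightarrow> complex) \<Rightarrow> real^'n::finite \<Rightarrow> complex" where
  "partial_derivs is f = foldr partial_deriv is f"

text \<open>
  Requiring every iterated partial derivative to be (Frechet) differentiable everywhere is the
  same as requiring all of them to exist and to be continuous. It also keeps
  \<^const>\<open>frechet_derivative\<close> from returning junk values.
\<close>

definition smooth :: "(real^'n::finite \<Rightarrow> complex) \<Rightarrow> bool" where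
  "smooth f \<longleftrightarrow> (\<forall>is x. partial_derivs is f differentiable (at x))"

definition supp :: "(real^'n::finite \<Rightarrow> complex) \<Rightarrow> (real^'n) set" where
  "supp f = closure {x. f x \<noteq> 0}"

definition test_function :: "(real^'n::finite \<Rightarrow> complex) \<Rightarrow> bool" where
  "test_function f \<longleftrightarrow> smooth f \<and> compact (supp f)"

definition schwartz :: "(real^'n::finite \<Rightarrow> complex) \<Rightarrow> bool" where
  "schwartz f \<longleftrightarrow> smooth f \<and>
     (\<forall>k is. bounded (range (\<lambda>x. norm x ^ k *\<^sub>R partial_derivs is f x)))"

definition fourier :: "(real^'n::finite \<Rightarrow> complex) \<Rightarrow> real^'n \<Rightarrow> complex" where
  "fourier f \<xi> = (LINT x|lborel. cis (- (\<xi> \<bullet> x)) * f x)"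

definition multiplier ::
  "(real^'n::finite \<Rightarrow> complex) \<Rightarrow> (real^'n \<Rightarrow> complex) \<Rightarrow> real^'n \<Rightarrow> complex" where
  "multiplier \<tau> f x =
     complex_of_real (inverse ((2 * pi) ^ CARD('n))) *
     (LINT \<xi>|lborel. cis (x \<bullet> \<xi>) * \<tau> \<xi> * fourier f \<xi>)"

text \<open>The norms take values in \<^typ>\<open>ennreal\<close>, so none of them silently becomes 0 when infinite.\<close>

definition L1_norm :: "(real^'n::finite \<Rightarrow> complex) \<Rightarrow> ennreal" where
  "L1_norm f = (\<integral>\<^sup>+x. ennreal (norm (f x)) \<partial>lborel)"

definition Linf_norm :: "(real^'n::finite \<Rightarrow> complex) \<Rightarrow> ennreal" where
  "Linf_norm f = esssup lborel (\<lambda>x. ennreal (norm (f x)))"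

definition conv ::
  "(real^'n::finite \<Rightarrow> complex) \<Rightarrow> (real^'n \<Rightarrow> complex) \<Rightarrow> real^'n \<Rightarrow> complex" where
  "conv f g x = (LINT y|lborel. f (x - y) * g y)"

definition dilate :: "real \<Rightarrow> (real^'n::finite \<Rightarrow> complex) \<Rightarrow> real^'n \<Rightarrow> complex" where
  "dilate t \<Phi> x = complex_of_real (inverse (t ^ CARD('n))) * \<Phi> (x /\<^sub>R t)"

definition h1_norm :: "(real^'n::finite \<Rightarrow> complex) \<Rightarrow> (real^'n \<Rightarrow> complex) \<Rightarrow> ennreal" where
  "h1_norm \<Phi> h =
     (\<integral>\<^sup>+x. (SUP t\<in>{0<..<1}. ennreal (norm (conv (dilate t \<Phi>) h x))) \<partial>lborel)"

end

theory Submission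
  imports Defs "HOL-Probability.Characteristic_Functions" "HOL-Real_Asymp.Real_Asymp"
begin

text \<open>
  Let \<open>T\<close> be the operator with symbol \<open>exp (i |\<xi>|^s)\<close>. It moves a wave packet of frequency \<open>\<mu>\<close> with
  \<open>|\<mu>| ~ M\<close> and width about \<open>M^(s/2 - 1)\<close> by minus the gradient of \<open>|\<xi>|^s\<close> at \<open>\<mu>\<close>, without spreading it.
  Adding \<open>M^(ns/2)\<close> such packets whose frequencies fill a cube of size \<open>M\<close> and whose centres are chosen
  so that \<open>T\<close> takes all of them to the origin in phase gives a function that is bounded uniformly
  in \<open>M\<close>, because the centres are separated, while its image under \<open>T\<close> has size \<open>M^(ns/2)\<close> on a ball
  of radius about \<open>1/M\<close>.

  With \<open>N = 2^j\<close> take for \<open>h\<close> an \<open>L^1\<close>-normalised Gaussian of width \<open>1/N\<close>. Testing \<open>T h\<close> against the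
  bounded function above at frequency \<open>N\<close> shows that its \<open>L^1\<close> norm over the ball of radius \<open>2 N^(s-1)\<close> is
  at least of order \<open>N^(ns/2)\<close>. For \<open>f = g\<close> take the function above with \<open>M ~ N^(1-s)\<close>, so that \<open>T f\<close> and \<open>T g\<close>
  have size \<open>N^(ns(1-s)/2)\<close> on all of that ball. The local Hardy norm of \<open>h\<close> is \<open>O(N^\<epsilon>)\<close> for every
  \<open>\<epsilon> > 0\<close>, and comparing powers of \<open>N\<close> gives the claim.
\<close>

section \<open>Gaussian integrals\<close>

text \<open>Two requirements on the packets pull against each other, and
  \<open>\<delta>\<^sup>2 * M powr (s - 2)\<close> decides both. It is the size of the Hessian of
  |\<xi>|^s times the square of the frequency width \<delta>, so it must be small for T not to
  spread a packet. Up to a constant it is also the distance between neighbouring centres measured in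
  packet widths 1/\<delta>, so it must stay away from 0 if the sum is to remain bounded. Confining
  it between two positive constants forces \<delta> ~ M^(1 - s/2), which is where the number M^(s/2)
  of frequencies per coordinate comes from. The centres separate because the gradient of |\<xi>|^s
  multiplies distances by at least s (1 - s) (2 M)^(s-2), which is positive for 0 < s < 1. The lower
  bound for T h comes from duality alone instead of asymptotics of an oscillatory kernel. The
  resulting powers of N are m, then ns(1-s)/2 for each of T f and T g, and ns/2 for T h, against
  \<epsilon> for the Hardy norm; so m + ns(1-s) + ns/2 \<le> \<epsilon>, and \<epsilon> tends to
  0.\<close>

lemma
  fixes f :: "'a::euclidean_space \<Rightarrow> real \<Rightarrow> 'b::{real_normed_field,banach,second_countable_topology}"
  assumes int: "\<And>b. b \<in> Basis \<Longrightarrow> integrable lborel (f b)"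
  shows integrable_lborel_prod: "integrable lborel (\<lambda>x::'a. \<Prod>b\<in>Basis. f b (x \<bullet> b))"
    and integral_lborel_prod:
      "(LINT x|lborel. (\<Prod>b\<in>Basis. f b (x \<bullet> b))) = (\<Prod>b\<in>Basis. (LINT t|lborel. f b t))"
proof -
  interpret product_sigma_finite "\<lambda>_::'a. lborel :: real measure" ..
  have [measurable]: "\<And>b. b \<in> Basis \<Longrightarrow> f b \<in> borel_measurable borel"
    using borel_measurable_integrable[OF int] by simp
  have inner: "(\<Sum>c\<in>Basis. g c *\<^sub>R c) \<bullet> b = g b" if "b \<in> Basis" for b and g :: "'a \<Rightarrow> real"
    using that by (simp add: inner_sum_left_Basis)
  have [measurable]: "(\<lambda>g. \<Sum>b\<in>Basis. g b *\<^sub>R b) \<in> measurable (\<Pi>\<^sub>M b\<in>Basis. lborel :: real measure) (borel :: 'a measure)"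
    by measurable
  have [measurable]: "(\<lambda>x::'a. \<Prod>b\<in>Basis. f b (x \<bullet> b)) \<in> borel_measurable borel"
    by measurable
  have eq: "(\<Prod>b\<in>Basis. f b ((\<Sum>c\<in>Basis. g c *\<^sub>R c) \<bullet> b)) = (\<Prod>b\<in>Basis. f b (g b))" for g
    by (rule prod.cong) (simp_all add: inner)
  show "integrable lborel (\<lambda>x::'a. \<Prod>b\<in>Basis. f b (x \<bullet> b))"
    unfolding lborel_eq[where 'a='a] by (subst integrable_distr_eq) (auto simp: eq intro!: product_integrable_prod int)
  show "(LINT x|lborel. (\<Prod>b\<in>Basis. f b (x \<bullet> b))) = (\<Prod>b\<in>Basis. (LINT t|lborel. f b t))"
    unfolding lborel_eq[where 'a='a] by (subst integral_distr) (auto simp: eq intro!: product_integral_prod int)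
qed

lemma
  fixes c :: real and t :: "'a::euclidean_space" and f :: "'a \<Rightarrow> 'b::{banach, second_countable_topology}"
  assumes c: "c \<noteq> 0"
  shows integral_lborel_affine:
      "(LINT x|lborel. f x) = \<bar>c\<bar> ^ DIM('a) *\<^sub>R (LINT x|lborel. f (t + c *\<^sub>R x))"
    and integrable_lborel_affine: "integrable lborel (\<lambda>x. f (t + c *\<^sub>R x)) \<longleftrightarrow> integrable lborel f"
proof -
  have aff: "integrable lborel (\<lambda>x. f (t + c *\<^sub>R x))" if "c \<noteq> 0" "integrable lborel f"
    for c t and f :: "'a \<Rightarrow> 'b"
  proof -
    have [measurable]: "f \<in> borel_measurable borel"
      using borel_measurable_integrable[OF that(2)] by simp
    have "integrable (density (distr lborel borel (\<lambda>x. t + c *\<^sub>R x)) (\<lambda>_. ennreal (\<bar>c\<bar>^DIM('a)))) f"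
      using that by (simp add: lborel_affine[of c t, symmetric])
    hence "integrable lborel (\<lambda>x. (\<bar>c\<bar>^DIM('a)) *\<^sub>R f (t + c *\<^sub>R x))"
      by (simp add: integrable_density integrable_distr_eq)
    hence "integrable lborel (\<lambda>x. inverse (\<bar>c\<bar>^DIM('a)) *\<^sub>R (\<bar>c\<bar>^DIM('a)) *\<^sub>R f (t + c *\<^sub>R x))"
      by (rule integrable_scaleR_right)
    moreover have "(\<lambda>x. inverse (\<bar>c\<bar>^DIM('a)) *\<^sub>R (\<bar>c\<bar>^DIM('a)) *\<^sub>R f (t + c *\<^sub>R x)) = (\<lambda>x. f (t + c *\<^sub>R x))"
      unfolding scaleR_scaleR using that(1) by simp
    ultimately show ?thesis by (rule subst[rotated])
  qed
  have inv: "(\<lambda>x. f (t + c *\<^sub>R (- t /\<^sub>R c + inverse c *\<^sub>R x))) = f"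
    using c by (auto simp: fun_eq_iff algebra_simps)
  show iff: "integrable lborel (\<lambda>x. f (t + c *\<^sub>R x)) \<longleftrightarrow> integrable lborel f"
    using aff[of c f t] aff[of "inverse c" "\<lambda>x. f (t + c *\<^sub>R x)" "- t /\<^sub>R c"] c unfolding inv by auto
  show "(LINT x|lborel. f x) = \<bar>c\<bar> ^ DIM('a) *\<^sub>R (LINT x|lborel. f (t + c *\<^sub>R x))"
  proof (cases "integrable lborel f")
    case True
    then have [measurable]: "f \<in> borel_measurable borel"
      using borel_measurable_integrable by fastforce
    show ?thesis
      by (subst lborel_affine[OF c, of t]) (simp add: integral_density integral_distr)
  next
    \<comment> \<open>Both integrals take the default value 0 here, so the substitution formula
      holds for every function.\<close>
    case False
    thus ?thesis using iff by (simp add: not_integrable_integral_eq)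
  qed
qed

lemma cis_measurable [measurable]: "cis \<in> borel_measurable borel"
  by (intro borel_measurable_continuous_onI continuous_intros)

text \<open>The factor 1/2 in the exponent makes this, up to a constant, its own Fourier
  transform.\<close>

definition gauss :: "'a::euclidean_space \<Rightarrow> real" where
  "gauss x = exp (- (norm x)\<^sup>2 / 2)"

lemma gauss_measurable [measurable]: "gauss \<in> borel_measurable borel"
  unfolding gauss_def by measurable

lemma gauss_pos: "0 < gauss x" and gauss_le_1: "gauss x \<le> 1"
  by (simp_all add: gauss_def)

lemma gauss_prod: "gauss x = (\<Prod>b\<in>Basis. exp (- (x \<bullet> b)\<^sup>2 / 2))"
proof -
  have "(norm x)\<^sup>2 = (\<Sum>b\<in>Basis. (x \<bullet> b)\<^sup>2)"
    unfolding power2_norm_eq_inner by (subst euclidean_inner) (simp add: power2_eq_square)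
  thus ?thesis
    unfolding gauss_def by (subst exp_sum[symmetric]) (simp_all add: sum_negf sum_divide_distrib)
qed

lemma integrable_gauss: "integrable lborel (gauss :: 'a::euclidean_space \<Rightarrow> real)"
proof -
  have "integrable lborel (\<lambda>x. sqrt (2 * pi) * std_normal_density x)"
    by (intro integrable_mult_right) simp
  hence "integrable lborel (\<lambda>x::real. exp (- x\<^sup>2 / 2))"
    by (simp add: std_normal_density_def)
  thus ?thesis unfolding gauss_prod[abs_def]
    by (intro integrable_lborel_prod)
qed

text \<open>The integrand factorises over the coordinates, and each factor is the characteristic
  function of the standard normal distribution, taken at \<open>- t\<close> because
  \<open>fourier\<close> has the opposite sign in its exponent.\<close>

lemma fourier_gauss:
  fixes \<xi> :: "'a::euclidean_space"
  shows "(LINT x|lborel. cis (- (\<xi> \<bullet> x)) * complex_of_real (gauss x)) =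
    complex_of_real (sqrt (2 * pi) ^ DIM('a) * gauss \<xi>)"
proof -
  have i1: "integrable lborel (\<lambda>x::real. exp (- x\<^sup>2 / 2))"
    using integrable_gauss[where 'a=real] by (simp add: gauss_def[abs_def])
  have i2: "integrable lborel (\<lambda>x::real. cis (- (t * x)) * complex_of_real (exp (- x\<^sup>2 / 2)))" for t
    by (rule Bochner_Integration.integrable_bound[OF i1]) (measurable, simp add: norm_mult)
  have v: "(LINT x|lborel. cis (- (t * x)) * complex_of_real (exp (- x\<^sup>2 / 2))) = complex_of_real (sqrt (2*pi) * exp (- t\<^sup>2 / 2))" for t :: real
  proof -
    have "complex_of_real (exp (- t\<^sup>2 / 2)) = char std_normal_distribution (- t)"
      by (simp add: char_std_normal_distribution)
    also have "\<dots> = (LINT x|lborel. std_normal_density x *\<^sub>R cis (- (t * x)))"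
      unfolding char_def by (subst integral_density) (auto simp: normal_density_nonneg cis_conv_exp mult_ac)
    finally have "complex_of_real (sqrt (2*pi) * exp (- t\<^sup>2 / 2)) =
      (LINT x|lborel. complex_of_real (sqrt (2*pi)) * (std_normal_density x *\<^sub>R cis (- (t * x))))"
      by (simp only: of_real_mult integral_mult_right_zero)
    also have "\<dots> = (LINT x|lborel. cis (- (t * x)) * complex_of_real (exp (- x\<^sup>2 / 2)))"
      by (rule Bochner_Integration.integral_cong) (simp_all add: std_normal_density_def scaleR_conv_of_real field_simps real_sqrt_mult)
    finally show ?thesis by simp
  qed
  have cis_sum': "finite A \<Longrightarrow> cis (\<Sum>b\<in>A. g b) = (\<Prod>b\<in>A. cis (g b))" for A and g :: "'a \<Rightarrow> real"
    by (induction A rule: finite_induct) (auto simp: cis_mult[symmetric])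
  have "cis (- (\<xi> \<bullet> x)) * complex_of_real (gauss x)
      = (\<Prod>b\<in>Basis. cis (- ((\<xi> \<bullet> b) * (x \<bullet> b))) * complex_of_real (exp (- (x \<bullet> b)\<^sup>2 / 2)))" for x
    unfolding gauss_prod prod.distrib of_real_prod cis_sum'[OF finite_Basis, symmetric]
    by (subst euclidean_inner) (simp add: sum_negf)
  then have "(LINT x|lborel. cis (- (\<xi> \<bullet> x)) * complex_of_real (gauss x)) =
     (\<Prod>b\<in>Basis. complex_of_real (sqrt (2*pi) * exp (- (\<xi> \<bullet> b)\<^sup>2 / 2)))"
    by (simp only: v
        integral_lborel_prod[where f = "\<lambda>b t. cis (- ((\<xi> \<bullet> b) * t)) * complex_of_real (exp (- t\<^sup>2 / 2))", OF i2])
  also have "\<dots> = complex_of_real (sqrt (2 * pi) ^ DIM('a) * gauss \<xi>)"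
    unfolding gauss_prod by (simp only: of_real_prod[symmetric] prod.distrib prod_constant of_real_mult of_real_power)
  finally show ?thesis .
qed

section \<open>Wave packets\<close>

text \<open>Width \<open>1 / \<delta>\<close> around \<open>a\<close> in space, width
  \<open>\<delta>\<close> around \<open>\<mu>\<close> in frequency. The modulation is
  \<open>cis (\<mu> \<bullet> x)\<close> rather than \<open>cis (\<mu> \<bullet> (x - a))\<close>:
  the phase of the transform then vanishes at \<open>\<mu>\<close> and is linear in
  \<open>\<xi> - \<mu>\<close>, so a suitable \<open>a\<close> cancels the linear Taylor term of
  |\<xi>|^s.\<close>

definition packet :: "real^'n \<Rightarrow> real \<Rightarrow> real^'n \<Rightarrow> real^'n \<Rightarrow> complex" where
  "packet \<mu> \<delta> a x = cis (\<mu> \<bullet> x) * complex_of_real (gauss (\<delta> *\<^sub>R (x - a)))"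

lemma packet_measurable [measurable]: "packet \<mu> \<delta> a \<in> borel_measurable borel"
  unfolding packet_def by measurable

lemma norm_packet: "norm (packet \<mu> \<delta> a x) = gauss (\<delta> *\<^sub>R (x - a))"
  using gauss_pos[of "\<delta> *\<^sub>R (x - a)"] by (simp add: packet_def norm_mult)

lemma integrable_gauss_affine:
  assumes "\<delta> \<noteq> 0"
  shows "integrable lborel (\<lambda>x. gauss (\<delta> *\<^sub>R (x - a)))"
  using integrable_lborel_affine[of \<delta> gauss "- \<delta> *\<^sub>R a"] integrable_gauss assms
  by (simp add: algebra_simps)

lemma integrable_packet: "\<delta> \<noteq> 0 \<Longrightarrow> integrable lborel (packet \<mu> \<delta> a)"
  by (rule Bochner_Integration.integrable_bound[OF integrable_gauss_affine[of \<delta> a]])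
     (auto simp: norm_packet gauss_pos less_imp_le)

lemma fourier_packet:
  fixes \<mu> a :: "real^'n"
  assumes "\<delta> > 0"
  shows "fourier (packet \<mu> \<delta> a) \<xi> = cis (- ((\<xi> - \<mu>) \<bullet> a)) *
    complex_of_real ((sqrt (2 * pi) / \<delta>) ^ CARD('n) * gauss ((\<xi> - \<mu>) /\<^sub>R \<delta>))"
proof -
  have "fourier (packet \<mu> \<delta> a) \<xi> =
    (inverse \<delta>) ^ CARD('n) *\<^sub>R (LINT x|lborel. cis (- (\<xi> \<bullet> (a + inverse \<delta> *\<^sub>R x))) *
      packet \<mu> \<delta> a (a + inverse \<delta> *\<^sub>R x))"
    unfolding fourier_def using assms by (subst integral_lborel_affine[of "inverse \<delta>" _ a]) simp_all
  also have "(\<lambda>x. cis (- (\<xi> \<bullet> (a + inverse \<delta> *\<^sub>R x))) * packet \<mu> \<delta> a (a + inverse \<delta> *\<^sub>R x)) =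
      (\<lambda>x. cis (- ((\<xi> - \<mu>) \<bullet> a)) * (cis (- (((\<xi> - \<mu>) /\<^sub>R \<delta>) \<bullet> x)) * complex_of_real (gauss x)))"
    unfolding packet_def mult.assoc[symmetric] cis_mult using assms
    by (intro ext arg_cong2[where f="(*)"] arg_cong[where f=cis] arg_cong[where f=complex_of_real] arg_cong[where f=gauss])
       (simp_all add: algebra_simps inner_simps)
  also have "(LINT x|lborel. cis (- ((\<xi> - \<mu>) \<bullet> a)) * (cis (- (((\<xi> - \<mu>) /\<^sub>R \<delta>) \<bullet> x)) * complex_of_real (gauss x)))
    = cis (- ((\<xi> - \<mu>) \<bullet> a)) * complex_of_real (sqrt (2 * pi) ^ DIM(real^'n) * gauss ((\<xi> - \<mu>) /\<^sub>R \<delta>))"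
    by (subst fourier_gauss[symmetric]) simp
  finally show ?thesis
    using assms by (simp add: scaleR_conv_of_real field_simps power_divide)
qed

text \<open>Linear combinations of polynomials times packets of one width. The closure rules are
  those that the product rule consumes, so the class is stable under partial derivatives and yields
  the Schwartz property without formulas for iterated derivatives.\<close>

inductive gauss_class :: "real \<Rightarrow> (real^'n \<Rightarrow> complex) \<Rightarrow> bool" for \<delta> where
  packet: "gauss_class \<delta> (packet \<mu> \<delta> a)"
| coord: "gauss_class \<delta> f \<Longrightarrow> gauss_class \<delta> (\<lambda>x. complex_of_real (x $ i) * f x)"
| scale: "gauss_class \<delta> f \<Longrightarrow> gauss_class \<delta> (\<lambda>x. c * f x)"
| add: "gauss_class \<delta> f \<Longrightarrow> gauss_class \<delta> g \<Longrightarrow> gauss_class \<delta> (\<lambda>x. f x + g x)"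

lemma gauss_class_sum:
  assumes "finite I" "\<And>k. k \<in> I \<Longrightarrow> gauss_class \<delta> (f k)"
  shows "gauss_class \<delta> (\<lambda>x. \<Sum>k\<in>I. f k x)"
  using assms
proof (induction I rule: finite_induct)
  case empty
  show ?case using scale[OF packet, of _ 0] by simp
next
  case (insert k I)
  thus ?case by (simp add: gauss_class.add)
qed

text \<open>Writing the packet as one complex exponential of a quadratic polynomial leaves a single
  use of the chain rule.\<close>

lemma packet_has_derivative:
  "(packet \<mu> \<delta> a has_derivative
     (\<lambda>h. (\<i> * complex_of_real (\<mu> \<bullet> h) - complex_of_real (\<delta>\<^sup>2 * ((x - a) \<bullet> h))) * packet \<mu> \<delta> a x)) (at x)"
proof -
  have eq: "packet \<mu> \<delta> a = (\<lambda>x. exp (\<i> * complex_of_real (\<mu> \<bullet> x) - complex_of_real (\<delta>\<^sup>2 / 2 * ((x - a) \<bullet> (x - a)))))"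
  proof
    fix x
    define A r where "A = \<mu> \<bullet> x" and "r = \<delta>\<^sup>2 / 2 * ((x - a) \<bullet> (x - a))"
    have r: "- (norm (\<delta> *\<^sub>R (x - a)))\<^sup>2 / 2 = - r"
      by (simp add: power_mult_distrib power2_norm_eq_inner r_def)
    have "exp (\<i> * complex_of_real A - complex_of_real r) = exp (\<i> * complex_of_real A + complex_of_real (- r))"
      by simp
    also have "\<dots> = cis A * complex_of_real (exp (- r))"
      by (simp only: exp_add exp_of_real cis_conv_exp)
    also have "\<dots> = packet \<mu> \<delta> a x"
      unfolding packet_def gauss_def r A_def ..
    finally show "packet \<mu> \<delta> a x = exp (\<i> * complex_of_real (\<mu> \<bullet> x) - complex_of_real (\<delta>\<^sup>2 / 2 * ((x - a) \<bullet> (x - a))))"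
      unfolding A_def r_def by simp
  qed
  define E where "E = (\<lambda>x. \<i> * complex_of_real (\<mu> \<bullet> x) - complex_of_real (\<delta>\<^sup>2 / 2 * ((x - a) \<bullet> (x - a))))"
  define E' where "E' = (\<lambda>h. \<i> * complex_of_real (\<mu> \<bullet> h) - complex_of_real (\<delta>\<^sup>2 * ((x - a) \<bullet> h)))"
  have 1: "((\<lambda>x. \<mu> \<bullet> x) has_derivative (\<lambda>h. \<mu> \<bullet> h)) (at x)"
    by (intro derivative_intros)
  have 2: "((\<lambda>x. \<delta>\<^sup>2 / 2 * ((x - a) \<bullet> (x - a))) has_derivative (\<lambda>h. \<delta>\<^sup>2 * ((x - a) \<bullet> h))) (at x)"
    by (rule derivative_eq_intros refl)+ (auto simp: fun_eq_iff inner_commute algebra_simps)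
  have "(E has_derivative E') (at x)"
    unfolding E_def E'_def by (intro derivative_intros 1 2)
  moreover have "(exp has_derivative (\<lambda>h. exp (E x) * h)) (at (E x))"
    using DERIV_exp[of "E x"] by (simp add: has_field_derivative_def)
  ultimately have "((\<lambda>x. exp (E x)) has_derivative (\<lambda>h. exp (E x) * E' h)) (at x)"
    by (rule has_derivative_compose)
  thus ?thesis
    unfolding eq E_def[symmetric] E'_def[symmetric] by (simp add: mult.commute E_def E'_def)
qed

lemma gauss_class_deriv:
  fixes f :: "real^'n \<Rightarrow> complex"
  assumes "gauss_class \<delta> f"
  shows "\<exists>f'. (\<forall>x. (f has_derivative f' x) (at x)) \<and> (\<forall>i. gauss_class \<delta> (\<lambda>x. f' x (axis i 1)))"
  using assms
proof (induction rule: gauss_class.induct)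
  case (packet \<mu> a)
  have "gauss_class \<delta> (\<lambda>x. (\<i> * complex_of_real (\<mu> \<bullet> axis i 1) - complex_of_real (\<delta>\<^sup>2 * ((x - a) \<bullet> axis i 1))) * packet \<mu> \<delta> a x)" for i
  proof -
    have "gauss_class \<delta> (\<lambda>x. (\<i> * complex_of_real (\<mu> $ i) + complex_of_real (\<delta>\<^sup>2 * a $ i)) * packet \<mu> \<delta> a x
        + (- complex_of_real (\<delta>\<^sup>2)) * (complex_of_real (x $ i) * packet \<mu> \<delta> a x))"
      by (intro gauss_class.intros)
    thus ?thesis by (rule back_subst[where P="gauss_class \<delta>"]) (auto simp: fun_eq_iff inner_axis algebra_simps)
  qed
  with packet_has_derivative[of \<mu> \<delta> a] show ?case
    by (intro exI conjI allI)
next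
  case (coord f j)
  then obtain f' where f': "\<And>x. (f has_derivative f' x) (at x)" "\<And>i. gauss_class \<delta> (\<lambda>x. f' x (axis i 1))"
    by blast
  have "((\<lambda>x. complex_of_real (x $ j)) has_derivative (\<lambda>h. complex_of_real (h $ j))) (at x)" for x :: "real^'n"
    by (intro derivative_intros bounded_linear_imp_has_derivative[OF bounded_linear_vec_nth])
  hence d: "((\<lambda>x. complex_of_real (x $ j) * f x) has_derivative
      (\<lambda>h. complex_of_real (x $ j) * f' x h + complex_of_real (h $ j) * f x)) (at x)" for x
    by (intro has_derivative_mult f')
  have "gauss_class \<delta> (\<lambda>x. complex_of_real (x $ j) * f' x (axis i 1) + complex_of_real (axis i 1 $ j) * f x)" for i
    by (intro gauss_class.intros f' coord)
  thus ?case using d by (intro exI[of _ "\<lambda>x h. complex_of_real (x $ j) * f' x h + complex_of_real (h $ j) * f x"]) blast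
next
  case (scale f c)
  then obtain f' where f': "\<And>x. (f has_derivative f' x) (at x)" "\<And>i. gauss_class \<delta> (\<lambda>x. f' x (axis i 1))"
    by blast
  show ?case
    by (intro exI[of _ "\<lambda>x h. c * f' x h"] conjI allI gauss_class.intros f' has_derivative_mult_right)
next
  case (add f g)
  then obtain f' g' where f': "\<And>x. (f has_derivative f' x) (at x)" "\<And>i. gauss_class \<delta> (\<lambda>x. f' x (axis i 1))"
      "\<And>x. (g has_derivative g' x) (at x)" "\<And>i. gauss_class \<delta> (\<lambda>x. g' x (axis i 1))"
    by blast
  show ?case
    by (intro exI[of _ "\<lambda>x h. f' x h + g' x h"] conjI allI gauss_class.intros f' has_derivative_add)
qed

lemma gauss_class_partial_derivs:
  assumes "gauss_class \<delta> f"
  shows "gauss_class \<delta> (partial_derivs is f)"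
proof (induction "is")
  case Nil
  thus ?case using assms by (simp add: partial_derivs_def)
next
  case (Cons i "is")
  obtain f' where f': "\<And>x. (partial_derivs is f has_derivative f' x) (at x)"
      "\<And>i. gauss_class \<delta> (\<lambda>x. f' x (axis i 1))"
    using gauss_class_deriv[OF Cons] by blast
  have "partial_derivs (i # is) f = (\<lambda>x. f' x (axis i 1))"
    using frechet_derivative_at[OF f'(1)] by (auto simp: partial_derivs_def partial_deriv_def fun_eq_iff)
  thus ?case using f'(2) by simp
qed

text \<open>\<open>k\<close> stays arbitrary in the induction because a coordinate factor is
  absorbed by one more power of \<open>norm x\<close>.\<close>

lemma gauss_class_bounded:
  assumes "gauss_class \<delta> f" "\<delta> > 0"
  shows "\<exists>C. \<forall>x. norm x ^ k * norm (f x) \<le> C"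
  using assms(1)
proof (induction arbitrary: k rule: gauss_class.induct)
  case (packet \<mu> a)
  have "norm x ^ k * gauss (\<delta> *\<^sub>R (x - a)) \<le>
      exp (real k * (norm a + real k / \<delta>\<^sup>2))" for x
  proof -
    \<comment> \<open>Bounding \<open>norm x\<close> by an exponential of |a| + |x - a| turns the
      power into an exponential, which the Gaussian beats after completing the square in |x -
      a|.\<close>
    have "norm x \<le> norm a + norm (x - a)"
      using norm_triangle_sub[of x a] by simp
    also have "\<dots> \<le> exp (norm a + norm (x - a))"
      using exp_ge_add_one_self[of "norm a + norm (x - a)"] by linarith
    finally have "norm x ^ k \<le> exp (norm a + norm (x - a)) ^ k"
      by (rule power_mono) simp
    also have "\<dots> = exp (real k * (norm a + norm (x - a)))"
      by (simp add: exp_of_nat_mult)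
    finally have "norm x ^ k * gauss (\<delta> *\<^sub>R (x - a)) \<le>
      exp (real k * (norm a + norm (x - a))) * gauss (\<delta> *\<^sub>R (x - a))"
      by (intro mult_right_mono) (auto simp: gauss_pos less_imp_le)
    also have "\<dots> = exp (real k * (norm a + norm (x - a)) - \<delta>\<^sup>2 * (norm (x - a))\<^sup>2 / 2)"
      unfolding gauss_def exp_add[symmetric] by (simp add: power_mult_distrib)
    also have "real k * (norm a + norm (x - a)) - \<delta>\<^sup>2 * (norm (x - a))\<^sup>2 / 2 \<le> real k * (norm a + real k / \<delta>\<^sup>2)"
    proof -
      have "0 \<le> (\<delta> * norm (x - a) - real k / \<delta>)\<^sup>2" by simp
      also have "\<dots> = \<delta>\<^sup>2 * (norm (x - a))\<^sup>2 - 2 * real k * norm (x - a) + (real k)\<^sup>2 / \<delta>\<^sup>2"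
        using assms(2) by (simp add: power2_diff power_mult_distrib power_divide)
      finally have "2 * real k * norm (x - a) \<le> \<delta>\<^sup>2 * (norm (x - a))\<^sup>2 + (real k)\<^sup>2 / \<delta>\<^sup>2"
        by simp
      moreover have "real k * (real k / \<delta>\<^sup>2) = (real k)\<^sup>2 / \<delta>\<^sup>2"
        by (simp add: power2_eq_square)
      moreover have "0 \<le> (real k)\<^sup>2 / \<delta>\<^sup>2"
        by simp
      ultimately show ?thesis
        unfolding distrib_left by argo
    qed
    finally show ?thesis by simp
  qed
  thus ?case by (auto simp: norm_packet)
next
  case (coord f i)
  obtain C where C: "\<forall>x. norm x ^ Suc k * norm (f x) \<le> C" using coord(2) by blast
  have "norm x ^ k * norm (complex_of_real (x $ i) * f x) \<le> C" for x
  proof -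
    have "norm x ^ k * norm (complex_of_real (x $ i) * f x) = norm x ^ k * (\<bar>x $ i\<bar> * norm (f x))"
      by (simp add: norm_mult)
    also have "\<dots> \<le> norm x ^ k * (norm x * norm (f x))"
      by (intro mult_left_mono mult_right_mono component_le_norm_cart) auto
    also have "\<dots> \<le> C" using C by (simp add: mult_ac)
    finally show ?thesis .
  qed
  thus ?case by blast
next
  case (scale f c)
  obtain C where C: "\<forall>x. norm x ^ k * norm (f x) \<le> C" using scale(2) by blast
  have "norm x ^ k * norm (c * f x) \<le> norm c * C" for x
    using mult_left_mono[OF C[rule_format, of x], of "norm c"] by (simp add: norm_mult mult_ac)
  thus ?case by blast
next
  case (add f g)
  obtain C where C: "\<forall>x. norm x ^ k * norm (f x) \<le> C" using add(3) by blast
  obtain D where D: "\<forall>x. norm x ^ k * norm (g x) \<le> D" using add(4) by blast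
  have "norm x ^ k * norm (f x + g x) \<le> C + D" for x
  proof -
    have "norm x ^ k * norm (f x + g x) \<le> norm x ^ k * (norm (f x) + norm (g x))"
      by (intro mult_left_mono norm_triangle_ineq) simp
    also have "\<dots> \<le> C + D" using C[rule_format, of x] D[rule_format, of x] by (simp add: algebra_simps)
    finally show ?thesis .
  qed
  thus ?case by blast
qed

lemma schwartz_gauss_class:
  assumes "gauss_class \<delta> f" "\<delta> > 0"
  shows "schwartz f"
  unfolding schwartz_def smooth_def
proof (intro conjI allI)
  fix "is" x
  show "partial_derivs is f differentiable at x"
    using gauss_class_deriv[OF gauss_class_partial_derivs[OF assms(1)], of "is"] unfolding differentiable_def by blast
next
  fix k "is"
  obtain C where "\<forall>x. norm x ^ k * norm (partial_derivs is f x) \<le> C"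
    using gauss_class_bounded[OF gauss_class_partial_derivs[OF assms(1)] assms(2)] by blast
  thus "bounded (range (\<lambda>x. norm x ^ k *\<^sub>R partial_derivs is f x))"
    by (auto simp: bounded_iff)
qed

section \<open>The phase function and its gradient\<close>

lemma norm_cis_minus_1: "norm (cis t - 1) \<le> \<bar>t\<bar>"
  using iexp_approx1[of t 0] by (simp add: cis_conv_exp)

text \<open>Concavity, in the form of the weighted arithmetic-geometric mean inequality for
  \<open>u\<close> and 1 with weights \<open>b\<close> and \<open>1 - b\<close>.\<close>

lemma powr_le_tangent:
  fixes u b :: real
  assumes "0 \<le> u" "0 < b" "b < 1"
  shows "u powr b \<le> 1 + b * (u - 1)"
proof (cases "u = 0")
  case False
  thus ?thesis using Youngs_inequality_0[of b "1 - b" u 1] assms by (simp add: algebra_simps)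
qed (use assms in simp)

text \<open>The upper half is the tangent inequality. For the lower half, the same inequality with
  exponent 1 - b gives u^b = u / u^(1-b) \<ge> u / w for w = 1 + (1 - b) v and v = u - 1, and the
  defect 1 + b v - u / w equals b (1 - b) v^2 / w, where w > b. The estimate is uniform down to u =
  0, although the second derivative of the power blows up there.\<close>

lemma powr_taylor:
  fixes u b :: real
  assumes u: "0 \<le> u" and b: "0 < b" "b < 1"
  shows "\<bar>u powr b - 1 - b * (u - 1)\<bar> \<le> (u - 1)\<^sup>2"
proof (cases "u = 0")
  case False
  define v where "v = u - 1"
  have v: "v > -1" using u False by (simp add: v_def)
  define w where "w = 1 + (1 - b) * v"
  have "(1 - b) * v > (1 - b) * (-1)"
    using b v by (intro mult_strict_left_mono) auto
  hence w: "w > b" by (simp add: w_def)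
  have "u powr (1 - b) \<le> w"
    using powr_le_tangent[of u "1 - b"] u b by (simp add: w_def v_def)
  hence "u / w \<le> u / u powr (1 - b)"
    using u False w b by (intro divide_left_mono) auto
  also have "\<dots> = u powr b"
    using u False by (simp add: powr_diff)
  finally have low: "u / w \<le> u powr b" .
  have "1 + b * v - u / w = b * (1 - b) * v\<^sup>2 / w"
    using w b by (simp add: field_simps v_def w_def power2_eq_square)
  also have "\<dots> \<le> b * (1 - b) * v\<^sup>2 / b"
    using w b by (intro divide_left_mono) auto
  also have "\<dots> \<le> v\<^sup>2"
    using b by (simp add: mult_left_le_one_le)
  finally have "1 + b * v - u powr b \<le> v\<^sup>2" using low by simp
  moreover have "u powr b \<le> 1 + b * v"
    using powr_le_tangent[OF u b] by (simp add: v_def)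
  ultimately show ?thesis unfolding v_def[symmetric] by simp
qed (use b in simp)

text \<open>With r = |\<mu>| and u = |\<mu> + \<eta>|^2 / r^2 one has |\<mu> + \<eta>|^s = r^s
  u^(s/2), so an expansion in one variable at u = 1 suffices, even if \<mu> + \<eta> = 0. The
  constant 10 is 9 + 1: the 9 comes from |u - 1| \<le> 3 |\<eta>| / r, the 1 from the part of u - 1
  that is quadratic in \<eta>.\<close>

lemma norm_powr_taylor:
  fixes \<mu> \<eta> :: "'a::real_inner"
  assumes "\<mu> \<noteq> 0" "norm \<eta> \<le> norm \<mu>" "0 < s" "s < 1"
  shows "\<bar>norm (\<mu> + \<eta>) powr s - norm \<mu> powr s - s * norm \<mu> powr (s - 2) * (\<mu> \<bullet> \<eta>)\<bar>
    \<le> 10 * norm \<mu> powr (s - 2) * (norm \<eta>)\<^sup>2"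
proof -
  define r where "r = norm \<mu>"
  have r: "r > 0" using assms by (simp add: r_def)
  define u where "u = (norm (\<mu> + \<eta>) / r)\<^sup>2"
  have u0: "u \<ge> 0" by (simp add: u_def)
  have rs: "r powr s = r powr (s - 2) * r\<^sup>2"
    using r by (simp add: powr_diff powr_numeral)
  have u1: "r\<^sup>2 * (u - 1) = 2 * (\<mu> \<bullet> \<eta>) + (norm \<eta>)\<^sup>2"
    using r unfolding u_def power_divide
    by (simp add: field_simps power2_norm_eq_inner r_def inner_simps inner_commute)
  have "norm (\<mu> + \<eta>) powr s = (r * sqrt u) powr s"
    using r by (simp add: u_def)
  also have "\<dots> = r powr s * u powr (s / 2)"
    using r u0 by (simp add: powr_mult powr_half_sqrt[symmetric] powr_powr)
  finally have eq: "norm (\<mu> + \<eta>) powr s - r powr s - s * r powr (s - 2) * (\<mu> \<bullet> \<eta>)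
    = r powr s * (u powr (s/2) - 1 - s / 2 * (u - 1)) + s / 2 * r powr (s - 2) * (norm \<eta>)\<^sup>2"
    using u1 unfolding rs by (simp add: algebra_simps) algebra
  have "\<bar>u powr (s/2) - 1 - s / 2 * (u - 1)\<bar> \<le> (u - 1)\<^sup>2"
    using assms by (intro powr_taylor u0) auto
  also have "(u - 1)\<^sup>2 \<le> 9 * (norm \<eta>)\<^sup>2 / r\<^sup>2"
  proof -
    have "\<bar>r\<^sup>2 * (u - 1)\<bar> \<le> 2 * \<bar>\<mu> \<bullet> \<eta>\<bar> + (norm \<eta>)\<^sup>2"
      unfolding u1 using abs_triangle_ineq[of "2 * (\<mu> \<bullet> \<eta>)" "(norm \<eta>)\<^sup>2"] by (simp add: abs_mult)
    also have "\<bar>\<mu> \<bullet> \<eta>\<bar> \<le> r * norm \<eta>"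
      unfolding r_def by (rule Cauchy_Schwarz_ineq2)
    also have "(norm \<eta>)\<^sup>2 \<le> r * norm \<eta>"
      using assms by (simp add: power2_eq_square r_def mult_right_mono)
    finally have "\<bar>r\<^sup>2 * (u - 1)\<bar> \<le> 3 * r * norm \<eta>" by simp
    hence "r * (r * \<bar>u - 1\<bar>) \<le> r * (3 * norm \<eta>)"
      using r by (simp add: abs_mult power2_eq_square mult_ac)
    hence "r * \<bar>u - 1\<bar> \<le> 3 * norm \<eta>"
      using r by (rule mult_left_le_imp_le)
    hence "(r * \<bar>u - 1\<bar>)\<^sup>2 \<le> (3 * norm \<eta>)\<^sup>2"
      using r by (intro power_mono) auto
    thus ?thesis using r by (simp add: power_mult_distrib field_simps)
  qed
  finally have "r powr s * \<bar>u powr (s/2) - 1 - s / 2 * (u - 1)\<bar> \<le> r powr s * (9 * (norm \<eta>)\<^sup>2 / r\<^sup>2)"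
    by (intro mult_left_mono) auto
  also have "\<dots> = 9 * (r powr (s - 2) * (norm \<eta>)\<^sup>2)"
    using r unfolding rs by (simp add: field_simps)
  finally have 1: "\<bar>r powr s * (u powr (s/2) - 1 - s / 2 * (u - 1))\<bar> \<le> 9 * (r powr (s - 2) * (norm \<eta>)\<^sup>2)"
    by (simp add: abs_mult)
  have "s / 2 * (r powr (s - 2) * (norm \<eta>)\<^sup>2) \<le> 1 * (r powr (s - 2) * (norm \<eta>)\<^sup>2)"
    using assms by (intro mult_right_mono) auto
  moreover have "0 \<le> s / 2 * (r powr (s - 2) * (norm \<eta>)\<^sup>2)" using assms by simp
  ultimately show ?thesis
    unfolding eq r_def[symmetric] using 1 by (simp add: mult.assoc)
qed

definition remainder :: "real \<Rightarrow> 'a::real_inner \<Rightarrow> 'a \<Rightarrow> real" where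
  "remainder s \<mu> \<eta> = norm (\<mu> + \<eta>) powr s - norm \<mu> powr s - s * norm \<mu> powr (s - 2) * (\<mu> \<bullet> \<eta>)"

lemma norm_cis_remainder:
  assumes "1 \<le> norm \<mu>" "0 < s" "s < 1"
  shows "norm (cis (remainder s \<mu> \<eta>) - 1) \<le> 10 * norm \<mu> powr (s - 2) * (norm \<eta>)\<^sup>2"
proof (cases "norm \<eta> \<le> norm \<mu>")
  case True
  have "norm (cis (remainder s \<mu> \<eta>) - 1) \<le> \<bar>remainder s \<mu> \<eta>\<bar>"
    by (rule norm_cis_minus_1)
  also have "\<dots> \<le> 10 * norm \<mu> powr (s - 2) * (norm \<eta>)\<^sup>2"
    unfolding remainder_def using True assms by (intro norm_powr_taylor) auto
  finally show ?thesis .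
next
  case False
  have "norm (cis (remainder s \<mu> \<eta>) - 1) \<le> 1 + 1"
    using norm_triangle_ineq4[of "cis (remainder s \<mu> \<eta>)" 1] by simp
  also have "\<dots> \<le> 10 * (norm \<mu> powr (- 2) * (norm \<mu>)\<^sup>2)"
  proof -
    have "norm \<mu> \<noteq> 0" using assms by linarith
    hence "norm \<mu> powr (- 2) * (norm \<mu>)\<^sup>2 = 1"
      by (simp add: powr_minus powr_numeral)
    thus ?thesis by simp
  qed
  also have "\<dots> \<le> 10 * (norm \<mu> powr (s - 2) * (norm \<eta>)\<^sup>2)"
    using assms False by (intro mult_left_mono mult_mono power_mono powr_mono) auto
  finally show ?thesis by (simp add: mult_ac)
qed

text \<open>
  The gradient of \<open>|\<xi>|^s\<close>, hence the centre of a packet of frequency \<open>\<mu>\<close> that \<open>T\<close> takes to the origin.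
\<close>

definition velocity :: "real \<Rightarrow> 'a::real_inner \<Rightarrow> 'a" where
  "velocity s \<mu> = (s * norm \<mu> powr (s - 2)) *\<^sub>R \<mu>"

lemma norm_velocity: "\<mu> \<noteq> 0 \<Longrightarrow> 0 < s \<Longrightarrow> norm (velocity s \<mu>) = s * norm \<mu> powr (s - 1)"
  by (simp add: velocity_def powr_diff power2_eq_square field_simps powr_numeral)

text \<open>The Hessian of |\<xi>|^s has the radial eigenvalue s (s - 1) r^(s-2) and the tangential
  eigenvalue s r^(s-2), of opposite signs, so in general the gradient map is not monotone. Its
  expansion is read off from squared norms instead: |\<mu> - \<nu>|^2 = (q - p)^2 + 2 (p q - x),
  with the mean value theorem for r^(s-1) in the radial part and monotonicity of r^(s-2) in the
  angular part.\<close>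

lemma velocity_expanding:
  fixes \<mu> \<nu> :: "'a::real_inner"
  assumes s: "0 < s" "s < 1" and nz: "\<mu> \<noteq> 0" "\<nu> \<noteq> 0" and R: "norm \<mu> \<le> R" "norm \<nu> \<le> R"
  shows "s * (1 - s) * R powr (s - 2) * norm (\<mu> - \<nu>) \<le> norm (velocity s \<mu> - velocity s \<nu>)"
proof -
  define p q x where "p = norm \<mu>" and "q = norm \<nu>" and "x = \<mu> \<bullet> \<nu>"
  have pq: "p > 0" "q > 0" "p \<le> R" "q \<le> R" using nz R by (auto simp: p_def q_def)
  have x: "x \<le> p * q" unfolding x_def p_def q_def by (rule norm_cauchy_schwarz)
  have p2: "p powr (s - 1) = p powr (s - 2) * p" if "p > 0" for p
    using that by (simp add: powr_diff powr_numeral power2_eq_square)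
  have mvt: "(1 - s) * R powr (s - 2) * (q - p) \<le> \<bar>p powr (s - 1) - q powr (s - 1)\<bar>"
    if "0 < p" "p < q" "q \<le> R" for p q
  proof -
    have "\<exists>z>p. z < q \<and> q powr (s - 1) - p powr (s - 1) = (q - p) * ((s - 1) * z powr (s - 1 - 1))"
      using that by (intro MVT2 has_real_derivative_powr) auto
    then obtain z where z: "p < z" "z < q"
        "q powr (s - 1) - p powr (s - 1) = (q - p) * ((s - 1) * z powr (s - 2))"
      by (auto simp: diff_diff_eq)
    have "R powr (s - 2) \<le> z powr (s - 2)"
      using z that s by (intro powr_mono2') auto
    hence "(1 - s) * (q - p) * R powr (s - 2) \<le> (1 - s) * (q - p) * z powr (s - 2)"
      using s that by (intro mult_left_mono) auto
    also have "\<dots> = p powr (s - 1) - q powr (s - 1)" using z by (simp add: algebra_simps)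
    finally show ?thesis by (simp add: mult_ac)
  qed
  define D where "D = \<bar>p powr (s - 1) - q powr (s - 1)\<bar>"
  have D: "(1 - s) * R powr (s - 2) * \<bar>q - p\<bar> \<le> D"
    using mvt[of p q] mvt[of q p] pq unfolding D_def by (cases p q rule: linorder_cases) (auto simp: abs_minus_commute)
  have "((1 - s) * R powr (s - 2) * \<bar>q - p\<bar>)\<^sup>2 \<le> D\<^sup>2"
    using D s by (intro power_mono) auto
  hence 1: "((1 - s) * R powr (s - 2))\<^sup>2 * (q - p)\<^sup>2 \<le> D\<^sup>2"
    by (simp add: power_mult_distrib)
  \<comment> \<open>The angular part would allow the constant 1; it is weakened to 1 - s so that
    both parts carry the same factor.\<close>
  have "(1 - s)\<^sup>2 * (R powr (s - 2) * R powr (s - 2)) \<le> 1 * (p powr (s - 2) * q powr (s - 2))"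
    using pq s by (intro mult_mono powr_mono2') (auto simp: power_le_one)
  hence 2: "((1 - s) * R powr (s - 2))\<^sup>2 * (2 * (p * q - x)) \<le> p powr (s - 2) * q powr (s - 2) * (2 * (p * q - x))"
    using x by (intro mult_right_mono) (auto simp: power_mult_distrib power2_eq_square mult_ac)
  have "((1 - s) * R powr (s - 2) * norm (\<mu> - \<nu>))\<^sup>2 = ((1 - s) * R powr (s - 2))\<^sup>2 * ((q - p)\<^sup>2 + 2 * (p * q - x))"
    unfolding power_mult_distrib power2_norm_eq_inner
    by (simp add: p_def q_def x_def power2_diff power2_norm_eq_inner inner_simps inner_commute algebra_simps)
  also have "\<dots> \<le> D\<^sup>2 + p powr (s - 2) * q powr (s - 2) * (2 * (p * q - x))"
    using 1 2 by (simp add: distrib_left)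
  also have "\<dots> = (norm (p powr (s - 2) *\<^sub>R \<mu> - q powr (s - 2) *\<^sub>R \<nu>))\<^sup>2"
  proof -
    have "\<mu> \<bullet> \<mu> = p\<^sup>2" "\<nu> \<bullet> \<nu> = q\<^sup>2" by (simp_all add: p_def q_def power2_norm_eq_inner)
    thus ?thesis
      unfolding power2_norm_eq_inner D_def p2[OF pq(1)] p2[OF pq(2)]
      by (simp add: inner_simps inner_commute[of \<nu> \<mu>] x_def[symmetric]) (simp add: power2_eq_square algebra_simps)
  qed
  finally have "(1 - s) * R powr (s - 2) * norm (\<mu> - \<nu>) \<le> norm (p powr (s - 2) *\<^sub>R \<mu> - q powr (s - 2) *\<^sub>R \<nu>)"
    by (rule power2_le_imp_le) simp
  hence "s * ((1 - s) * R powr (s - 2) * norm (\<mu> - \<nu>)) \<le> s * norm (p powr (s - 2) *\<^sub>R \<mu> - q powr (s - 2) *\<^sub>R \<nu>)"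
    using s by (intro mult_left_mono) auto
  also have "\<dots> = norm (s *\<^sub>R (p powr (s - 2) *\<^sub>R \<mu> - q powr (s - 2) *\<^sub>R \<nu>))"
    using s by simp
  finally show ?thesis by (simp add: velocity_def p_def q_def scaleR_diff_right mult_ac)
qed

section \<open>Lattices of frequencies and sums of separated Gaussians\<close>

lemma sum_exp_abs_le:
  fixes A :: "nat set" and \<kappa> :: real
  assumes "finite A" "\<kappa> > 0"
  shows "(\<Sum>k\<in>A. exp (- \<kappa> * \<bar>real k - real l\<bar>)) \<le> 2 * (1 + 1 / \<kappa>)"
proof -
  define r where "r = exp (- \<kappa>)"
  have r: "0 < r" "r < 1" using assms by (auto simp: r_def)
  have geo: "(\<Sum>k\<in>B. r ^ k) \<le> 1 + 1 / \<kappa>" if "finite B" for B :: "nat set"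
  proof -
    have "(\<Sum>k\<in>B. r ^ k) \<le> (\<Sum>k. r ^ k)"
      using r that by (intro sum_le_suminf summable_geometric) auto
    also have "\<dots> = 1 / (1 - r)" using r by (intro suminf_geometric) auto
    also have "\<dots> \<le> 1 + 1 / \<kappa>"
    proof -
      \<comment> \<open>The claim 1 / (1 - r) \<le> 1 + 1 / \<kappa> is equivalent to (1 + \<kappa>)
        r \<le> 1.\<close>
      have "(1 + \<kappa>) * r \<le> exp \<kappa> * r" using r by (intro mult_right_mono exp_ge_add_one_self) auto
      also have "\<dots> = 1" by (simp add: r_def exp_minus)
      finally have "(1 + \<kappa>) * r \<le> 1" .
      thus ?thesis using r assms by (simp add: field_simps)
    qed
    finally show ?thesis .
  qed
  have e: "exp (- \<kappa> * real j) = r ^ j" for j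
    unfolding r_def by (simp add: exp_of_nat_mult[symmetric] mult.commute)
  \<comment> \<open>The indices on either side of \<open>l\<close> give one geometric series each,
    hence the factor 2.\<close>
  have "(\<Sum>k\<in>{k\<in>A. l \<le> k}. exp (- \<kappa> * \<bar>real k - real l\<bar>)) = (\<Sum>k\<in>(\<lambda>k. k - l) ` {k\<in>A. l \<le> k}. r ^ k)"
    by (subst sum.reindex) (auto simp: inj_on_def e[symmetric] of_nat_diff intro!: sum.cong)
  moreover have "(\<Sum>k\<in>{k\<in>A. \<not> l \<le> k}. exp (- \<kappa> * \<bar>real k - real l\<bar>)) = (\<Sum>k\<in>(\<lambda>k. l - k) ` {k\<in>A. \<not> l \<le> k}. r ^ k)"
    by (subst sum.reindex) (auto simp: inj_on_def e[symmetric] of_nat_diff intro!: sum.cong)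
  moreover have "(\<Sum>k\<in>A. exp (- \<kappa> * \<bar>real k - real l\<bar>)) =
     (\<Sum>k\<in>{k\<in>A. l \<le> k}. exp (- \<kappa> * \<bar>real k - real l\<bar>)) + (\<Sum>k\<in>{k\<in>A. \<not> l \<le> k}. exp (- \<kappa> * \<bar>real k - real l\<bar>))"
    using assms by (subst sum.union_disjoint[symmetric]) (auto intro!: sum.cong)
  ultimately show ?thesis
    using geo[of "(\<lambda>k. k - l) ` {k\<in>A. l \<le> k}"] geo[of "(\<lambda>k. l - k) ` {k\<in>A. \<not> l \<le> k}"] assms by simp
qed

text \<open>All coordinates lie in [K, 2K), so with step \<delta> every node has norm between M and
  2 M for M = \<delta> K sqrt n. This keeps the frequencies comparable and away from the singularity
  of |\<xi>|^s at 0.\<close>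

definition grid :: "nat \<Rightarrow> ('n::finite \<Rightarrow> nat) set" where
  "grid K = PiE UNIV (\<lambda>_. {K..<2 * K})"

definition node :: "real \<Rightarrow> ('n::finite \<Rightarrow> nat) \<Rightarrow> real^'n" where
  "node \<delta> k = \<delta> *\<^sub>R (\<chi> i. real (k i))"

lemma finite_grid: "finite (grid K)"
  unfolding grid_def by (intro finite_PiE) auto

lemma card_grid: "card (grid K :: ('n::finite \<Rightarrow> nat) set) = K ^ CARD('n)"
  unfolding grid_def by (subst card_PiE) auto

lemma norm_node:
  fixes k :: "'n::finite \<Rightarrow> nat"
  assumes "k \<in> grid K" "\<delta> > 0"
  shows "\<delta> * K * sqrt CARD('n) \<le> norm (node \<delta> k)" "norm (node \<delta> k) \<le> 2 * (\<delta> * K * sqrt CARD('n))"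
proof -
  have b: "K \<le> k i" "k i \<le> 2 * K" for i
    using PiE_mem[OF assms(1)[unfolded grid_def], of i] by auto
  have n: "norm (node \<delta> k) = \<delta> * sqrt (\<Sum>i\<in>UNIV. (real (k i))\<^sup>2)"
  proof -
    have "norm (node \<delta> k) = \<delta> * norm (\<chi> i. real (k i))"
      using assms by (simp add: node_def)
    thus ?thesis by (simp add: norm_vec_def L2_set_def)
  qed
  have "real K * sqrt CARD('n) = sqrt (\<Sum>i\<in>(UNIV::'n set). (real K)\<^sup>2)"
    by (simp add: real_sqrt_mult mult.commute)
  also have "\<dots> \<le> sqrt (\<Sum>i\<in>UNIV. (real (k i))\<^sup>2)"
    using b by (intro real_sqrt_le_mono sum_mono power_mono) auto
  finally show "\<delta> * K * sqrt CARD('n) \<le> norm (node \<delta> k)"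
    unfolding n using assms by (simp add: mult.assoc)
  have "sqrt (\<Sum>i\<in>UNIV. (real (k i))\<^sup>2) \<le> sqrt (\<Sum>i\<in>(UNIV::'n set). (2 * real K)\<^sup>2)"
  proof (intro real_sqrt_le_mono sum_mono power_mono)
    show "real (k i) \<le> 2 * real K" for i using b(2)[of i] by linarith
  qed auto
  also have "\<dots> = 2 * real K * sqrt CARD('n)"
    by (simp add: real_sqrt_mult mult.commute)
  finally show "norm (node \<delta> k) \<le> 2 * (\<delta> * K * sqrt CARD('n))"
    unfolding n using assms by (simp add: mult.assoc mult.left_commute)
qed

text \<open>The source of boundedness of the superpositions: the bound involves neither the number
  K^n of centres nor \<open>y\<close>, only the separation \<open>\<kappa>\<close> per lattice step.
  Weakening each Gaussian to a product of exponentials in the index differences makes the sum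
  factorise over the coordinates.\<close>

lemma sum_gauss_separated:
  fixes z :: "('n::finite \<Rightarrow> nat) \<Rightarrow> real^'n"
  assumes sep: "\<And>k l. k \<in> grid K \<Longrightarrow> l \<in> grid K \<Longrightarrow> \<kappa> * norm (node 1 k - node 1 l) \<le> norm (z k - z l)"
    and \<kappa>: "\<kappa> > 0"
  shows "(\<Sum>k\<in>grid K. gauss (y - z k)) \<le> (2 * exp 2 * (1 + 1 / \<kappa>)) ^ CARD('n)"
proof (cases "grid K = ({} :: ('n \<Rightarrow> nat) set)")
  case True
  thus ?thesis using \<kappa> by simp
next
  case False
  \<comment> \<open>For the centre \<open>z l\<close> nearest to \<open>y\<close> one has \<open>|y - z k| \<ge> |z k - z l| / 2\<close> for all \<open>k\<close>.\<close>
  define l where "l = arg_min_on (\<lambda>k. norm (y - z k)) (grid K)"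
  have l: "l \<in> grid K" "\<And>k. k \<in> grid K \<Longrightarrow> norm (y - z l) \<le> norm (y - z k)"
    unfolding l_def using arg_min_if_finite[OF finite_grid False] arg_min_least[OF finite_grid False] by auto
  have "gauss (y - z k) \<le> (\<Prod>i\<in>UNIV. exp 2 * exp (- \<kappa> * \<bar>real (k i) - real (l i)\<bar>))" if k: "k \<in> grid K" for k
  proof -
    have "norm (z k - z l) \<le> norm (y - z l) + norm (y - z k)"
      using norm_triangle_ineq4[of "y - z l" "y - z k"] by simp
    hence "\<kappa> * norm (node 1 k - node 1 l) \<le> 2 * norm (y - z k)"
      using sep[OF k l(1)] l(2)[OF k] by simp
    hence "(\<kappa> * norm (node 1 k - node 1 l))\<^sup>2 \<le> (2 * norm (y - z k))\<^sup>2"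
      using \<kappa> by (intro power_mono) auto
    hence "- (norm (y - z k))\<^sup>2 / 2 \<le> - (\<kappa>\<^sup>2 * (norm (node 1 k - node 1 l))\<^sup>2) / 8"
      by (simp add: power_mult_distrib)
    also have "\<dots> = (\<Sum>i\<in>UNIV. - (\<kappa> * \<bar>real (k i) - real (l i)\<bar>)\<^sup>2 / 8)"
      by (simp add: norm_vec_def L2_set_def node_def sum_nonneg sum_distrib_left sum_divide_distrib sum_negf power_mult_distrib)
    also have "\<dots> \<le> (\<Sum>i\<in>UNIV. 2 - \<kappa> * \<bar>real (k i) - real (l i)\<bar>)"
    proof (rule sum_mono)
      fix i
      \<comment> \<open>The inequality t^2 / 8 \<ge> t - 2 is (t - 4)^2 \<ge> 0; its 2 is the source
        of \<open>exp 2\<close> in the bound.\<close>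
      have "0 \<le> (\<kappa> * \<bar>real (k i) - real (l i)\<bar> - 4)\<^sup>2" by simp
      thus "- (\<kappa> * \<bar>real (k i) - real (l i)\<bar>)\<^sup>2 / 8 \<le> 2 - \<kappa> * \<bar>real (k i) - real (l i)\<bar>"
        by (simp add: power2_diff)
    qed
    finally have "gauss (y - z k) \<le> exp (\<Sum>i\<in>UNIV. 2 - \<kappa> * \<bar>real (k i) - real (l i)\<bar>)"
      unfolding gauss_def by simp
    also have "\<dots> = (\<Prod>i\<in>UNIV. exp 2 * exp (- \<kappa> * \<bar>real (k i) - real (l i)\<bar>))"
      unfolding exp_sum[OF finite] exp_add[symmetric] by simp
    finally show ?thesis .
  qed
  hence "(\<Sum>k\<in>grid K. gauss (y - z k)) \<le> (\<Sum>k\<in>grid K. \<Prod>i\<in>UNIV. exp 2 * exp (- \<kappa> * \<bar>real (k i) - real (l i)\<bar>))"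
    by (rule sum_mono)
  also have "\<dots> = (\<Prod>i\<in>UNIV. \<Sum>j\<in>{K..<2 * K}. exp 2 * exp (- \<kappa> * \<bar>real j - real (l i)\<bar>))"
    unfolding grid_def by (subst prod_sum_PiE) auto
  also have "\<dots> \<le> (\<Prod>i\<in>(UNIV::'n set). 2 * exp 2 * (1 + 1 / \<kappa>))"
  proof (intro prod_mono conjI)
    fix i
    show "(\<Sum>j\<in>{K..<2 * K}. exp 2 * exp (- \<kappa> * \<bar>real j - real (l i)\<bar>)) \<le> 2 * exp 2 * (1 + 1 / \<kappa>)"
      using mult_left_mono[OF sum_exp_abs_le[of "{K..<2 * K}" \<kappa> "l i"], of "exp 2"] \<kappa>
      by (simp add: sum_distrib_left algebra_simps)
  qed (auto intro!: sum_nonneg)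
  finally show ?thesis by simp
qed

section \<open>Superpositions of packets focusing at the origin\<close>

lemma integral_gauss: "(LINT x::'a::euclidean_space|lborel. gauss x) = sqrt (2 * pi) ^ DIM('a)"
proof -
  have "complex_of_real (LINT x::'a|lborel. gauss x) = (LINT x::'a|lborel. complex_of_real (gauss x))"
    by (rule integral_complex_of_real[symmetric])
  also have "\<dots> = complex_of_real (sqrt (2 * pi) ^ DIM('a))"
    using fourier_gauss[of "0::'a"] by (simp add: gauss_def)
  finally show ?thesis by (simp only: of_real_eq_iff)
qed

lemma integrable_gauss_moment:
  "integrable lborel (\<lambda>x::'a::euclidean_space. (norm x + (norm x)\<^sup>2) * gauss x)"
proof (rule Bochner_Integration.integrable_bound)
  show "integrable lborel (\<lambda>x::'a. 10 * gauss ((1 / sqrt 2) *\<^sub>R (x - 0)))"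
    by (intro integrable_mult_right integrable_gauss_affine) simp
  have "(norm x + (norm x)\<^sup>2) * gauss x \<le> 10 * gauss ((1 / sqrt 2) *\<^sub>R x)" for x :: 'a
  proof -
    \<comment> \<open>\<open>gauss x\<close> is exp (- 2 t): one factor exp (- t) pays for the
      polynomial, the other is again a Gaussian.\<close>
    define t where "t = (norm x)\<^sup>2 / 4"
    have "0 \<le> (norm x - 1)\<^sup>2" by simp
    hence "norm x + (norm x)\<^sup>2 \<le> 1 / 2 + 6 * t" by (simp add: power2_diff t_def)
    also have "\<dots> \<le> 10 * exp t"
    proof -
      have "0 \<le> t" by (simp add: t_def)
      thus ?thesis using exp_ge_add_one_self[of t] by linarith
    qed
    finally have "(norm x + (norm x)\<^sup>2) * exp (- 2 * t) \<le> 10 * exp t * exp (- 2 * t)"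
      by (rule mult_right_mono) simp
    also have "\<dots> = 10 * exp (- t)" unfolding mult.assoc exp_add[symmetric] by simp
    finally show ?thesis by (simp add: gauss_def t_def power_mult_distrib power_divide)
  qed
  moreover have "0 \<le> (norm x + (norm x)\<^sup>2) * gauss x" for x :: 'a
    using gauss_pos[of x] by simp
  ultimately show "AE x in lborel. norm ((norm x + (norm x)\<^sup>2) * gauss x) \<le> norm (10 * gauss ((1 / sqrt 2) *\<^sub>R (x - 0 :: 'a)))"
    by (intro AE_I2) (simp add: order_trans[OF _ abs_ge_self])
qed measurable

text \<open>The mean of |Z| + |Z|^2 for a standard normal vector Z; the type argument records the
  dimension. The first power accounts for errors linear in the frequency offset, the second for the
  quadratic phase remainder.\<close>

definition gauss_moment :: "'a::euclidean_space itself \<Rightarrow> real" where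
  "gauss_moment _ = (LINT x::'a|lborel. (norm x + (norm x)\<^sup>2) * gauss x) / sqrt (2 * pi) ^ DIM('a)"

lemma gauss_moment_nonneg: "0 \<le> gauss_moment TYPE('a::euclidean_space)"
  unfolding gauss_moment_def using gauss_pos[where 'a='a]
  by (intro divide_nonneg_pos Bochner_Integration.integral_nonneg mult_nonneg_nonneg) (auto intro: less_imp_le)

text \<open>After \<xi> = \<mu> + \<delta> \<zeta> the powers of \<delta> cancel, leaving an average
  over a standard Gaussian \<zeta>.\<close>

lemma multiplier_packet:
  fixes \<mu> a x :: "real^'n"
  assumes "\<delta> > 0"
  shows "multiplier \<tau> (packet \<mu> \<delta> a) x = complex_of_real (1 / sqrt (2 * pi) ^ CARD('n)) *
    (LINT \<zeta>|lborel. cis (x \<bullet> (\<mu> + \<delta> *\<^sub>R \<zeta>)) * \<tau> (\<mu> + \<delta> *\<^sub>R \<zeta>) * cis (- (\<delta> * (\<zeta> \<bullet> a))) *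
      complex_of_real (gauss \<zeta>))"
proof -
  let ?I = "LINT \<zeta>|lborel. cis (x \<bullet> (\<mu> + \<delta> *\<^sub>R \<zeta>)) * \<tau> (\<mu> + \<delta> *\<^sub>R \<zeta>) * cis (- (\<delta> * (\<zeta> \<bullet> a))) *
      complex_of_real (gauss \<zeta>)"
  have "(LINT \<xi>|lborel. cis (x \<bullet> \<xi>) * \<tau> \<xi> * fourier (packet \<mu> \<delta> a) \<xi>) =
    \<delta> ^ CARD('n) *\<^sub>R (LINT \<zeta>|lborel. cis (x \<bullet> (\<mu> + \<delta> *\<^sub>R \<zeta>)) * \<tau> (\<mu> + \<delta> *\<^sub>R \<zeta>) * fourier (packet \<mu> \<delta> a) (\<mu> + \<delta> *\<^sub>R \<zeta>))"
    using assms by (subst integral_lborel_affine[of \<delta> _ \<mu>]) simp_all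
  also have "(\<lambda>\<zeta>. cis (x \<bullet> (\<mu> + \<delta> *\<^sub>R \<zeta>)) * \<tau> (\<mu> + \<delta> *\<^sub>R \<zeta>) * fourier (packet \<mu> \<delta> a) (\<mu> + \<delta> *\<^sub>R \<zeta>)) =
    (\<lambda>\<zeta>. complex_of_real ((sqrt (2 * pi) / \<delta>) ^ CARD('n)) *
      (cis (x \<bullet> (\<mu> + \<delta> *\<^sub>R \<zeta>)) * \<tau> (\<mu> + \<delta> *\<^sub>R \<zeta>) * cis (- (\<delta> * (\<zeta> \<bullet> a))) * complex_of_real (gauss \<zeta>)))"
    using assms by (simp add: fourier_packet fun_eq_iff)
  also have "\<delta> ^ CARD('n) *\<^sub>R (LINT \<zeta>|lborel. complex_of_real ((sqrt (2 * pi) / \<delta>) ^ CARD('n)) *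
      (cis (x \<bullet> (\<mu> + \<delta> *\<^sub>R \<zeta>)) * \<tau> (\<mu> + \<delta> *\<^sub>R \<zeta>) * cis (- (\<delta> * (\<zeta> \<bullet> a))) * complex_of_real (gauss \<zeta>)))
    = complex_of_real (\<delta> ^ CARD('n) * (sqrt (2 * pi) / \<delta>) ^ CARD('n)) * ?I"
    by (simp only: integral_mult_right_zero scaleR_conv_of_real of_real_mult mult.assoc)
  finally have "multiplier \<tau> (packet \<mu> \<delta> a) x =
    complex_of_real (inverse ((2 * pi) ^ CARD('n)) * (\<delta> ^ CARD('n) * (sqrt (2 * pi) / \<delta>) ^ CARD('n))) * ?I"
    unfolding multiplier_def by (simp only: of_real_mult mult.assoc)
  also have "inverse ((2 * pi) ^ CARD('n)) * (\<delta> ^ CARD('n) * (sqrt (2 * pi) / \<delta>) ^ CARD('n)) = 1 / sqrt (2 * pi) ^ CARD('n)"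
  proof -
    have "(2 * pi) ^ CARD('n) = sqrt (2 * pi) ^ CARD('n) * sqrt (2 * pi) ^ CARD('n)"
      unfolding power_mult_distrib[symmetric] by simp
    thus ?thesis using assms by (simp add: power_divide field_simps del: real_sqrt_mult_self)
  qed
  finally show ?thesis .
qed

text \<open>Centring the packet at \<open>velocity s \<mu>\<close> cancels the linear term of the
  phase. What is averaged over \<zeta> is then \<open>cis (x \<bullet> \<mu>) * \<beta>\<close> up
  to three errors, the three summands of the bound: the variation of \<open>b\<close> over a
  frequency distance \<delta> |\<zeta>|, the displacement \<open>x\<close> from the focus, and the
  quadratic remainder of the phase.\<close>

lemma multiplier_packet_approx:
  fixes \<mu> x :: "real^'n" and b :: "real^'n \<Rightarrow> complex"
  assumes s: "0 < s" "s < 1" and \<delta>: "\<delta> > 0" and M: "1 \<le> M" "M \<le> norm \<mu>" "norm \<mu> \<le> 2 * M"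
    and b: "b \<in> borel_measurable borel" "\<And>\<xi>. norm (b \<xi>) \<le> B"
    and lip: "\<And>\<eta>. norm (b (\<mu> + \<eta>) - complex_of_real \<beta>) \<le> L * norm \<eta> / M"
    and \<beta>: "0 \<le> \<beta>" "\<beta> \<le> 1" and L: "0 \<le> L"
  shows "norm (cis (- (norm \<mu> powr s)) * multiplier (\<lambda>\<xi>. cis (norm \<xi> powr s) * b \<xi>) (packet \<mu> \<delta> (velocity s \<mu>)) x
      - cis (x \<bullet> \<mu>) * complex_of_real \<beta>)
    \<le> gauss_moment TYPE(real^'n) * (L * \<delta> / M + \<delta> * norm x + 10 * \<delta>\<^sup>2 * M powr (s - 2))"
proof -
  note [measurable] = b(1)
  define c where "c = sqrt (2 * pi) ^ CARD('n)"
  have c: "c > 0" by (simp add: c_def)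
  have ig: "(LINT x::real^'n|lborel. gauss x) = c"
    by (simp add: integral_gauss c_def)
  define E where "E = (\<lambda>\<zeta>. cis (x \<bullet> \<mu>) * (cis (\<delta> * (x \<bullet> \<zeta>)) * cis (remainder s \<mu> (\<delta> *\<^sub>R \<zeta>)) * b (\<mu> + \<delta> *\<^sub>R \<zeta>)))"
  define R where "R = L * \<delta> / M + \<delta> * norm x + 10 * \<delta>\<^sup>2 * M powr (s - 2)"
  have [measurable]: "E \<in> borel_measurable borel"
    unfolding E_def remainder_def by measurable
  have intE: "integrable lborel (\<lambda>\<zeta>. E \<zeta> * complex_of_real (gauss \<zeta>))"
  proof (rule Bochner_Integration.integrable_bound)
    show "integrable lborel (\<lambda>\<zeta>. B * gauss (\<zeta> :: real^'n))"
      by (intro integrable_mult_right integrable_gauss)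
    have "norm (E \<zeta> * complex_of_real (gauss \<zeta>)) \<le> norm (B * gauss \<zeta>)" for \<zeta>
    proof -
      have "0 \<le> B" using b(2)[of 0] norm_ge_zero order_trans by blast
      have "norm (E \<zeta> * complex_of_real (gauss \<zeta>)) = norm (b (\<mu> + \<delta> *\<^sub>R \<zeta>)) * gauss \<zeta>"
        using gauss_pos[of \<zeta>] by (simp add: E_def norm_mult)
      also have "\<dots> \<le> B * gauss \<zeta>"
        using gauss_pos[of \<zeta>] by (intro mult_right_mono b) auto
      finally show ?thesis using \<open>0 \<le> B\<close> gauss_pos[of \<zeta>] by simp
    qed
    thus "AE \<zeta> in lborel. norm (E \<zeta> * complex_of_real (gauss \<zeta>)) \<le> norm (B * gauss \<zeta>)" by simp
  qed measurable
  have "cis (- (norm \<mu> powr s)) * multiplier (\<lambda>\<xi>. cis (norm \<xi> powr s) * b \<xi>) (packet \<mu> \<delta> (velocity s \<mu>)) x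
    = complex_of_real (1 / c) * (LINT \<zeta>|lborel. E \<zeta> * complex_of_real (gauss \<zeta>))"
  proof -
    define G where "G = (\<lambda>\<zeta>. cis (x \<bullet> (\<mu> + \<delta> *\<^sub>R \<zeta>)) * (cis (norm (\<mu> + \<delta> *\<^sub>R \<zeta>) powr s) * b (\<mu> + \<delta> *\<^sub>R \<zeta>)) *
        cis (- (\<delta> * (\<zeta> \<bullet> velocity s \<mu>))) * complex_of_real (gauss \<zeta>))"
    have ph: "cis (- (norm \<mu> powr s)) * G \<zeta> = E \<zeta> * complex_of_real (gauss \<zeta>)" for \<zeta>
    proof -
      have "- (norm \<mu> powr s) + x \<bullet> (\<mu> + \<delta> *\<^sub>R \<zeta>) + norm (\<mu> + \<delta> *\<^sub>R \<zeta>) powr s + - (\<delta> * (\<zeta> \<bullet> velocity s \<mu>))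
        = x \<bullet> \<mu> + \<delta> * (x \<bullet> \<zeta>) + remainder s \<mu> (\<delta> *\<^sub>R \<zeta>)"
        by (simp add: remainder_def velocity_def inner_simps inner_commute algebra_simps)
      hence ph: "cis (- (norm \<mu> powr s)) * cis (x \<bullet> (\<mu> + \<delta> *\<^sub>R \<zeta>)) * cis (norm (\<mu> + \<delta> *\<^sub>R \<zeta>) powr s) * cis (- (\<delta> * (\<zeta> \<bullet> velocity s \<mu>)))
        = cis (x \<bullet> \<mu>) * cis (\<delta> * (x \<bullet> \<zeta>)) * cis (remainder s \<mu> (\<delta> *\<^sub>R \<zeta>))"
        by (simp only: cis_mult)
      have "cis (- (norm \<mu> powr s)) * G \<zeta> = (cis (- (norm \<mu> powr s)) * cis (x \<bullet> (\<mu> + \<delta> *\<^sub>R \<zeta>)) * cis (norm (\<mu> + \<delta> *\<^sub>R \<zeta>) powr s) * cis (- (\<delta> * (\<zeta> \<bullet> velocity s \<mu>))))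
          * (b (\<mu> + \<delta> *\<^sub>R \<zeta>) * complex_of_real (gauss \<zeta>))"
        unfolding G_def by (simp only: mult_ac)
      also have "\<dots> = E \<zeta> * complex_of_real (gauss \<zeta>)"
        unfolding ph E_def by (simp only: mult_ac)
      finally show ?thesis .
    qed
    have "cis (- (norm \<mu> powr s)) * multiplier (\<lambda>\<xi>. cis (norm \<xi> powr s) * b \<xi>) (packet \<mu> \<delta> (velocity s \<mu>)) x
      = complex_of_real (1 / c) * (cis (- (norm \<mu> powr s)) * (LINT \<zeta>|lborel. G \<zeta>))"
      unfolding multiplier_packet[OF \<delta>] c_def[symmetric] G_def by (rule mult.left_commute)
    also have "cis (- (norm \<mu> powr s)) * (LINT \<zeta>|lborel. G \<zeta>) = (LINT \<zeta>|lborel. E \<zeta> * complex_of_real (gauss \<zeta>))"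
      unfolding ph[symmetric] by (rule integral_mult_right_zero[symmetric])
    finally show ?thesis .
  qed
  also have "\<dots> - cis (x \<bullet> \<mu>) * complex_of_real \<beta> = complex_of_real (1 / c) *
      (LINT \<zeta>|lborel. E \<zeta> * complex_of_real (gauss \<zeta>) - cis (x \<bullet> \<mu>) * complex_of_real \<beta> * complex_of_real (gauss \<zeta>))"
  proof -
    have "(LINT \<zeta>::real^'n|lborel. cis (x \<bullet> \<mu>) * complex_of_real \<beta> * complex_of_real (gauss \<zeta>)) = cis (x \<bullet> \<mu>) * complex_of_real \<beta> * c"
      unfolding integral_mult_right_zero integral_complex_of_real ig ..
    moreover have "(LINT \<zeta>|lborel. E \<zeta> * complex_of_real (gauss \<zeta>) - cis (x \<bullet> \<mu>) * complex_of_real \<beta> * complex_of_real (gauss \<zeta>))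
      = (LINT \<zeta>|lborel. E \<zeta> * complex_of_real (gauss \<zeta>)) - (LINT \<zeta>::real^'n|lborel. cis (x \<bullet> \<mu>) * complex_of_real \<beta> * complex_of_real (gauss \<zeta>))"
      by (intro Bochner_Integration.integral_diff intE integrable_mult_right integrable_of_real integrable_gauss)
    moreover have "complex_of_real (1 / c) * P - q = complex_of_real (1 / c) * (P - q * complex_of_real c)" for P q
      using c by (simp add: field_simps)
    ultimately show ?thesis by (simp only:)
  qed
  also have "norm \<dots> \<le> 1 / c * (LINT \<zeta>::real^'n|lborel. R * ((norm \<zeta> + (norm \<zeta>)\<^sup>2) * gauss \<zeta>))"
    unfolding norm_mult
  proof (rule mult_mono)
    show "norm (LINT \<zeta>|lborel. E \<zeta> * complex_of_real (gauss \<zeta>) - cis (x \<bullet> \<mu>) * complex_of_real \<beta> * complex_of_real (gauss \<zeta>))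
      \<le> (LINT \<zeta>::real^'n|lborel. R * ((norm \<zeta> + (norm \<zeta>)\<^sup>2) * gauss \<zeta>))"
    proof (rule Bochner_Integration.integral_norm_bound_integral)
      fix \<zeta> :: "real^'n"
      define T where "T = b (\<mu> + \<delta> *\<^sub>R \<zeta>)"
      define p q where "p = cis (\<delta> * (x \<bullet> \<zeta>))" and "q = cis (remainder s \<mu> (\<delta> *\<^sub>R \<zeta>))"
      \<comment> \<open>One factor is replaced at a time: \<open>T\<close> by
        \<open>\<beta>\<close>, then \<open>q\<close> and \<open>p\<close> by 1.\<close>
      have "p * q * T - \<beta> = p * q * (T - \<beta>) + \<beta> * (p * (q - 1)) + \<beta> * (p - 1)"
        by (simp add: algebra_simps)
      also have "norm \<dots> \<le> norm (p * q * (T - \<beta>)) + norm (\<beta> * (p * (q - 1))) + norm (\<beta> * (p - 1))"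
        by (meson norm_triangle_ineq norm_triangle_mono order_refl)
      also have "\<dots> = norm (T - \<beta>) + \<beta> * norm (q - 1) + \<beta> * norm (p - 1)"
        using \<beta> by (simp add: norm_mult p_def q_def)
      also have "\<dots> \<le> norm (T - \<beta>) + 1 * norm (q - 1) + 1 * norm (p - 1)"
        using \<beta> by (intro add_mono mult_right_mono) auto
      also have "norm (T - \<beta>) \<le> L * \<delta> / M * norm \<zeta>"
        using lip[of "\<delta> *\<^sub>R \<zeta>"] \<delta> by (simp add: T_def)
      also have "norm (q - 1) \<le> 10 * \<delta>\<^sup>2 * M powr (s - 2) * (norm \<zeta>)\<^sup>2"
      proof -
        have "norm (q - 1) \<le> 10 * norm \<mu> powr (s - 2) * (norm (\<delta> *\<^sub>R \<zeta>))\<^sup>2"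
          unfolding q_def using M s by (intro norm_cis_remainder) auto
        also have "\<dots> \<le> 10 * M powr (s - 2) * (norm (\<delta> *\<^sub>R \<zeta>))\<^sup>2"
          using M s by (intro mult_right_mono mult_left_mono powr_mono2') auto
        finally show ?thesis by (simp add: power_mult_distrib mult_ac)
      qed
      also have "norm (p - 1) \<le> \<delta> * norm x * norm \<zeta>"
      proof -
        have "norm (p - 1) \<le> \<delta> * \<bar>x \<bullet> \<zeta>\<bar>"
          unfolding p_def using norm_cis_minus_1[of "\<delta> * (x \<bullet> \<zeta>)"] \<delta> by (simp add: abs_mult)
        also have "\<dots> \<le> \<delta> * (norm x * norm \<zeta>)"
          using \<delta> by (intro mult_left_mono Cauchy_Schwarz_ineq2) auto
        finally show ?thesis by (simp add: mult_ac)
      qed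
      finally have 1: "norm (p * q * T - \<beta>) \<le> L * \<delta> / M * norm \<zeta> + 1 * (10 * \<delta>\<^sup>2 * M powr (s - 2) * (norm \<zeta>)\<^sup>2) + 1 * (\<delta> * norm x * norm \<zeta>)"
        by simp
      \<comment> \<open>Adding the missing mixed products lets the single weight |\<zeta>| +
        |\<zeta>|^2 serve all three errors.\<close>
      have "0 \<le> L * \<delta> / M * (norm \<zeta>)\<^sup>2" "0 \<le> 10 * \<delta>\<^sup>2 * M powr (s - 2) * norm \<zeta>" "0 \<le> \<delta> * norm x * (norm \<zeta>)\<^sup>2"
        using L \<delta> M by auto
      with 1 have 2: "norm (p * q * T - \<beta>) \<le> R * (norm \<zeta> + (norm \<zeta>)\<^sup>2)"
        unfolding R_def by (simp only: distrib_left distrib_right)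
      have "norm (E \<zeta> * complex_of_real (gauss \<zeta>) - cis (x \<bullet> \<mu>) * complex_of_real \<beta> * complex_of_real (gauss \<zeta>))
        = norm (cis (x \<bullet> \<mu>) * (p * q * T - \<beta>) * complex_of_real (gauss \<zeta>))"
        by (simp add: E_def p_def q_def T_def algebra_simps)
      also have "\<dots> = norm (p * q * T - \<beta>) * gauss \<zeta>"
        using gauss_pos[of \<zeta>] by (simp add: norm_mult)
      also have "\<dots> \<le> R * (norm \<zeta> + (norm \<zeta>)\<^sup>2) * gauss \<zeta>"
        using gauss_pos[of \<zeta>] by (intro mult_right_mono 2) auto
      finally show "norm (E \<zeta> * complex_of_real (gauss \<zeta>) - cis (x \<bullet> \<mu>) * complex_of_real \<beta> * complex_of_real (gauss \<zeta>))
        \<le> R * ((norm \<zeta> + (norm \<zeta>)\<^sup>2) * gauss \<zeta>)" by (simp add: mult.assoc)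
    qed (intro Bochner_Integration.integrable_diff intE integrable_mult_right integrable_of_real integrable_gauss integrable_gauss_moment)+
  qed (use c in \<open>auto simp: norm_divide\<close>)
  also have "\<dots> = gauss_moment TYPE(real^'n) * R"
    by (simp add: gauss_moment_def c_def)
  finally show ?thesis unfolding R_def .
qed

text \<open>
  The factors \<open>cis (- |\<mu>|^s)\<close> cancel the phase that \<open>T\<close> gives to the packets at the origin.
\<close>

definition focusing :: "real \<Rightarrow> real \<Rightarrow> nat \<Rightarrow> real^'n::finite \<Rightarrow> complex" where
  "focusing s \<delta> K x = (\<Sum>k\<in>grid K. cis (- (norm (node \<delta> k :: real^'n) powr s)) *
     packet (node \<delta> k) \<delta> (velocity s (node \<delta> k)) x)"

lemma schwartz_focusing: "\<delta> > 0 \<Longrightarrow> schwartz (focusing s \<delta> K)"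
  unfolding focusing_def[abs_def]
  by (rule schwartz_gauss_class[of \<delta>]) (auto intro!: gauss_class_sum finite_grid gauss_class.intros)

lemma focusing_measurable [measurable]: "focusing s \<delta> K \<in> borel_measurable borel"
  unfolding focusing_def[abs_def] by measurable

lemma integrable_focusing: "\<delta> > 0 \<Longrightarrow> integrable lborel (focusing s \<delta> K)"
  unfolding focusing_def[abs_def]
  by (intro Bochner_Integration.integrable_sum integrable_mult_right integrable_packet) auto

lemma norm_focusing_le:
  "norm (focusing s \<delta> K x) \<le> (\<Sum>k\<in>grid K. gauss (\<delta> *\<^sub>R (x - velocity s (node \<delta> k))))"
  unfolding focusing_def by (rule order_trans[OF norm_sum]) (simp add: norm_mult norm_packet)

text \<open>\<open>\<kappa>\<close> is a lower bound for the separation of the centres per lattice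
  step, in units of the packet width: neighbouring frequencies differ by \<delta>,
  \<open>velocity\<close> multiplies distances by at least s (1 - s) (2 M)^(s-2) among the nodes,
  and the unit of length 1/\<delta> gives the second factor \<delta>.\<close>

lemma focusing_bounded:
  fixes x :: "real^'n"
  assumes s: "0 < s" "s < 1" and \<delta>: "\<delta> > 0" and K: "K \<ge> 1"
    and M: "M = \<delta> * K * sqrt CARD('n)" and \<kappa>: "\<kappa> = s * (1 - s) * (2 * M) powr (s - 2) * \<delta>\<^sup>2"
  shows "norm (focusing s \<delta> K x) \<le> (2 * exp 2 * (1 + 1 / \<kappa>)) ^ CARD('n)"
proof -
  have Mpos: "M > 0" using \<delta> K by (simp add: M)
  have "norm (focusing s \<delta> K x) \<le> (\<Sum>k\<in>grid K. gauss (\<delta> *\<^sub>R x - \<delta> *\<^sub>R velocity s (node \<delta> k)))"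
    using norm_focusing_le[of s \<delta> K x] by (simp add: scaleR_diff_right)
  also have "\<dots> \<le> (2 * exp 2 * (1 + 1 / \<kappa>)) ^ CARD('n)"
  proof (rule sum_gauss_separated)
    show "\<kappa> > 0" using s \<delta> Mpos by (simp add: \<kappa>)
    fix k l :: "'n \<Rightarrow> nat" assume kl: "k \<in> grid K" "l \<in> grid K"
    have nk: "M \<le> norm (node \<delta> k)" "norm (node \<delta> k) \<le> 2 * M" if "k \<in> grid K" for k :: "'n \<Rightarrow> nat"
      using norm_node[OF that \<delta>] by (simp_all add: M)
    have "\<kappa> * norm (node 1 k - node 1 l :: real^'n) = \<delta> * (s * (1 - s) * (2 * M) powr (s - 2) * norm (node \<delta> k - node \<delta> l :: real^'n))"
    proof -
      have "node \<delta> k - node \<delta> l = \<delta> *\<^sub>R (node 1 k - node 1 l :: real^'n)"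
        by (simp add: node_def scaleR_diff_right)
      hence "norm (node \<delta> k - node \<delta> l :: real^'n) = \<delta> * norm (node 1 k - node 1 l :: real^'n)"
        using \<delta> by simp
      thus ?thesis by (simp add: \<kappa> power2_eq_square)
    qed
    also have "\<dots> \<le> \<delta> * norm (velocity s (node \<delta> k) - velocity s (node \<delta> l :: real^'n))"
      using nk[OF kl(1)] nk[OF kl(2)] Mpos \<delta> s by (intro mult_left_mono velocity_expanding) auto
    also have "\<dots> = norm (\<delta> *\<^sub>R velocity s (node \<delta> k) - \<delta> *\<^sub>R velocity s (node \<delta> l :: real^'n))"
      unfolding scaleR_diff_right[symmetric] norm_scaleR using \<delta> by simp
    finally show "\<kappa> * norm (node 1 k - node 1 l :: real^'n) \<le> norm (\<delta> *\<^sub>R velocity s (node \<delta> k) - \<delta> *\<^sub>R velocity s (node \<delta> l :: real^'n))" .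
  qed
  finally show ?thesis .
qed

lemma integrable_multiplier_packet:
  fixes \<tau> :: "real^'n \<Rightarrow> complex"
  assumes "\<delta> > 0" and [measurable]: "\<tau> \<in> borel_measurable borel" and \<tau>: "\<And>\<xi>. norm (\<tau> \<xi>) \<le> B"
  shows "integrable lborel (\<lambda>\<xi>. cis (x \<bullet> \<xi>) * \<tau> \<xi> * fourier (packet \<mu> \<delta> a) \<xi>)"
proof (rule Bochner_Integration.integrable_bound)
  let ?c = "(sqrt (2 * pi) / \<delta>) ^ CARD('n)"
  show "integrable lborel (\<lambda>\<xi>. B * (?c * gauss (inverse \<delta> *\<^sub>R (\<xi> - \<mu>))))"
    using assms(1) by (intro integrable_mult_right integrable_gauss_affine) simp
  have "0 \<le> B" using \<tau>[of 0] norm_ge_zero order_trans by blast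
  have "norm (cis (x \<bullet> \<xi>) * \<tau> \<xi> * fourier (packet \<mu> \<delta> a) \<xi>) \<le> norm (B * (?c * gauss (inverse \<delta> *\<^sub>R (\<xi> - \<mu>))))" for \<xi>
  proof -
    have nn: "0 \<le> ?c * gauss (inverse \<delta> *\<^sub>R (\<xi> - \<mu>))"
      using gauss_pos[of "inverse \<delta> *\<^sub>R (\<xi> - \<mu>)"] assms(1) by simp
    have "norm (fourier (packet \<mu> \<delta> a) \<xi>) = ?c * gauss (inverse \<delta> *\<^sub>R (\<xi> - \<mu>))"
      unfolding fourier_packet[OF assms(1)] norm_mult norm_cis norm_of_real using nn by simp
    hence "norm (cis (x \<bullet> \<xi>) * \<tau> \<xi> * fourier (packet \<mu> \<delta> a) \<xi>) = norm (\<tau> \<xi>) * (?c * gauss (inverse \<delta> *\<^sub>R (\<xi> - \<mu>)))"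
      by (simp add: norm_mult)
    also have "\<dots> \<le> B * (?c * gauss (inverse \<delta> *\<^sub>R (\<xi> - \<mu>)))"
      by (intro mult_right_mono \<tau> nn)
    finally show ?thesis using nn \<open>0 \<le> B\<close> by simp
  qed
  thus "AE \<xi> in lborel. norm (cis (x \<bullet> \<xi>) * \<tau> \<xi> * fourier (packet \<mu> \<delta> a) \<xi>) \<le> norm (B * (?c * gauss (inverse \<delta> *\<^sub>R (\<xi> - \<mu>))))"
    by simp
qed (simp add: fourier_packet assms(1))

lemma fourier_focusing:
  fixes \<xi> :: "real^'n"
  assumes "\<delta> > 0"
  shows "fourier (focusing s \<delta> K) \<xi> = (\<Sum>k\<in>grid K. cis (- (norm (node \<delta> k :: real^'n) powr s)) *
     fourier (packet (node \<delta> k) \<delta> (velocity s (node \<delta> k))) \<xi>)"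
proof -
  have i: "integrable lborel (\<lambda>x. cis (- (\<xi> \<bullet> x)) * packet \<mu> \<delta> a x)" for \<mu> a
    using assms by (intro Bochner_Integration.integrable_bound[OF integrable_packet[of \<delta> \<mu> a]]) (auto simp: norm_mult)
  show ?thesis
  proof -
    have "(\<lambda>x. cis (- (\<xi> \<bullet> x)) * focusing s \<delta> K x) = (\<lambda>x. \<Sum>k\<in>grid K. cis (- (norm (node \<delta> k :: real^'n) powr s)) *
      (cis (- (\<xi> \<bullet> x)) * packet (node \<delta> k) \<delta> (velocity s (node \<delta> k)) x))"
      by (auto simp: fun_eq_iff focusing_def sum_distrib_left intro!: sum.cong)
    thus ?thesis
      unfolding fourier_def by (simp add: Bochner_Integration.integral_sum i)
  qed
qed

lemma multiplier_focusing:
  fixes \<tau> :: "real^'n \<Rightarrow> complex"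
  assumes "\<delta> > 0" and "\<tau> \<in> borel_measurable borel" and "\<And>\<xi>. norm (\<tau> \<xi>) \<le> B"
  shows "multiplier \<tau> (focusing s \<delta> K) x = (\<Sum>k\<in>grid K. cis (- (norm (node \<delta> k :: real^'n) powr s)) *
     multiplier \<tau> (packet (node \<delta> k) \<delta> (velocity s (node \<delta> k))) x)"
proof -
  have eq: "(\<lambda>\<xi>. cis (x \<bullet> \<xi>) * \<tau> \<xi> * fourier (focusing s \<delta> K) \<xi>) = (\<lambda>\<xi>. \<Sum>k\<in>grid K. cis (- (norm (node \<delta> k :: real^'n) powr s)) *
    (cis (x \<bullet> \<xi>) * \<tau> \<xi> * fourier (packet (node \<delta> k) \<delta> (velocity s (node \<delta> k))) \<xi>))"
    by (auto simp: fun_eq_iff fourier_focusing[OF assms(1)] sum_distrib_left intro!: sum.cong)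
  have "(LINT \<xi>|lborel. cis (x \<bullet> \<xi>) * \<tau> \<xi> * fourier (focusing s \<delta> K) \<xi>) = (\<Sum>k\<in>grid K. cis (- (norm (node \<delta> k :: real^'n) powr s)) *
    (LINT \<xi>|lborel. cis (x \<bullet> \<xi>) * \<tau> \<xi> * fourier (packet (node \<delta> k) \<delta> (velocity s (node \<delta> k))) \<xi>))"
    unfolding eq
    by (subst Bochner_Integration.integral_sum) (auto intro!: integrable_mult_right integrable_multiplier_packet[OF assms])
  thus ?thesis
    unfolding multiplier_def by (simp only: sum_distrib_left mult.left_commute)
qed

text \<open>Near the origin each term has real part close to \<open>\<beta> \<mu>\<close>, the value
  of the symbol at its node, and these are at least \<open>\<alpha>\<close>; so the K^n real parts
  add up without cancellation. The loss 2 M |x| bounds the phases \<open>x \<bullet> \<mu>\<close>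
  over the nodes.\<close>

lemma multiplier_focusing_approx:
  fixes x :: "real^'n" and b :: "real^'n \<Rightarrow> complex"
  assumes s: "0 < s" "s < 1" and \<delta>: "\<delta> > 0" and M: "M = \<delta> * K * sqrt CARD('n)" "1 \<le> M"
    and b: "b \<in> borel_measurable borel" "\<And>\<xi>. norm (b \<xi>) \<le> B"
    and lip: "\<And>\<mu> \<eta>. M \<le> norm \<mu> \<Longrightarrow> norm \<mu> \<le> 2 * M \<Longrightarrow> norm (b (\<mu> + \<eta>) - complex_of_real (\<beta> \<mu>)) \<le> L * norm \<eta> / M"
    and \<beta>: "\<And>\<mu>. M \<le> norm \<mu> \<Longrightarrow> norm \<mu> \<le> 2 * M \<Longrightarrow> \<alpha> \<le> \<beta> \<mu> \<and> \<beta> \<mu> \<le> 1" and \<alpha>: "0 \<le> \<alpha>" and L: "0 \<le> L"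
  shows "K ^ CARD('n) * (\<alpha> - 2 * M * norm x - gauss_moment TYPE(real^'n) * (L * \<delta> / M + \<delta> * norm x + 10 * \<delta>\<^sup>2 * M powr (s - 2)))
    \<le> norm (multiplier (\<lambda>\<xi>. cis (norm \<xi> powr s) * b \<xi>) (focusing s \<delta> K) x)"
proof -
  define R where "R = gauss_moment TYPE(real^'n) * (L * \<delta> / M + \<delta> * norm x + 10 * \<delta>\<^sup>2 * M powr (s - 2))"
  note [measurable] = b(1)
  define T where "T = (\<lambda>k::'n \<Rightarrow> nat. cis (- (norm (node \<delta> k :: real^'n) powr s)) *
     multiplier (\<lambda>\<xi>. cis (norm \<xi> powr s) * b \<xi>) (packet (node \<delta> k) \<delta> (velocity s (node \<delta> k))) x)"
  have "\<alpha> - 2 * M * norm x - R \<le> Re (T k)" if k: "k \<in> grid K" for k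
  proof -
    let ?\<mu> = "node \<delta> k :: real^'n"
    have \<mu>: "M \<le> norm ?\<mu>" "norm ?\<mu> \<le> 2 * M"
      using norm_node[OF k \<delta>] by (simp_all add: M)
    note \<beta>' = \<beta>[OF \<mu>]
    have 1: "norm (T k - cis (x \<bullet> ?\<mu>) * \<beta> ?\<mu>) \<le> R"
      unfolding T_def R_def using \<beta>' \<alpha>
      by (intro multiplier_packet_approx[where B=B] s \<delta> M(2) \<mu> b lip L) auto
    have "norm (cis (x \<bullet> ?\<mu>) * \<beta> ?\<mu> - \<beta> ?\<mu>) = \<beta> ?\<mu> * norm (cis (x \<bullet> ?\<mu>) - 1)"
      using \<beta>' \<alpha> norm_mult[of "complex_of_real (\<beta> ?\<mu>)" "cis (x \<bullet> ?\<mu>) - 1"] by (simp add: algebra_simps)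
    also have "\<dots> \<le> 1 * \<bar>x \<bullet> ?\<mu>\<bar>"
      using \<beta>' by (intro mult_mono norm_cis_minus_1) auto
    also have "\<dots> \<le> norm x * norm ?\<mu>"
      using Cauchy_Schwarz_ineq2[of x ?\<mu>] by simp
    also have "\<dots> \<le> norm x * (2 * M)"
      using \<mu> by (intro mult_left_mono) auto
    also have "\<dots> = 2 * M * norm x" by simp
    finally have 2: "norm (cis (x \<bullet> ?\<mu>) * \<beta> ?\<mu> - \<beta> ?\<mu>) \<le> 2 * M * norm x" .
    have "norm (T k - \<beta> ?\<mu>) \<le> R + 2 * M * norm x"
      using norm_triangle_ineq[of "T k - cis (x \<bullet> ?\<mu>) * \<beta> ?\<mu>" "cis (x \<bullet> ?\<mu>) * \<beta> ?\<mu> - \<beta> ?\<mu>"] 1 2 by simp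
    hence "\<bar>Re (T k) - \<beta> ?\<mu>\<bar> \<le> R + 2 * M * norm x"
      using abs_Re_le_cmod[of "T k - \<beta> ?\<mu>"] by simp
    thus ?thesis using \<beta>' by linarith
  qed
  hence "(\<Sum>k\<in>(grid K :: ('n \<Rightarrow> nat) set). \<alpha> - 2 * M * norm x - R) \<le> (\<Sum>k\<in>grid K. Re (T k))"
    by (rule sum_mono)
  also have "\<dots> = Re (multiplier (\<lambda>\<xi>. cis (norm \<xi> powr s) * b \<xi>) (focusing s \<delta> K) x)"
    unfolding T_def Re_sum[symmetric] using b(2)
    by (subst multiplier_focusing[OF \<delta>, where B=B]) (auto simp: norm_mult)
  also have "\<dots> \<le> norm (multiplier (\<lambda>\<xi>. cis (norm \<xi> powr s) * b \<xi>) (focusing s \<delta> K) x)"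
    by (rule complex_Re_le_cmod)
  finally show ?thesis by (simp add: card_grid R_def)
qed

section \<open>The local Hardy norm of a narrow Gaussian\<close>

lemma integral_gauss_affine:
  fixes a :: "'a::euclidean_space"
  assumes "\<delta> > 0"
  shows "(LINT x|lborel. gauss (\<delta> *\<^sub>R (x - a))) = (sqrt (2 * pi) / \<delta>) ^ DIM('a)"
proof -
  have "sqrt (2 * pi) ^ DIM('a) = \<delta> ^ DIM('a) * (LINT x|lborel. gauss (- \<delta> *\<^sub>R a + \<delta> *\<^sub>R x))"
    using integral_lborel_affine[of \<delta> gauss "- \<delta> *\<^sub>R a"] assms by (simp add: integral_gauss)
  also have "(\<lambda>x. gauss (- \<delta> *\<^sub>R a + \<delta> *\<^sub>R x)) = (\<lambda>x. gauss (\<delta> *\<^sub>R (x - a)))"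
    by (simp add: algebra_simps)
  finally show ?thesis using assms by (simp add: power_divide field_simps)
qed

text \<open>Dyadic shells: where 2^k \<le> 1 + |x| \<le> 2^(k+1) the weight is at most 2^(-p k), and
  the Gaussian of width 2^k is at least exp (-2). The integral is thus dominated by a geometric
  series of ratio 2^(n - p).\<close>

lemma integrable_weight:
  fixes p :: real
  assumes p: "real DIM('a) < p"
  shows "integrable lborel (\<lambda>x::'a::euclidean_space. (1 + norm x) powr (- p))"
proof (rule integrableI_nonneg)
  let ?n = "DIM('a)"
  define c where "c = sqrt (2 * pi) ^ ?n"
  define T where "T = (\<lambda>k x. ennreal (2 powr (- p * real k)) * ennreal (gauss ((1 / 2 ^ k) *\<^sub>R (x :: 'a))))"
  have pt: "ennreal ((1 + norm x) powr (- p)) \<le> ennreal (exp 2) * (\<Sum>k. T k x)" for x :: 'a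
  proof -
    define y where "y = 1 + norm x"
    have y: "y \<ge> 1" by (simp add: y_def)
    define k where "k = nat \<lfloor>log 2 y\<rfloor>"
    have l0: "0 \<le> log 2 y" using y by simp
    have "real k \<le> log 2 y" "log 2 y \<le> real k + 1"
      using l0 unfolding k_def by linarith+
    hence k: "2 powr real k \<le> y" "y \<le> 2 powr (real k + 1)"
      using y by (simp_all add: le_log_iff log_le_iff)
    have "norm x / 2 ^ k \<le> 2"
      using k(2) y_def by (simp add: powr_add powr_realpow field_simps)
    hence "(norm x / 2 ^ k)\<^sup>2 \<le> 2\<^sup>2" by (intro power_mono) auto
    hence g: "exp (- 2) \<le> gauss ((1 / 2 ^ k) *\<^sub>R x)"
      unfolding gauss_def by simp
    have "y powr (- p) \<le> (2 powr real k) powr (- p)"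
      using k p by (intro powr_mono2') auto
    also have "\<dots> = exp 2 * (2 powr (- p * real k) * exp (- 2))"
      by (simp add: powr_powr mult.commute mult_exp_exp)
    also have "\<dots> \<le> exp 2 * (2 powr (- p * real k) * gauss ((1 / 2 ^ k) *\<^sub>R x))"
      by (intro mult_left_mono g) auto
    finally have "ennreal (y powr (- p)) \<le> ennreal (exp 2) * T k x"
      unfolding T_def using gauss_pos[of "(1 / 2 ^ k) *\<^sub>R x"]
      by (simp add: ennreal_mult[symmetric] less_imp_le)
    also have "T k x \<le> (\<Sum>k. T k x)"
      using sum_le_suminf[of "\<lambda>k. T k x" "{k}"] by simp
    finally show ?thesis unfolding y_def by (simp add: mult_left_mono)
  qed
  have "(\<integral>\<^sup>+x. ennreal ((1 + norm (x::'a)) powr (- p)) \<partial>lborel) \<le> (\<integral>\<^sup>+x. ennreal (exp 2) * (\<Sum>k. T k x) \<partial>lborel)"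
    by (intro nn_integral_mono pt)
  also have "\<dots> = ennreal (exp 2) * (\<Sum>k. \<integral>\<^sup>+x. T k x \<partial>lborel)"
    unfolding T_def by (subst nn_integral_cmult) (auto simp: nn_integral_suminf)
  also have "(\<lambda>k. \<integral>\<^sup>+x. T k x \<partial>lborel) = (\<lambda>k. ennreal (c * (2 powr (real ?n - p)) ^ k))"
  proof
    fix k
    have "(\<integral>\<^sup>+x. T k x \<partial>lborel) = ennreal (2 powr (- p * real k)) * ennreal ((sqrt (2 * pi) / (1 / 2 ^ k)) ^ ?n)"
      unfolding T_def
      by (subst nn_integral_cmult, measurable, subst nn_integral_eq_integral)
         (use integrable_gauss_affine[of "1 / 2 ^ k" "0::'a"] integral_gauss_affine[of "1 / 2 ^ k" "0::'a"] in
           \<open>auto simp: gauss_pos less_imp_le\<close>)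
    also have "\<dots> = ennreal (c * (2 powr (- p * real k) * (2 ^ k) ^ ?n))"
      by (subst ennreal_mult[symmetric]) (auto simp: c_def power_mult_distrib mult_ac)
    also have "(2::real) powr (- p * real k) * (2 ^ k) ^ ?n = (2 powr (real ?n - p)) ^ k"
    proof -
      have "((2::real) ^ k) ^ ?n = 2 powr (real ?n * real k)"
        by (simp add: powr_realpow[symmetric] powr_powr mult.commute)
      moreover have "(2 powr (real ?n - p)) ^ k = 2 powr ((real ?n - p) * real k)"
        by (simp add: powr_realpow[symmetric] powr_powr)
      ultimately show ?thesis by (simp add: powr_add[symmetric] algebra_simps)
    qed
    finally show "(\<integral>\<^sup>+x. T k x \<partial>lborel) = ennreal (c * (2 powr (real ?n - p)) ^ k)" .
  qed
  also have "ennreal (exp 2) * (\<Sum>k. ennreal (c * (2 powr (real ?n - p)) ^ k)) < \<infinity>"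
  proof -
    have "2 powr (real ?n - p) < 2 powr 0" using p by (intro powr_less_mono) auto
    hence "(\<Sum>k. ennreal (c * (2 powr (real ?n - p)) ^ k)) \<noteq> \<infinity>"
      unfolding infinity_ennreal_def
      by (intro ennreal_suminf_neq_top summable_mult summable_geometric) (auto simp: c_def)
    thus ?thesis by (simp add: ennreal_mult_less_top less_top)
  qed
  finally show "(\<integral>\<^sup>+x. ennreal ((1 + norm (x::'a)) powr (- p)) \<partial>lborel) < \<infinity>" .
qed auto

lemma smooth_continuous:
  assumes "smooth f"
  shows "continuous_on UNIV f"
proof (intro continuous_at_imp_continuous_on ballI differentiable_imp_continuous_within)
  fix x
  have "partial_derivs [] f differentiable (at x)"
    using assms unfolding smooth_def by blast
  thus "f differentiable (at x)" by (simp add: partial_derivs_def)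
qed

lemma smooth_measurable: "smooth f \<Longrightarrow> f \<in> borel_measurable borel"
  by (intro borel_measurable_continuous_onI smooth_continuous)

lemma schwartz_decay:
  assumes "schwartz f"
  shows "\<exists>C. \<forall>x. norm x ^ k * norm (f x) \<le> C"
proof -
  have "bounded (range (\<lambda>x. norm x ^ k *\<^sub>R partial_derivs [] f x))"
    using assms unfolding schwartz_def by blast
  thus ?thesis by (auto simp: bounded_iff partial_derivs_def)
qed

lemma one_plus_powr_le:
  fixes a p :: real
  assumes "0 \<le> a" "0 \<le> p"
  shows "(1 + a) powr p \<le> 2 powr p * (1 + a powr p)"
proof -
  have "(1 + a) powr p \<le> (2 * max 1 a) powr p"
    using assms by (intro powr_mono2) auto
  also have "\<dots> = 2 powr p * max 1 a powr p"
    by (simp add: powr_mult)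
  also have "max 1 a powr p \<le> 1 + a powr p"
    by (auto simp: max_def)
  finally show ?thesis by (simp add: mult_left_mono)
qed

text \<open>From 1 + r \<le> exp r and completing the square, which leaves half of the Gaussian
  exponent.\<close>

lemma weighted_gauss_le:
  fixes u :: "'a::euclidean_space"
  assumes "0 \<le> p"
  shows "(1 + norm u) powr p * gauss u \<le> exp (p\<^sup>2) * gauss ((1 / sqrt 2) *\<^sub>R (u - 0))"
proof -
  have "(1 + norm u) powr p \<le> exp (norm u) powr p"
    using assms by (intro powr_mono2) (auto simp: exp_ge_add_one_self)
  also have "\<dots> = exp (p * norm u)" by (simp add: powr_def mult.commute)
  finally have "(1 + norm u) powr p * gauss u \<le> exp (p * norm u) * gauss u"
    using gauss_pos[of u] by (intro mult_right_mono) auto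
  also have "\<dots> = exp (p * norm u - (norm u)\<^sup>2 / 2)"
    unfolding gauss_def exp_add[symmetric] by simp
  also have "\<dots> \<le> exp (p\<^sup>2 - (norm u)\<^sup>2 / 4)"
  proof -
    have "0 \<le> (norm u / 2 - p)\<^sup>2" by simp
    hence "p * norm u \<le> (norm u)\<^sup>2 / 4 + p\<^sup>2"
      by (simp add: power2_diff power_divide mult.commute)
    thus ?thesis unfolding exp_le_cancel_iff by linarith
  qed
  also have "\<dots> = exp (p\<^sup>2) * gauss ((1 / sqrt 2) *\<^sub>R (u - 0))"
    unfolding gauss_def exp_add[symmetric] by (simp add: power_divide)
  finally show ?thesis .
qed

text \<open>The prefactor normalises the transform to \<open>gauss (\<xi> /\<^sub>R N)\<close>,
  which stays above a constant for |\<xi>| \<le> 2 N.\<close>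

definition bump :: "real \<Rightarrow> real^'n::finite \<Rightarrow> complex" where
  "bump N x = complex_of_real ((N / sqrt (2 * pi)) ^ CARD('n)) * packet 0 N 0 x"

lemma schwartz_bump: "N > 0 \<Longrightarrow> schwartz (bump N)"
  unfolding bump_def[abs_def] by (rule schwartz_gauss_class[of N]) (auto intro: gauss_class.intros)

lemma norm_bump: "N > 0 \<Longrightarrow> norm (bump N (x::real^'n)) = (N / sqrt (2 * pi)) ^ CARD('n) * gauss (N *\<^sub>R x)"
  by (simp add: bump_def norm_mult norm_packet norm_power norm_divide)

lemma fourier_bump: "N > 0 \<Longrightarrow> fourier (bump N) (\<xi>::real^'n) = complex_of_real (gauss (\<xi> /\<^sub>R N))"
proof -
  assume N: "N > 0"
  have "fourier (bump N) \<xi> = complex_of_real ((N / sqrt (2 * pi)) ^ CARD('n)) * fourier (packet 0 N 0) \<xi>"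
    unfolding fourier_def bump_def mult.left_commute[of "cis _" "complex_of_real (_ ^ _)"] by (rule integral_mult_right_zero)
  also have "\<dots> = complex_of_real ((N / sqrt (2 * pi)) ^ CARD('n) * (sqrt (2 * pi) / N) ^ CARD('n)) * complex_of_real (gauss (\<xi> /\<^sub>R N))"
    by (simp add: fourier_packet[OF N])
  also have "(N / sqrt (2 * pi)) ^ CARD('n) * (sqrt (2 * pi) / N) ^ CARD('n) = 1"
    using N by (simp add: power_mult_distrib[symmetric])
  finally show ?thesis by simp
qed

text \<open>
  The Gaussian has no cancellation, so a loss (here \<open>N^\<epsilon>\<close>) is unavoidable; it comes from
  \<open>t^(-n) |x/t|^(-n-\<epsilon>) \<le> |x|^(-n-\<epsilon>)\<close> for \<open>t < 1\<close>, and it is harmless for the exponent.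
\<close>

lemma h1_norm_bump:
  fixes \<Phi> :: "real^'n \<Rightarrow> complex"
  assumes \<Phi>: "schwartz \<Phi>" and \<epsilon>: "0 < \<epsilon>" "\<epsilon> \<le> 1"
  shows "\<exists>C. \<forall>N\<ge>1. h1_norm \<Phi> (bump N) \<le> ennreal (C * N powr \<epsilon>)"
proof -
  define n where "n = CARD('n)"
  define p where "p = real n + \<epsilon>"
  have p: "p > 0" "real n < p" using \<epsilon> by (auto simp: p_def)
  have [measurable]: "\<Phi> \<in> borel_measurable borel"
    using \<Phi> by (auto simp: schwartz_def intro: smooth_measurable)
  obtain C1 where C1: "\<And>x. norm (\<Phi> x) \<le> C1"
    using schwartz_decay[OF \<Phi>, of 0] by auto
  obtain C2 where C2: "\<And>x. norm x ^ (n + 1) * norm (\<Phi> x) \<le> C2"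
    using schwartz_decay[OF \<Phi>, of "n + 1"] by auto
  define C0 where "C0 = C1 + C2"
  \<comment> \<open>Schwartz seminorms have integer exponents; real exponents up to n + 1 are
    dominated by the powers 0 and n + 1 together.\<close>
  have decay: "norm x powr q * norm (\<Phi> x) \<le> C0" if q: "0 \<le> q" "q \<le> real n + 1" for x q
  proof -
    have "norm x powr q \<le> 1 + norm x ^ (n + 1)"
    proof (cases "norm x \<le> 1")
      case True
      hence "norm x powr q \<le> 1 powr q" using q by (intro powr_mono2) auto
      thus ?thesis by (simp add: add_increasing2)
    next
      case False
      hence "norm x powr q \<le> norm x powr (real (n + 1))" using q by (intro powr_mono) auto
      also have "\<dots> = norm x ^ (n + 1)" using False by (intro powr_realpow) auto
      finally show ?thesis by simp
    qed
    hence "norm x powr q * norm (\<Phi> x) \<le> (1 + norm x ^ (n + 1)) * norm (\<Phi> x)"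
      by (rule mult_right_mono) simp
    also have "\<dots> \<le> C0" using C1[of x] C2[of x] by (simp add: C0_def distrib_right)
    finally show ?thesis .
  qed
  have "0 \<le> C1" by (rule order_trans[OF norm_ge_zero C1])
  moreover have C2': "0 \<le> C2" by (rule order_trans[OF _ C2[of 0]]) simp
  ultimately have C0: "0 \<le> C0" by (simp add: C0_def)
  have int\<Phi>: "integrable lborel (\<lambda>x. norm (\<Phi> x))"
  proof (rule Bochner_Integration.integrable_bound)
    show "integrable lborel (\<lambda>x::real^'n. 2 powr (real n + 1) * 2 * C0 * (1 + norm x) powr (- (real n + 1)))"
      by (intro integrable_mult_right integrable_weight) (simp add: n_def)
    have "norm (\<Phi> x) \<le> 2 powr (real n + 1) * 2 * C0 * (1 + norm x) powr (- (real n + 1))" for x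
    proof -
      have "(1 + norm x) powr (real n + 1) * norm (\<Phi> x) \<le> 2 powr (real n + 1) * (1 + norm x powr (real n + 1)) * norm (\<Phi> x)"
        by (intro mult_right_mono one_plus_powr_le) auto
      also have "\<dots> = 2 powr (real n + 1) * (norm (\<Phi> x) + norm x powr (real n + 1) * norm (\<Phi> x))"
        by (simp add: algebra_simps)
      also have "\<dots> \<le> 2 powr (real n + 1) * (C0 + C0)"
      proof -
        have "norm (\<Phi> x) \<le> C0" using C1[of x] C2' by (simp add: C0_def)
        thus ?thesis using decay[of "real n + 1" x] by (intro mult_left_mono add_mono) auto
      qed
      finally have "(1 + norm x) powr (real n + 1) * norm (\<Phi> x) \<le> 2 powr (real n + 1) * 2 * C0" by simp
      moreover have "(1 + norm x) powr (real n + 1) > 0"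
        unfolding powr_gt_zero using norm_ge_zero[of x] by linarith
      ultimately show ?thesis by (simp only: powr_minus_divide) (simp add: field_simps)
    qed
    thus "AE x in lborel. norm (norm (\<Phi> x)) \<le> norm (2 powr (real n + 1) * 2 * C0 * (1 + norm x) powr (- (real n + 1)))"
      using C0 by (intro AE_I2) simp
  qed measurable
  define A where "A = (LINT x|lborel. norm (\<Phi> x))"
  define c where "c = sqrt (2 * pi) ^ n"
  have c: "c > 0" by (simp add: c_def)
  \<comment> \<open>The Gaussian bears the weight of exponent \<open>p\<close> with bounded supremum
    and finite integral; both are used below.\<close>
  define w where "w = (\<lambda>u::real^'n. (1 + norm u) powr p * gauss u)"
  have w: "0 \<le> w u" "w u \<le> exp (p\<^sup>2)" for u
  proof -
    show "0 \<le> w u" unfolding w_def using gauss_pos[of u] by simp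
    have "w u \<le> exp (p\<^sup>2) * gauss ((1 / sqrt 2) *\<^sub>R (u - 0))"
      unfolding w_def using p by (intro weighted_gauss_le) auto
    also have "\<dots> \<le> exp (p\<^sup>2) * 1" by (intro mult_left_mono gauss_le_1) auto
    finally show "w u \<le> exp (p\<^sup>2)" by simp
  qed
  have [measurable]: "w \<in> borel_measurable borel" unfolding w_def by measurable
  have intw: "integrable lborel w"
  proof (rule Bochner_Integration.integrable_bound)
    show "integrable lborel (\<lambda>u::real^'n. exp (p\<^sup>2) * gauss ((1 / sqrt 2) *\<^sub>R (u - 0)))"
      by (intro integrable_mult_right integrable_gauss_affine) simp
    have "norm (w u) \<le> norm (exp (p\<^sup>2) * gauss ((1 / sqrt 2) *\<^sub>R (u - 0)))" for u
    proof -
      have "norm (w u) = w u" using w(1)[of u] by simp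
      also have "\<dots> \<le> exp (p\<^sup>2) * gauss ((1 / sqrt 2) *\<^sub>R (u - 0))"
        unfolding w_def using p by (intro weighted_gauss_le) auto
      also have "\<dots> \<le> norm (exp (p\<^sup>2) * gauss ((1 / sqrt 2) *\<^sub>R (u - 0)))"
        unfolding real_norm_def by (rule abs_ge_self)
      finally show ?thesis .
    qed
    thus "AE u in lborel. norm (w u) \<le> norm (exp (p\<^sup>2) * gauss ((1 / sqrt 2) *\<^sub>R (u - 0)))" by simp
  qed measurable
  define H where "H = (LINT u|lborel. w u)"
  have H: "0 \<le> H" unfolding H_def by (intro Bochner_Integration.integral_nonneg w)
  have A: "0 \<le> A" unfolding A_def by (intro Bochner_Integration.integral_nonneg) auto
  define W where "W = (LINT x::real^'n|lborel. (1 + norm x) powr (- p))"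
  have intW: "integrable lborel (\<lambda>x::real^'n. (1 + norm x) powr (- p))"
    using p by (intro integrable_weight) (simp add: n_def)
  define C where "C = 2 powr p * (exp (p\<^sup>2) / c * A + C0 * H / c)"
  have C: "0 \<le> C" using A C0 H c by (simp add: C_def)
  show ?thesis
  proof (intro exI[of _ "C * W"] allI impI)
    fix N :: real assume N: "1 \<le> N"
    have Np: "N > 0" using N by simp
    have bumpw: "(1 + N * norm y) powr p * norm (bump N y) = N ^ n / c * w (N *\<^sub>R y)" for y :: "real^'n"
      using Np by (simp add: norm_bump w_def n_def c_def power_divide)
    \<comment> \<open>The bound is uniform in \<open>t\<close>, so it passes to the supremum; its
      integral over \<open>x\<close> is of order N^p N^(-n) = N^\<epsilon>.\<close>
    have key: "norm (conv (dilate t \<Phi>) (bump N) x) \<le> C * N powr p * (1 + norm (N *\<^sub>R x)) powr (- p)"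
      if t: "0 < t" "t < 1" for t x
    proof -
      define \<Psi> where "\<Psi> = dilate t \<Phi>"
      have [measurable]: "\<Psi> \<in> borel_measurable borel"
        unfolding \<Psi>_def dilate_def[abs_def] by measurable
      have [measurable]: "bump N \<in> borel_measurable (borel :: (real^'n) measure)"
        unfolding bump_def[abs_def] by measurable
      have n\<Psi>: "norm (\<Psi> z) = norm (\<Phi> (z /\<^sub>R t)) / t ^ n" for z
        unfolding \<Psi>_def dilate_def norm_mult norm_of_real n_def using t by (simp add: divide_inverse mult.commute)
      have \<Psi>decay: "norm z powr p * norm (\<Psi> z) \<le> C0" for z
      proof -
        have "norm z powr p * norm (\<Psi> z) = t powr p / t ^ n * (norm (z /\<^sub>R t) powr p * norm (\<Phi> (z /\<^sub>R t)))"
          using t by (simp add: n\<Psi> powr_mult powr_divide divide_inverse[symmetric] field_simps)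
        also have "t powr p / t ^ n = t powr \<epsilon>"
          using t by (simp add: p_def powr_add powr_realpow)
        also have "t powr \<epsilon> * (norm (z /\<^sub>R t) powr p * norm (\<Phi> (z /\<^sub>R t))) \<le> 1 * C0"
          using t \<epsilon> p by (intro mult_mono decay powr_le1) (auto simp: p_def)
        finally show ?thesis by simp
      qed
      define X where "X = (1 + N * norm x) powr p"
      have Xpos: "X > 0"
      proof -
        have "0 \<le> N * norm x" using Np by simp
        thus ?thesis unfolding X_def powr_gt_zero by linarith
      qed
      \<comment> \<open>The weight is distributed by 1 + N |x| \<le> (1 + N |x - y|) (1 + N |y|),
        and the p-th power of the first factor is split into 1 and a pure power. For the 1, the
        supremum of \<open>w\<close> meets the integral of \<open>\<Psi>\<close>; for the pure
        power, the decay of \<open>\<Psi>\<close> meets the integral of \<open>w\<close>.\<close>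
      define J where "J = (\<lambda>y. 2 powr p * (N ^ n / c * exp (p\<^sup>2) * norm (\<Psi> (x - y)) + N powr p * C0 * (N ^ n / c * w (N *\<^sub>R y))))"
      have J: "X * norm (\<Psi> (x - y) * bump N y) \<le> J y" for y
      proof -
        have "1 + N * norm x \<le> 1 + N * (norm (x - y) + norm y)"
          using norm_triangle_ineq[of "x - y" y] Np by (simp add: mult_left_mono)
        also have "\<dots> \<le> (1 + N * norm (x - y)) * (1 + N * norm y)"
          using Np by (simp add: algebra_simps)
        finally have "X \<le> ((1 + N * norm (x - y)) * (1 + N * norm y)) powr p"
          unfolding X_def using p Np by (intro powr_mono2) auto
        also have "\<dots> = (1 + N * norm (x - y)) powr p * (1 + N * norm y) powr p"
          using Np by (simp add: powr_mult)
        also have "\<dots> \<le> (2 powr p * (1 + (N * norm (x - y)) powr p)) * (1 + N * norm y) powr p"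
          using Np p by (intro mult_right_mono one_plus_powr_le) auto
        finally have "X * (norm (\<Psi> (x - y)) * norm (bump N y)) \<le>
            (2 powr p * (1 + (N * norm (x - y)) powr p)) * (1 + N * norm y) powr p * (norm (\<Psi> (x - y)) * norm (bump N y))"
          by (rule mult_right_mono) simp
        also have "\<dots> = 2 powr p * ((norm (\<Psi> (x - y)) + N powr p * (norm (x - y) powr p * norm (\<Psi> (x - y)))) * (N ^ n / c * w (N *\<^sub>R y)))"
          unfolding bumpw[symmetric] using Np by (simp add: powr_mult algebra_simps)
        also have "\<dots> \<le> 2 powr p * ((norm (\<Psi> (x - y)) + N powr p * C0) * (N ^ n / c * w (N *\<^sub>R y)))"
          using Np c w by (intro mult_left_mono mult_right_mono add_left_mono \<Psi>decay) auto
        also have "\<dots> \<le> J y"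
        proof -
          have "norm (\<Psi> (x - y)) * (N ^ n / c * w (N *\<^sub>R y)) \<le> norm (\<Psi> (x - y)) * (N ^ n / c * exp (p\<^sup>2))"
            using Np c w by (intro mult_left_mono) auto
          also have "\<dots> = N ^ n / c * exp (p\<^sup>2) * norm (\<Psi> (x - y))"
            by (rule mult.commute)
          finally show ?thesis
            unfolding J_def distrib_right by (intro mult_left_mono[OF add_right_mono]) auto
        qed
        finally show ?thesis by (simp add: norm_mult)
      qed
      have refl\<Phi>: "(LINT y|lborel. norm (\<Psi> (x - y))) = A" and int\<Psi>: "integrable lborel (\<lambda>y. norm (\<Psi> (x - y)))"
      proof -
        have eq: "(\<lambda>y. norm (\<Psi> (x - y))) = (\<lambda>y. (\<lambda>z. norm (\<Phi> z) / t ^ n) (x /\<^sub>R t + (- inverse t) *\<^sub>R y))"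
          using t by (simp add: n\<Psi> fun_eq_iff scaleR_diff_right)
        have *: "inverse t \<noteq> 0" "- inverse t \<noteq> 0" using t by auto
        show "integrable lborel (\<lambda>y. norm (\<Psi> (x - y)))"
          unfolding eq by (subst integrable_lborel_affine[OF *(2)]) (use int\<Phi> in simp)
        show "(LINT y|lborel. norm (\<Psi> (x - y))) = A"
          using integral_lborel_affine[OF *(2), of "\<lambda>z. norm (\<Phi> z) / t ^ n" "x /\<^sub>R t"] t
          unfolding eq by (simp add: A_def n_def field_simps)
      qed
      have intw': "integrable lborel (\<lambda>y. w (N *\<^sub>R y))" and eqw: "N ^ n * (LINT y|lborel. w (N *\<^sub>R y)) = H"
        using integrable_lborel_affine[of N w 0] integral_lborel_affine[of N w 0] intw Np
        by (simp_all add: H_def n_def)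
      have intJ: "integrable lborel J"
        unfolding J_def by (intro integrable_mult_right Bochner_Integration.integrable_add int\<Psi> intw')
      have "(LINT y|lborel. J y) = 2 powr p * (N ^ n / c * exp (p\<^sup>2) * A + N powr p * C0 * (N ^ n / c * (LINT y|lborel. w (N *\<^sub>R y))))"
        unfolding J_def refl\<Phi>[symmetric] integral_mult_right_zero
        by (subst Bochner_Integration.integral_add) (auto intro!: integrable_mult_right int\<Psi> intw')
      also have "\<dots> = 2 powr p * (N ^ n * (exp (p\<^sup>2) / c * A) + N powr p * (C0 * H / c))"
        unfolding eqw[symmetric] by (simp add: field_simps)
      also have "\<dots> \<le> 2 powr p * (N powr p * (exp (p\<^sup>2) / c * A) + N powr p * (C0 * H / c))"
      proof -
        have "N ^ n \<le> N powr p"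
          using N p powr_mono[of "real n" p N] by (simp add: powr_realpow)
        thus ?thesis using A c by (intro mult_left_mono add_mono mult_right_mono) auto
      qed
      also have "\<dots> = C * N powr p" by (simp add: C_def algebra_simps)
      finally have JC: "(LINT y|lborel. J y) \<le> C * N powr p" .
      have "norm (conv \<Psi> (bump N) x) \<le> (LINT y|lborel. J y / X)"
        unfolding conv_def
      proof (rule Bochner_Integration.integral_norm_bound_integral)
        have b: "norm (\<Psi> (x - y) * bump N y) \<le> J y / X" for y
          using J[of y] Xpos by (simp add: field_simps)
        show "norm (\<Psi> (x - y) * bump N y) \<le> J y / X" for y by (rule b)
        show "integrable lborel (\<lambda>y. J y / X)" using intJ by simp
        thus "integrable lborel (\<lambda>y. \<Psi> (x - y) * bump N y)"
          by (rule Bochner_Integration.integrable_bound) (measurable, intro AE_I2, unfold real_norm_def, rule order_trans[OF b abs_ge_self])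
      qed
      also have "\<dots> \<le> C * N powr p / X" using JC Xpos by (simp add: divide_right_mono)
      also have "\<dots> = C * N powr p * (1 + norm (N *\<^sub>R x)) powr (- p)"
        using Np by (simp add: X_def powr_minus_divide)
      finally show ?thesis unfolding \<Psi>_def .
    qed
    have "h1_norm \<Phi> (bump N) \<le> (\<integral>\<^sup>+x. ennreal (C * N powr p * (1 + norm (N *\<^sub>R x :: real^'n)) powr (- p)) \<partial>lborel)"
      unfolding h1_norm_def by (intro nn_integral_mono SUP_least ennreal_leI key) auto
    also have "\<dots> = ennreal (C * N powr p * (LINT x::real^'n|lborel. (1 + norm (N *\<^sub>R x)) powr (- p)))"
      using intW Np C integrable_lborel_affine[of N "\<lambda>x::real^'n. (1 + norm x) powr (- p)" 0]
      by (subst nn_integral_eq_integral) auto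
    also have "(LINT x::real^'n|lborel. (1 + norm (N *\<^sub>R x)) powr (- p)) = W / N ^ n"
      using integral_lborel_affine[of N "\<lambda>x::real^'n. (1 + norm x) powr (- p)" 0] Np
      by (simp add: W_def n_def field_simps)
    also have "C * N powr p * (W / N ^ n) = C * W * N powr \<epsilon>"
      using Np by (simp add: p_def powr_add powr_realpow)
    finally show "h1_norm \<Phi> (bump N) \<le> ennreal (C * W * N powr \<epsilon>)" .
  qed
qed

section \<open>Lower bounds for the multiplier operators\<close>

text \<open>The function is radial with profile exp (- r^2 / 2), whose slope is at most 1 in size
  because z \<le> 1 + z^2 / 2 \<le> exp (z^2 / 2).\<close>

lemma gauss_lipschitz: "\<bar>gauss u - gauss v\<bar> \<le> norm (u - v)"
proof -
  have mvt: "\<bar>exp (- b\<^sup>2 / 2) - exp (- a\<^sup>2 / 2)\<bar> \<le> b - a" if "0 \<le> a" "a < b" for a b :: real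
  proof -
    have "\<exists>z>a. z < b \<and> exp (- b\<^sup>2 / 2) - exp (- a\<^sup>2 / 2) = (b - a) * (- z * exp (- z\<^sup>2 / 2))"
      using that by (intro MVT2) (auto intro!: derivative_eq_intros)
    then obtain z where z: "a < z" "exp (- b\<^sup>2 / 2) - exp (- a\<^sup>2 / 2) = (b - a) * (- z * exp (- z\<^sup>2 / 2))"
      by auto
    have "0 \<le> (z - 1)\<^sup>2" by simp
    hence "z \<le> 1 + z\<^sup>2 / 2" by (simp add: power2_diff)
    also have "\<dots> \<le> exp (z\<^sup>2 / 2)" by (rule exp_ge_add_one_self)
    finally have "z * exp (- z\<^sup>2 / 2) \<le> exp (z\<^sup>2 / 2) * exp (- z\<^sup>2 / 2)"
      by (rule mult_right_mono) simp
    hence "z * exp (- z\<^sup>2 / 2) \<le> 1" by (simp add: exp_add[symmetric])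
    hence "(b - a) * (z * exp (- z\<^sup>2 / 2)) \<le> (b - a) * 1"
      using that by (intro mult_left_mono) auto
    thus ?thesis unfolding z(2) using that z(1) by (simp add: abs_mult)
  qed
  have "\<bar>gauss u - gauss v\<bar> \<le> \<bar>norm u - norm v\<bar>"
    using mvt[of "norm u" "norm v"] mvt[of "norm v" "norm u"] unfolding gauss_def
    by (cases "norm u" "norm v" rule: linorder_cases) (auto simp: abs_minus_commute)
  also have "\<dots> \<le> norm (u - v)" by (rule norm_triangle_ineq3)
  finally show ?thesis .
qed

text \<open>Fubini. The pairing is bilinear, without conjugation, hence the reflection of
  \<open>\<sigma>\<close>.\<close>

lemma fourier_pairing:
  fixes \<sigma> F :: "real^'n \<Rightarrow> complex"
  assumes \<sigma>: "integrable lborel \<sigma>" and F: "integrable lborel F"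
  shows "(LINT x|lborel. (LINT \<xi>|lborel. cis (x \<bullet> \<xi>) * \<sigma> \<xi>) * F x) = (LINT \<xi>|lborel. \<sigma> (- \<xi>) * fourier F \<xi>)"
proof -
  have [measurable]: "\<sigma> \<in> borel_measurable borel" "F \<in> borel_measurable borel"
    using \<sigma> F borel_measurable_integrable by fastforce+
  define f where "f = (\<lambda>x \<xi>. cis (x \<bullet> \<xi>) * \<sigma> \<xi> * F x)"
  have in\<xi>: "integrable lborel (\<lambda>\<xi>. f x \<xi>)" for x
  proof -
    have "integrable lborel (\<lambda>\<xi>. cis (x \<bullet> \<xi>) * \<sigma> \<xi>)"
      by (rule Bochner_Integration.integrable_bound[OF \<sigma>]) (auto simp: norm_mult)
    thus ?thesis unfolding f_def by (rule integrable_mult_left)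
  qed
  have "integrable (lborel \<Otimes>\<^sub>M lborel) (case_prod f)"
  proof (rule lborel_pair.Fubini_integrable)
    show "case_prod f \<in> borel_measurable (lborel \<Otimes>\<^sub>M lborel)"
      unfolding f_def by measurable
    have "(\<lambda>x. LINT \<xi>|lborel. norm (case (x, \<xi>) of (x, \<xi>) \<Rightarrow> f x \<xi>)) = (\<lambda>x. (LINT \<xi>|lborel. norm (\<sigma> \<xi>)) * norm (F x))"
      unfolding f_def by (simp add: norm_mult)
    thus "integrable lborel (\<lambda>x. LINT \<xi>|lborel. norm (case (x, \<xi>) of (x, \<xi>) \<Rightarrow> f x \<xi>))"
      using F by simp
    show "AE x in lborel. integrable lborel (\<lambda>\<xi>. case (x, \<xi>) of (x, \<xi>) \<Rightarrow> f x \<xi>)"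
      using in\<xi> by simp
  qed
  hence "(LINT x|lborel. LINT \<xi>|lborel. f x \<xi>) = (LINT \<xi>|lborel. LINT x|lborel. f x \<xi>)"
    by (rule lborel_pair.Fubini_integral[symmetric])
  also have "(\<lambda>\<xi>. LINT x|lborel. f x \<xi>) = (\<lambda>\<xi>. \<sigma> \<xi> * fourier F (- \<xi>))"
  proof
    fix \<xi>
    have "(\<lambda>x. f x \<xi>) = (\<lambda>x. \<sigma> \<xi> * (cis (- ((- \<xi>) \<bullet> x)) * F x))"
      by (simp add: f_def fun_eq_iff inner_commute)
    thus "(LINT x|lborel. f x \<xi>) = \<sigma> \<xi> * fourier F (- \<xi>)"
      unfolding fourier_def by (simp only: integral_mult_right_zero)
  qed
  also have "(LINT \<xi>|lborel. \<sigma> \<xi> * fourier F (- \<xi>)) = (LINT \<xi>|lborel. \<sigma> (- \<xi>) * fourier F \<xi>)"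
    using integral_lborel_affine[of "-1" "\<lambda>\<xi>. \<sigma> \<xi> * fourier F (- \<xi>)" 0] by simp
  also have "(\<lambda>x. LINT \<xi>|lborel. f x \<xi>) = (\<lambda>x. (LINT \<xi>|lborel. cis (x \<bullet> \<xi>) * \<sigma> \<xi>) * F x)"
    unfolding f_def by (simp only: integral_mult_left_zero)
  finally show ?thesis .
qed

text \<open>Duality: the pairing becomes the value at 0 of a multiplier operator applied to
  \<open>F\<close>, with the transform of \<open>h\<close> absorbed into the symbol. For the phase
  |\<xi>|^s, which is even, the reflection is harmless, so a superposition focusing at 0 makes this
  value large.\<close>

lemma multiplier_pairing:
  fixes \<tau> h F :: "real^'n \<Rightarrow> complex"
  assumes "integrable lborel (\<lambda>\<xi>. \<tau> \<xi> * fourier h \<xi>)" "integrable lborel F"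
  shows "(LINT x|lborel. multiplier \<tau> h x * F x) = multiplier (\<lambda>\<xi>. \<tau> (- \<xi>) * fourier h (- \<xi>)) F 0"
  using fourier_pairing[OF assms] unfolding multiplier_def
  by (simp add: mult.assoc)

text \<open>\<delta>^2 M^(s-2) is confined to [D/4, D]: the upper end controls the spreading of
  packets, the lower end keeps the separation above a fixed \<open>\<kappa>\<close> and so gives a
  bound \<open>C\<close> independent of \<open>M\<close>.\<close>

lemma focusing_scale:
  assumes s: "0 < s" "s < 1"
  obtains C c d :: real where "C > 0" "c > 0" "d > 0"
    "\<And>M. M \<ge> 1 \<Longrightarrow> \<exists>K \<delta>. K \<ge> 1 \<and> \<delta> > 0 \<and> M = \<delta> * K * sqrt CARD('n::finite) \<and>
      gauss_moment TYPE(real^'n) * (10 * \<delta>\<^sup>2 * M powr (s - 2)) \<le> 1 / 100 \<and> d \<le> \<delta>\<^sup>2 * M powr (s - 2) \<and>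
      c * M powr (s / 2) \<le> real K \<and> (\<forall>x::real^'n. norm (focusing s \<delta> K x) \<le> C)"
proof -
  define n where "n = real CARD('n)"
  define G where "G = gauss_moment TYPE(real^'n)"
  \<comment> \<open>Small enough for 10 G D \<le> 1/100 and for n D \<le> 1; the latter yields K
    \<ge> M^(s/2), that is, the witness 1 for \<open>c\<close>.\<close>
  define D where "D = 1 / (1000 * n * (1 + G))"
  define \<kappa> where "\<kappa> = s * (1 - s) * 2 powr (s - 2) * (D / 4)"
  define C where "C = (2 * exp 2 * (1 + 1 / \<kappa>)) ^ CARD('n)"
  have n: "n \<ge> 1" by (simp add: n_def Suc_leI)
  have G: "G \<ge> 0" unfolding G_def by (rule gauss_moment_nonneg)
  have D: "D > 0" using n G by (simp add: D_def)
  have "1000 * n * (1 + G) \<ge> 1 * 1" using n G by (intro mult_mono) auto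
  hence nD: "n * D \<le> 1" using n G by (simp add: D_def field_simps)
  have GD: "G * (10 * D) \<le> 1 / 100"
  proof -
    have "G * 1 \<le> (1 + G) * n" using n G by (intro mult_mono) auto
    moreover have "n * (1 + G) > 0" using n G by (intro mult_pos_pos) auto
    ultimately have "G / (n * (1 + G)) \<le> 1" by (simp add: divide_le_eq mult.commute)
    moreover have "G * (10 * D) = G / (n * (1 + G)) / 100" by (simp add: D_def)
    ultimately show ?thesis by simp
  qed
  have \<kappa>: "\<kappa> > 0" using s D by (simp add: \<kappa>_def)
  have main: "\<exists>K \<delta>. K \<ge> 1 \<and> \<delta> > 0 \<and> M = \<delta> * K * sqrt CARD('n) \<and>
      G * (10 * \<delta>\<^sup>2 * M powr (s - 2)) \<le> 1 / 100 \<and> D / 4 \<le> \<delta>\<^sup>2 * M powr (s - 2) \<and>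
      1 * M powr (s / 2) \<le> real K \<and> (\<forall>x::real^'n. norm (focusing s \<delta> K x) \<le> C)" if M: "M \<ge> 1" for M
  proof -
    \<comment> \<open>The real number of steps per coordinate for which \<delta>^2 M^(s-2) would
      equal \<open>D\<close>. Rounding up gives y \<le> K \<le> 2 y, hence the loss of a factor 4 at
      most.\<close>
    define y where "y = M powr (s / 2) / sqrt (n * D)"
    define K where "K = nat \<lceil>y\<rceil>"
    define \<delta> where "\<delta> = M / (K * sqrt n)"
    have "1 \<le> M powr (s / 2)" using M s by (intro ge_one_powr_ge_zero) auto
    moreover have "sqrt (n * D) \<le> 1" "sqrt (n * D) > 0" using nD n D by simp_all
    ultimately have "M powr (s / 2) * sqrt (n * D) \<le> M powr (s / 2) * 1"
      by (intro mult_left_mono) auto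
    hence y: "M powr (s / 2) \<le> y"
      unfolding y_def using \<open>sqrt (n * D) > 0\<close> by (simp add: le_divide_eq)
    with \<open>1 \<le> M powr (s / 2)\<close> have y1: "1 \<le> y" by linarith
    have K: "y \<le> K" "K \<le> 2 * y" using y1 unfolding K_def by linarith+
    have K1: "K \<ge> 1" using K y1 by linarith
    have \<delta>: "\<delta> > 0" using M K1 n by (simp add: \<delta>_def)
    have eq: "\<delta>\<^sup>2 * M powr (s - 2) = D * (y / K)\<^sup>2"
    proof -
      have y2: "y\<^sup>2 = M powr s / (n * D)"
        using n D M by (simp add: y_def power_divide powr_power)
      have "\<delta>\<^sup>2 * M powr (s - 2) = M powr s / (K\<^sup>2 * n)"
        using n M by (simp add: \<delta>_def power_divide power_mult_distrib powr_diff powr_numeral)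
      also have "\<dots> = D * (y / K)\<^sup>2"
        unfolding power_divide y2 using D by simp
      finally show ?thesis .
    qed
    have q: "1 / 2 \<le> y / K" "y / K \<le> 1" using K K1 by (simp_all add: field_simps)
    have "(1 / 2)\<^sup>2 \<le> (y / K)\<^sup>2" "(y / K)\<^sup>2 \<le> 1\<^sup>2"
      using q y1 by (intro power_mono; simp)+
    hence "D * (1 / 2)\<^sup>2 \<le> D * (y / K)\<^sup>2" "D * (y / K)\<^sup>2 \<le> D * 1\<^sup>2"
      using D by (intro mult_left_mono; linarith)+
    hence low: "D / 4 \<le> \<delta>\<^sup>2 * M powr (s - 2)" and up: "\<delta>\<^sup>2 * M powr (s - 2) \<le> D"
      unfolding eq by (simp_all add: power_divide)
    have "G * (10 * \<delta>\<^sup>2 * M powr (s - 2)) \<le> G * (10 * D)"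
      using G up by (intro mult_left_mono) auto
    also note GD
    finally have 1: "G * (10 * \<delta>\<^sup>2 * M powr (s - 2)) \<le> 1 / 100" .
    have Meq: "M = \<delta> * K * sqrt CARD('n)" using K1 n by (simp add: \<delta>_def n_def)
    have 2: "norm (focusing s \<delta> K x) \<le> C" for x :: "real^'n"
    proof -
      define \<kappa>' where "\<kappa>' = s * (1 - s) * (2 * M) powr (s - 2) * \<delta>\<^sup>2"
      have "\<kappa>' = s * (1 - s) * 2 powr (s - 2) * (\<delta>\<^sup>2 * M powr (s - 2))"
        using M by (simp add: \<kappa>'_def powr_mult)
      hence "\<kappa> \<le> \<kappa>'"
        unfolding \<kappa>_def using s low by (simp add: mult_left_mono)
      hence "1 / \<kappa>' \<le> 1 / \<kappa>" using \<kappa> by (intro divide_left_mono) auto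
      hence "(2 * exp 2 * (1 + 1 / \<kappa>')) ^ CARD('n) \<le> C"
        unfolding C_def using \<kappa> \<open>\<kappa> \<le> \<kappa>'\<close> by (intro power_mono mult_left_mono) auto
      moreover have "norm (focusing s \<delta> K x) \<le> (2 * exp 2 * (1 + 1 / \<kappa>')) ^ CARD('n)"
        by (rule focusing_bounded[OF s \<delta> K1 Meq \<kappa>'_def])
      ultimately show ?thesis by simp
    qed
    show ?thesis using K1 \<delta> Meq 1 low y K 2 by (intro exI[of _ K] exI[of _ \<delta>]) auto
  qed
  have "C > 0" using \<kappa> by (simp add: C_def add_pos_pos)
  thus ?thesis using that[of C 1 "D / 4"] D main unfolding G_def by auto
qed

lemma step_bounds:
  assumes "M = \<delta> * real K * sqrt CARD('n::finite)" "K \<ge> 1" "\<delta> > 0"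
  shows "\<delta> \<le> M" "\<delta> / M \<le> 1 / real K"
proof -
  have n: "1 \<le> sqrt CARD('n)" by (simp add: Suc_leI)
  have "\<delta> * (1 * 1) \<le> \<delta> * (real K * sqrt CARD('n))"
    using assms n by (intro mult_left_mono mult_mono) auto
  thus "\<delta> \<le> M" using assms by (simp add: mult.assoc)
  have "\<delta> * K * 1 \<le> \<delta> * K * sqrt CARD('n)"
    using assms n by (intro mult_left_mono) auto
  moreover have "M > 0" using assms by simp
  ultimately show "\<delta> / M \<le> 1 / real K" using assms by (simp add: field_simps)
qed

text \<open>Serves both T itself, with b = 1, and its truncation by \<phi>. The Lipschitz condition
  holds with constant B + 1: either \<mu> + \<eta> stays in the ball where b = 1, or |\<eta>| \<ge>
  M and the crude bound B + 1 suffices. As \<delta> / M \<le> 1 / K, large \<open>K\<close> makes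
  this error small.\<close>

lemma multiplier_focusing_ge:
  fixes x :: "real^'n" and b :: "real^'n \<Rightarrow> complex"
  assumes s: "0 < s" "s < 1" and K: "K \<ge> 1" "\<delta> > 0" "M = \<delta> * K * sqrt CARD('n)" and M: "M \<ge> 1"
    and G: "G = gauss_moment TYPE(real^'n)" "G * (10 * \<delta>\<^sup>2 * M powr (s - 2)) \<le> 1 / 100"
    and b: "b \<in> borel_measurable borel" "\<And>\<xi>. norm (b \<xi>) \<le> B" "\<And>\<xi>. norm \<xi> \<le> 4 * M \<Longrightarrow> b \<xi> = 1"
    and KB: "100 * G * (B + 1) \<le> K" and x: "100 * (1 + G) * (M * norm x) \<le> 1"
  shows "real K ^ CARD('n) / 2 \<le> norm (multiplier (\<lambda>\<xi>. cis (norm \<xi> powr s) * b \<xi>) (focusing s \<delta> K) x)"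
proof -
  have G0: "G \<ge> 0" unfolding G by (rule gauss_moment_nonneg)
  have B: "B \<ge> 0" by (rule order_trans[OF norm_ge_zero b(2)[of 0]])
  have lip: "norm (b (\<mu> + \<eta>) - complex_of_real 1) \<le> (B + 1) * norm \<eta> / M" if "norm \<mu> \<le> 2 * M" for \<mu> \<eta>
  proof (cases "norm (\<mu> + \<eta>) \<le> 4 * M")
    case True
    thus ?thesis using b(3) B M by simp
  next
    case False
    hence "M \<le> norm \<eta>" using that norm_triangle_ineq[of \<mu> \<eta>] M by linarith
    hence "(B + 1) * 1 \<le> (B + 1) * (norm \<eta> / M)"
      using B M by (intro mult_left_mono) auto
    moreover have "norm (b (\<mu> + \<eta>) - 1) \<le> B + 1"
      using norm_triangle_ineq4[of "b (\<mu> + \<eta>)" 1] b(2)[of "\<mu> + \<eta>"] by simp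
    ultimately show ?thesis by simp
  qed
  have "real K ^ CARD('n) * (1 - 2 * M * norm x - G * ((B + 1) * \<delta> / M + \<delta> * norm x + 10 * \<delta>\<^sup>2 * M powr (s - 2)))
    \<le> norm (multiplier (\<lambda>\<xi>. cis (norm \<xi> powr s) * b \<xi>) (focusing s \<delta> K) x)"
    unfolding G(1)
    by (rule multiplier_focusing_approx[OF s K(2,3) M b(1,2), where \<beta>="\<lambda>_. 1" and L="B + 1" and \<alpha>=1])
      (use lip B in auto)
  moreover have "1 / 2 \<le> 1 - 2 * M * norm x - G * ((B + 1) * \<delta> / M + \<delta> * norm x + 10 * \<delta>\<^sup>2 * M powr (s - 2))"
  proof -
    note sb = step_bounds[OF K(3,1,2)]
    have Mx: "0 \<le> M * norm x" "0 \<le> G * (M * norm x)" using M G0 by auto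
    have x': "100 * (M * norm x) + 100 * (G * (M * norm x)) \<le> 1"
      using x by (simp add: algebra_simps)
    have "G * (B + 1) * (\<delta> / M) \<le> G * (B + 1) * (1 / K)"
      using G0 B sb by (intro mult_left_mono) auto
    also have "\<dots> \<le> 1 / 100" using KB K by (simp add: field_simps)
    finally have 1: "G * ((B + 1) * \<delta> / M) \<le> 1 / 100" by (simp add: mult.assoc)
    have "\<delta> * norm x \<le> M * norm x" using sb by (intro mult_right_mono) auto
    hence 2: "G * (\<delta> * norm x) \<le> G * (M * norm x)" using G0 by (intro mult_left_mono) auto
    show ?thesis unfolding distrib_left using 1 2 G(2) x' Mx by linarith
  qed
  hence "real K ^ CARD('n) * (1 / 2) \<le> real K ^ CARD('n) * (1 - 2 * M * norm x - G * ((B + 1) * \<delta> / M + \<delta> * norm x + 10 * \<delta>\<^sup>2 * M powr (s - 2)))"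
    by (intro mult_left_mono) auto
  ultimately show ?thesis by linarith
qed

text \<open>The crude supremum bound of order N^n serves integrability and the tail estimate, where
  an exponentially small factor outweighs it.\<close>

lemma integrable_multiplier_bump:
  fixes \<theta> :: "real^'n \<Rightarrow> complex"
  assumes [measurable]: "\<theta> \<in> borel_measurable borel" and B: "\<And>\<xi>. norm (\<theta> \<xi>) \<le> B" and N: "N > 0"
  shows "integrable lborel (\<lambda>\<xi>. cis (norm \<xi> powr s) * \<theta> (\<xi> /\<^sub>R N) * fourier (bump N) \<xi>)"
    and "norm (multiplier (\<lambda>\<xi>. cis (norm \<xi> powr s) * \<theta> (\<xi> /\<^sub>R N)) (bump N) x) \<le> B * N ^ CARD('n)"
    and "(\<lambda>x. multiplier (\<lambda>\<xi>. cis (norm \<xi> powr s) * \<theta> (\<xi> /\<^sub>R N)) (bump N) x) \<in> borel_measurable borel"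
proof -
  have B0: "B \<ge> 0" by (rule order_trans[OF norm_ge_zero B[of 0]])
  have g: "integrable lborel (\<lambda>\<xi>::real^'n. B * gauss (inverse N *\<^sub>R (\<xi> - 0)))"
    using N by (intro integrable_mult_right integrable_gauss_affine) simp
  have bd: "norm (cis t * (cis (norm \<xi> powr s) * \<theta> (\<xi> /\<^sub>R N)) * fourier (bump N) \<xi>) \<le> B * gauss (inverse N *\<^sub>R (\<xi> - 0))" for t \<xi>
    using mult_right_mono[OF B[of "\<xi> /\<^sub>R N"], of "gauss (\<xi> /\<^sub>R N)"] gauss_pos[of "\<xi> /\<^sub>R N"]
    by (simp add: norm_mult fourier_bump[OF N])
  have int: "integrable lborel (\<lambda>\<xi>. cis (x \<bullet> \<xi>) * (cis (norm \<xi> powr s) * \<theta> (\<xi> /\<^sub>R N)) * fourier (bump N) \<xi>)" for x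
    using bd[of "x \<bullet> _"] unfolding fourier_bump[OF N, abs_def]
    by (intro Bochner_Integration.integrable_bound[OF g]) (auto simp: abs_of_nonneg B0 gauss_pos less_imp_le)
  from int[of 0] show "integrable lborel (\<lambda>\<xi>. cis (norm \<xi> powr s) * \<theta> (\<xi> /\<^sub>R N) * fourier (bump N) \<xi>)"
    by simp
  have "norm (LINT \<xi>|lborel. cis (x \<bullet> \<xi>) * (cis (norm \<xi> powr s) * \<theta> (\<xi> /\<^sub>R N)) * fourier (bump N) \<xi>)
    \<le> (LINT \<xi>::real^'n|lborel. B * gauss (inverse N *\<^sub>R (\<xi> - 0)))"
    by (intro Bochner_Integration.integral_norm_bound_integral int g bd)
  also have "\<dots> = B * (sqrt (2 * pi) * N) ^ CARD('n)"
    using N by (simp only: integral_mult_right_zero integral_gauss_affine inverse_positive_iff_positive) (simp add: divide_inverse)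
  finally have I: "norm (LINT \<xi>|lborel. cis (x \<bullet> \<xi>) * (cis (norm \<xi> powr s) * \<theta> (\<xi> /\<^sub>R N)) * fourier (bump N) \<xi>)
    \<le> B * (sqrt (2 * pi) * N) ^ CARD('n)" .
  have "norm (multiplier (\<lambda>\<xi>. cis (norm \<xi> powr s) * \<theta> (\<xi> /\<^sub>R N)) (bump N) x) \<le>
    inverse ((2 * pi) ^ CARD('n)) * (B * (sqrt (2 * pi) * N) ^ CARD('n))"
    unfolding multiplier_def norm_mult norm_of_real using I by (intro mult_mono) (auto simp del: of_real_inverse of_real_power)
  also have "\<dots> = B * N ^ CARD('n) * (sqrt (2 * pi) / (2 * pi)) ^ CARD('n)"
    by (simp add: power_mult_distrib power_divide field_simps)
  also have "\<dots> \<le> B * N ^ CARD('n) * 1"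
  proof (intro mult_left_mono power_le_one)
    have "sqrt (2 * pi) * 1 \<le> sqrt (2 * pi) * sqrt (2 * pi)"
      using pi_gt3 by (intro mult_left_mono) auto
    thus "sqrt (2 * pi) / (2 * pi) \<le> 1" by (simp add: field_simps)
  qed (use B0 N in auto)
  finally show "norm (multiplier (\<lambda>\<xi>. cis (norm \<xi> powr s) * \<theta> (\<xi> /\<^sub>R N)) (bump N) x) \<le> B * N ^ CARD('n)"
    by simp
  show "(\<lambda>x. multiplier (\<lambda>\<xi>. cis (norm \<xi> powr s) * \<theta> (\<xi> /\<^sub>R N)) (bump N) x) \<in> borel_measurable borel"
    unfolding multiplier_def fourier_bump[OF N] by measurable
qed

text \<open>All centres lie in the ball of radius M^(s-1), so such an \<open>x\<close> is at
  distance at least |x| / 2 from each. Half of the resulting exponent \<delta>^2 |x|^2 / 8 becomes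
  the constant factor, through |x| \<ge> 2 M^(s-1); the other half stays as an integrable
  Gaussian.\<close>

lemma focusing_tail:
  fixes x :: "real^'n"
  assumes s: "0 < s" "s < 1" and K: "K \<ge> 1" "\<delta> > 0" "M = \<delta> * K * sqrt CARD('n)"
    and x: "2 * M powr (s - 1) \<le> norm x"
  shows "norm (focusing s \<delta> K x) \<le> real K ^ CARD('n) * exp (- (\<delta>\<^sup>2 * (M powr (s - 1))\<^sup>2) / 4) * gauss ((\<delta> / sqrt 8) *\<^sub>R (x - 0))"
proof -
  define V where "V = M powr (s - 1)"
  have M: "M > 0" using K by simp
  have "gauss (\<delta> *\<^sub>R (x - velocity s (node \<delta> k))) \<le> exp (- (\<delta>\<^sup>2 * V\<^sup>2) / 4) * gauss ((\<delta> / sqrt 8) *\<^sub>R (x - 0))"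
    if k: "k \<in> grid K" for k :: "'n \<Rightarrow> nat"
  proof -
    let ?\<mu> = "node \<delta> k :: real^'n"
    have \<mu>: "M \<le> norm ?\<mu>" using norm_node(1)[OF k K(2)] by (simp add: K(3))
    hence "norm (velocity s ?\<mu>) = s * norm ?\<mu> powr (s - 1)"
      using M s by (intro norm_velocity) auto
    also have "\<dots> \<le> 1 * V"
      unfolding V_def using \<mu> M s by (intro mult_mono powr_mono2') auto
    finally have "norm x / 2 \<le> norm (x - velocity s ?\<mu>)"
      using x norm_triangle_ineq2[of x "velocity s ?\<mu>"] by (simp add: V_def)
    hence "(norm x / 2)\<^sup>2 \<le> (norm (x - velocity s ?\<mu>))\<^sup>2" by (intro power_mono) auto
    hence 1: "\<delta>\<^sup>2 * ((norm x)\<^sup>2 / 4) \<le> \<delta>\<^sup>2 * (norm (x - velocity s ?\<mu>))\<^sup>2"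
      by (intro mult_left_mono) (auto simp: power_divide)
    have "(2 * V)\<^sup>2 \<le> (norm x)\<^sup>2" using x by (intro power_mono) (auto simp: V_def)
    hence 2: "\<delta>\<^sup>2 * (4 * V\<^sup>2) \<le> \<delta>\<^sup>2 * (norm x)\<^sup>2"
      by (intro mult_left_mono) (auto simp: power_mult_distrib)
    have "- (norm (\<delta> *\<^sub>R (x - velocity s ?\<mu>)))\<^sup>2 / 2 = - (\<delta>\<^sup>2 * (norm (x - velocity s ?\<mu>))\<^sup>2) / 2"
      by (simp add: power_mult_distrib)
    also have "\<dots> \<le> - (\<delta>\<^sup>2 * V\<^sup>2) / 4 + - (\<delta>\<^sup>2 * (norm x)\<^sup>2 / 8) / 2"
      using 1 2 by simp
    also have "\<dots> = - (\<delta>\<^sup>2 * V\<^sup>2) / 4 + - (norm ((\<delta> / sqrt 8) *\<^sub>R (x - 0)))\<^sup>2 / 2"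
      by (simp add: power_mult_distrib power_divide)
    finally show ?thesis unfolding gauss_def exp_add[symmetric] by simp
  qed
  hence "(\<Sum>k\<in>grid K. gauss (\<delta> *\<^sub>R (x - velocity s (node \<delta> k :: real^'n)))) \<le>
     (\<Sum>k\<in>(grid K :: ('n \<Rightarrow> nat) set). exp (- (\<delta>\<^sup>2 * V\<^sup>2) / 4) * gauss ((\<delta> / sqrt 8) *\<^sub>R (x - 0)))"
    by (rule sum_mono)
  thus ?thesis
    using norm_focusing_le[of s \<delta> K x] by (simp add: card_grid V_def mult.assoc)
qed

text \<open>By duality the pairing of the image of \<open>bump N\<close> with the superposition at
  frequency N is a value at the focus, of order K^n. The superposition is bounded by
  \<open>C\<close> and tiny outside the ball, so the integral over the ball must account for that
  size. Constants: the Gaussian symbol is at least exp (-2) \<ge> 1/9 at the nodes, the errors leave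
  1/18, and the tail takes at most half of that.\<close>

lemma multiplier_bump_ge:
  fixes \<theta> :: "real^'n \<Rightarrow> complex"
  assumes s: "0 < s" "s < 1" and K: "K \<ge> 1" "\<delta> > 0" "N = \<delta> * K * sqrt CARD('n)" and N: "N \<ge> 1"
    and G: "G = gauss_moment TYPE(real^'n)" "G * (10 * \<delta>\<^sup>2 * N powr (s - 2)) \<le> 1 / 100"
    and \<theta>: "\<theta> \<in> borel_measurable borel" "\<And>\<xi>. norm (\<theta> \<xi>) \<le> B" "\<And>\<xi>. 1 / 8 \<le> norm \<xi> \<Longrightarrow> norm \<xi> \<le> 8 \<Longrightarrow> \<theta> \<xi> = 1"
    and KB: "100 * G * (2 * (B + 1)) \<le> K"
    and C: "\<And>x::real^'n. norm (focusing s \<delta> K x) \<le> C"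
    and tail: "B * N ^ CARD('n) * (exp (- (\<delta>\<^sup>2 * (N powr (s - 1))\<^sup>2) / 4) * (sqrt (2 * pi) / (\<delta> / sqrt 8)) ^ CARD('n)) \<le> 1 / 36"
  defines "U \<equiv> \<lambda>x. norm (multiplier (\<lambda>\<xi>. cis (norm \<xi> powr s) * \<theta> (\<xi> /\<^sub>R N)) (bump N) x)"
  shows "integrable lborel (\<lambda>x. indicator (cball 0 (2 * N powr (s - 1))) x * U x)"
    and "real K ^ CARD('n) / 36 \<le> C * (LINT x|lborel. indicator (cball 0 (2 * N powr (s - 1))) x * U x)"
proof -
  note [measurable] = \<theta>(1)
  have Np: "N > 0" using N by simp
  have G0: "G \<ge> 0" unfolding G by (rule gauss_moment_nonneg)
  have B: "B \<ge> 0" by (rule order_trans[OF norm_ge_zero \<theta>(2)[of 0]])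
  have C0: "C \<ge> 0" by (rule order_trans[OF norm_ge_zero C[of 0]])
  define S where "S = cball (0 :: real^'n) (2 * N powr (s - 1))"
  have [measurable]: "S \<in> sets borel" by (simp add: S_def)
  define F where "F = (focusing s \<delta> K :: real^'n \<Rightarrow> complex)"
  have [measurable]: "F \<in> borel_measurable borel" unfolding F_def by measurable
  define T where "T = multiplier (\<lambda>\<xi>. cis (norm \<xi> powr s) * \<theta> (\<xi> /\<^sub>R N)) (bump N)"
  have U: "U x = norm (T x)" for x by (simp add: U_def T_def)
  have [measurable]: "T \<in> borel_measurable borel"
    unfolding T_def using integrable_multiplier_bump(3)[OF \<theta>(1,2) Np, of s] by simp
  have Tb: "norm (T x) \<le> B * N ^ CARD('n)" for x
    unfolding T_def by (rule integrable_multiplier_bump(2)[OF \<theta>(1,2) Np])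
  have intS: "integrable lborel (\<lambda>x. indicator S x * norm (T x))"
  proof (rule Bochner_Integration.integrable_bound)
    show "integrable lborel (\<lambda>x. B * N ^ CARD('n) * indicator S x :: real)"
      unfolding S_def by (intro integrable_mult_right integrable_real_indicator) (use emeasure_lborel_cball_finite[of "0::real^'n"] in auto)
    show "AE x in lborel. norm (indicator S x * norm (T x)) \<le> norm (B * N ^ CARD('n) * indicator S x :: real)"
      using Tb B Np by (intro AE_I2) (auto simp: indicator_def abs_of_nonneg)
  qed measurable
  thus "integrable lborel (\<lambda>x. indicator (cball 0 (2 * N powr (s - 1))) x * U x)"
    unfolding U S_def .
  \<comment> \<open>The symbol that acts on \<open>F\<close> after duality, apart from the phase:
    \<open>\<theta>\<close> reflected, times the transform of \<open>bump N\<close>.\<close>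
  define b where "b = (\<lambda>\<xi>. \<theta> (- \<xi> /\<^sub>R N) * complex_of_real (gauss (\<xi> /\<^sub>R N)))"
  have bm: "b \<in> borel_measurable borel" unfolding b_def by measurable
  have bb: "norm (b \<xi>) \<le> B" for \<xi>
  proof -
    have "norm (\<theta> (- \<xi> /\<^sub>R N)) * gauss (\<xi> /\<^sub>R N) \<le> B * 1"
      using B gauss_pos[of "\<xi> /\<^sub>R N"] by (intro mult_mono \<theta> gauss_le_1) auto
    thus ?thesis using gauss_pos[of "\<xi> /\<^sub>R N"] by (simp add: b_def norm_mult)
  qed
  have pair: "(LINT x|lborel. T x * F x) = multiplier (\<lambda>\<xi>. cis (norm \<xi> powr s) * b \<xi>) F 0"
  proof -
    have "(LINT x|lborel. T x * F x) = multiplier (\<lambda>\<xi>. cis (norm (- \<xi>) powr s) * \<theta> (- \<xi> /\<^sub>R N) * fourier (bump N) (- \<xi>)) F 0"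
      unfolding T_def F_def
      by (rule multiplier_pairing[OF integrable_multiplier_bump(1)[OF \<theta>(1,2) Np] integrable_focusing[OF K(2)]])
    also have "(\<lambda>\<xi>. cis (norm (- \<xi>) powr s) * \<theta> (- \<xi> /\<^sub>R N) * fourier (bump N) (- \<xi>)) = (\<lambda>\<xi>. cis (norm \<xi> powr s) * b \<xi>)"
      by (simp add: fun_eq_iff b_def fourier_bump[OF Np] gauss_def)
    finally show ?thesis .
  qed
  \<comment> \<open>For |\<eta>| \<le> N / 2 the rescaled point stays where \<open>\<theta>\<close>
    is 1, and only the Gaussian varies; for larger \<eta> the crude bound B + 1 is at most 2 (B + 1)
    |\<eta>| / N.\<close>
  have lip: "norm (b (\<mu> + \<eta>) - complex_of_real (gauss (\<mu> /\<^sub>R N))) \<le> (2 * (B + 1)) * norm \<eta> / N"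
    if \<mu>: "N \<le> norm \<mu>" "norm \<mu> \<le> 2 * N" for \<mu> \<eta>
  proof (cases "norm \<eta> \<le> N / 2")
    case True
    have 1: "N / 8 \<le> norm (\<mu> + \<eta>)" "norm (\<mu> + \<eta>) \<le> 8 * N"
      using True \<mu> Np norm_triangle_ineq2[of \<mu> "- \<eta>"] norm_triangle_ineq[of \<mu> \<eta>] by auto
    have 2: "norm (- (\<mu> + \<eta>) /\<^sub>R N) = norm (\<mu> + \<eta>) / N"
      unfolding norm_scaleR norm_minus_cancel using Np by (simp add: divide_inverse mult.commute)
    have "1 / 8 \<le> norm (- (\<mu> + \<eta>) /\<^sub>R N) \<and> norm (- (\<mu> + \<eta>) /\<^sub>R N) \<le> 8"
      unfolding 2 using 1 Np by (simp add: field_simps)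
    hence "b (\<mu> + \<eta>) = complex_of_real (gauss ((\<mu> + \<eta>) /\<^sub>R N))"
      using \<theta>(3) unfolding b_def by auto
    hence "norm (b (\<mu> + \<eta>) - complex_of_real (gauss (\<mu> /\<^sub>R N))) = \<bar>gauss ((\<mu> + \<eta>) /\<^sub>R N) - gauss (\<mu> /\<^sub>R N)\<bar>"
      by (simp only: of_real_diff[symmetric] norm_of_real)
    also have "\<dots> \<le> norm ((\<mu> + \<eta>) /\<^sub>R N - \<mu> /\<^sub>R N)" by (rule gauss_lipschitz)
    also have "(\<mu> + \<eta>) /\<^sub>R N - \<mu> /\<^sub>R N = \<eta> /\<^sub>R N" by (simp add: scaleR_add_right)
    also have "norm (\<eta> /\<^sub>R N) = 1 * (norm \<eta> / N)" using Np by (simp add: divide_inverse mult.commute)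
    also have "\<dots> \<le> (2 * (B + 1)) * (norm \<eta> / N)" using B Np by (intro mult_right_mono) auto
    finally show ?thesis by simp
  next
    case False
    have "norm (b (\<mu> + \<eta>) - complex_of_real (gauss (\<mu> /\<^sub>R N))) \<le> norm (b (\<mu> + \<eta>)) + norm (complex_of_real (gauss (\<mu> /\<^sub>R N)))"
      by (rule norm_triangle_ineq4)
    also have "\<dots> \<le> B + 1"
      using gauss_pos[of "\<mu> /\<^sub>R N"] gauss_le_1[of "\<mu> /\<^sub>R N"] by (intro add_mono bb) auto
    also have "\<dots> = (B + 1) * 1" by simp
    also have "\<dots> \<le> (B + 1) * (2 * (norm \<eta> / N))"
      using False B Np by (intro mult_left_mono) (auto simp: field_simps)
    also have "\<dots> = (2 * (B + 1)) * norm \<eta> / N" by simp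
    finally show ?thesis .
  qed
  have \<beta>: "1 / 9 \<le> gauss (\<mu> /\<^sub>R N) \<and> gauss (\<mu> /\<^sub>R N) \<le> 1" if \<mu>: "N \<le> norm \<mu>" "norm \<mu> \<le> 2 * N" for \<mu> :: "real^'n"
  proof
    have "norm (\<mu> /\<^sub>R N) \<le> 2" using \<mu> Np by (simp add: field_simps)
    hence "(norm (\<mu> /\<^sub>R N))\<^sup>2 \<le> 2\<^sup>2" by (intro power_mono) auto
    hence g: "exp (- 2) \<le> gauss (\<mu> /\<^sub>R N)" unfolding gauss_def by simp
    have "exp 2 = exp 1 * exp (1::real)" by (simp add: exp_add[symmetric])
    also have "\<dots> \<le> 3 * 3" by (intro mult_mono exp_le) auto
    finally have "1 / 9 \<le> exp (- (2::real))" by (simp add: exp_minus field_simps)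
    with g show "1 / 9 \<le> gauss (\<mu> /\<^sub>R N)" by simp
  qed (rule gauss_le_1)
  have "real K ^ CARD('n) * (1 / 9 - 2 * N * norm (0 :: real^'n) - G * ((2 * (B + 1)) * \<delta> / N + \<delta> * norm (0 :: real^'n) + 10 * \<delta>\<^sup>2 * N powr (s - 2)))
    \<le> norm (multiplier (\<lambda>\<xi>. cis (norm \<xi> powr s) * b \<xi>) F 0)"
    unfolding G(1) F_def
    by (rule multiplier_focusing_approx[OF s K(2,3) N bm bb, where \<beta>="\<lambda>\<mu>. gauss (\<mu> /\<^sub>R N)" and L="2 * (B + 1)" and \<alpha>="1 / 9"])
      (use lip \<beta> B in auto)
  moreover have "1 / 18 \<le> 1 / 9 - 2 * N * norm (0 :: real^'n) - G * ((2 * (B + 1)) * \<delta> / N + \<delta> * norm (0 :: real^'n) + 10 * \<delta>\<^sup>2 * N powr (s - 2))"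
  proof -
    note sb = step_bounds[OF K(3,1,2)]
    have "G * (2 * (B + 1)) * (\<delta> / N) \<le> G * (2 * (B + 1)) * (1 / K)"
      using G0 B sb by (intro mult_left_mono) auto
    also have "\<dots> \<le> 1 / 100" using KB K by (simp add: field_simps)
    finally have "G * ((2 * (B + 1)) * \<delta> / N) \<le> 1 / 100" by (simp add: mult.assoc)
    thus ?thesis unfolding distrib_left using G(2) by simp
  qed
  hence "real K ^ CARD('n) * (1 / 18) \<le> real K ^ CARD('n) * (1 / 9 - 2 * N * norm (0 :: real^'n) - G * ((2 * (B + 1)) * \<delta> / N + \<delta> * norm (0 :: real^'n) + 10 * \<delta>\<^sup>2 * N powr (s - 2)))"
    by (rule mult_left_mono) simp
  ultimately have "real K ^ CARD('n) * (1 / 18) \<le> norm (multiplier (\<lambda>\<xi>. cis (norm \<xi> powr s) * b \<xi>) F 0)"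
    by linarith
  hence low: "real K ^ CARD('n) / 18 \<le> norm (LINT x|lborel. T x * F x)"
    unfolding pair by simp
  define E where "E = real K ^ CARD('n) * exp (- (\<delta>\<^sup>2 * (N powr (s - 1))\<^sup>2) / 4)"
  have E: "E \<ge> 0" by (simp add: E_def)
  \<comment> \<open>On the ball \<open>F\<close> is bounded by \<open>C\<close>; outside it the
    supremum of \<open>T\<close> meets the Gaussian tail of \<open>F\<close>.\<close>
  define J where "J = (\<lambda>x. C * (indicator S x * norm (T x)) + B * N ^ CARD('n) * (E * gauss ((\<delta> / sqrt 8) *\<^sub>R (x - 0 :: real^'n))))"
  have d8: "\<delta> / sqrt 8 > 0" using K by simp
  have intg: "integrable lborel (\<lambda>x. gauss ((\<delta> / sqrt 8) *\<^sub>R (x - 0 :: real^'n)))"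
    using d8 by (intro integrable_gauss_affine) auto
  have "norm (LINT x|lborel. T x * F x) \<le> (LINT x|lborel. J x)"
  proof (rule Bochner_Integration.integral_norm_bound_integral)
    show "integrable lborel (\<lambda>x. T x * F x)"
    proof (rule Bochner_Integration.integrable_bound)
      show "integrable lborel (\<lambda>x. (B * N ^ CARD('n)) *\<^sub>R F x)"
        unfolding F_def by (intro integrable_scaleR_right integrable_focusing K)
      have "norm (T x * F x) \<le> norm ((B * N ^ CARD('n)) *\<^sub>R F x)" for x
        using mult_right_mono[OF Tb[of x], of "norm (F x)"] B Np by (simp add: norm_mult)
      thus "AE x in lborel. norm (T x * F x) \<le> norm ((B * N ^ CARD('n)) *\<^sub>R F x)" by simp
    qed measurable
    show "integrable lborel J"
      unfolding J_def by (intro Bochner_Integration.integrable_add integrable_mult_right intS intg)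
    fix x :: "real^'n"
    have g0: "0 \<le> B * N ^ CARD('n) * (E * gauss ((\<delta> / sqrt 8) *\<^sub>R (x - 0)))"
      using B Np E gauss_pos[of "(\<delta> / sqrt 8) *\<^sub>R (x - 0)"] by (intro mult_nonneg_nonneg) auto
    show "norm (T x * F x) \<le> J x"
    proof (cases "x \<in> S")
      case True
      have "norm (T x * F x) \<le> norm (T x) * C"
        unfolding norm_mult F_def by (intro mult_left_mono C) auto
      thus ?thesis unfolding J_def using True g0 by (simp add: mult.commute)
    next
      case False
      hence "2 * N powr (s - 1) \<le> norm x" by (simp add: S_def)
      hence "norm (F x) \<le> E * gauss ((\<delta> / sqrt 8) *\<^sub>R (x - 0))"
        unfolding F_def E_def by (rule focusing_tail[OF s K])
      hence "norm (T x) * norm (F x) \<le> (B * N ^ CARD('n)) * (E * gauss ((\<delta> / sqrt 8) *\<^sub>R (x - 0)))"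
        using B Np by (intro mult_mono Tb) auto
      thus ?thesis unfolding J_def using False by (simp add: norm_mult)
    qed
  qed
  also have "(LINT x|lborel. J x) = C * (LINT x|lborel. indicator S x * norm (T x)) +
      B * N ^ CARD('n) * (E * (sqrt (2 * pi) / (\<delta> / sqrt 8)) ^ CARD('n))"
  proof -
    have "(LINT x|lborel. J x) = (LINT x|lborel. C * (indicator S x * norm (T x))) +
      (LINT x|lborel. B * N ^ CARD('n) * (E * gauss ((\<delta> / sqrt 8) *\<^sub>R (x - 0 :: real^'n))))"
      unfolding J_def by (intro Bochner_Integration.integral_add integrable_mult_right intS intg)
    thus ?thesis unfolding integral_mult_right_zero integral_gauss_affine[OF d8] by simp
  qed
  also have "B * N ^ CARD('n) * (E * (sqrt (2 * pi) / (\<delta> / sqrt 8)) ^ CARD('n)) \<le> real K ^ CARD('n) * (1 / 36)"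
    using mult_left_mono[OF tail, of "real K ^ CARD('n)"] by (simp add: E_def mult_ac)
  finally show "real K ^ CARD('n) / 36 \<le> C * (LINT x|lborel. indicator (cball 0 (2 * N powr (s - 1))) x * U x)"
    using low unfolding U S_def[symmetric] by simp
qed

section \<open>Choice of the scales and comparison of powers of \<open>2 ^ j\<close>\<close>

lemma test_function_bounded:
  assumes "test_function f"
  shows "\<exists>B\<ge>0. \<forall>x. norm (f x) \<le> B"
proof -
  have "compact (f ` supp f)"
    using assms unfolding test_function_def
    by (intro compact_continuous_image continuous_on_subset[OF smooth_continuous]) auto
  hence "bounded (f ` supp f)" by (rule compact_imp_bounded)
  then obtain B where B: "\<And>x. x \<in> supp f \<Longrightarrow> norm (f x) \<le> B"
    by (auto simp: bounded_iff)
  have "norm (f x) \<le> max B 0" for x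
  proof (cases "x \<in> supp f")
    case False
    hence "f x = 0" using closure_subset[of "{x. f x \<noteq> 0}"] by (auto simp: supp_def)
    thus ?thesis by simp
  qed (use B in \<open>auto simp: le_max_iff_disj\<close>)
  thus ?thesis by (intro exI[of _ "max B 0"]) auto
qed

lemma Linf_norm_le:
  assumes "f \<in> borel_measurable borel" "\<And>x. norm (f x) \<le> C"
  shows "Linf_norm f \<le> ennreal C"
  unfolding Linf_norm_def using assms by (intro esssup_I) (auto intro!: ennreal_leI)

lemma exponent_nonpos:
  fixes e C :: real
  assumes "\<And>j::nat. j \<ge> j0 \<Longrightarrow> (2 ^ j) powr e \<le> C"
  shows "e \<le> 0"
proof (rule ccontr)
  assume "\<not> e \<le> 0"
  hence e: "2 powr e > (1::real)" by simp
  have *: "(2 ^ j) powr e = (2 powr e) ^ j" for j :: nat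
    by (simp add: powr_realpow[symmetric] powr_powr mult.commute)
  obtain k where k: "C < (2 powr e) ^ k" using real_arch_pow[OF e] by blast
  have "(2 powr e) ^ k \<le> (2 powr e) ^ (max j0 k)" using e by (intro power_increasing) auto
  also have "\<dots> \<le> C" using assms[of "max j0 k"] by (simp add: *)
  finally show False using k by simp
qed

lemma power_gauss_tail_small:
  fixes A d s \<epsilon> :: real
  assumes "0 < s" "0 < d" "0 < \<epsilon>"
  shows "eventually (\<lambda>N::real. A * (N ^ n * exp (- (d * N powr s) / 4)) \<le> \<epsilon>) at_top"
proof -
  have "((\<lambda>N::real. N ^ n * exp (- (d * N powr s) / 4)) \<longlongrightarrow> 0) at_top"
    using assms by real_asymp
  hence "((\<lambda>N::real. A * (N ^ n * exp (- (d * N powr s) / 4))) \<longlongrightarrow> A * 0) at_top"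
    by (intro tendsto_mult tendsto_const)
  hence "eventually (\<lambda>N::real. A * (N ^ n * exp (- (d * N powr s) / 4)) < \<epsilon>) at_top"
    using assms by (intro order_tendstoD) auto
  thus ?thesis by eventually_elim simp
qed

theorem proposition4p1:
  fixes s m :: real
    and \<theta> \<phi> \<Phi> :: "real^'n::finite \<Rightarrow> complex"
  assumes "0 < s" and "s < 1"
    and "test_function \<theta>"
    and "\<forall>\<xi>. 1/8 \<le> norm \<xi> \<and> norm \<xi> \<le> 8 \<longrightarrow> \<theta> \<xi> = 1"
    and "supp \<theta> \<subseteq> {\<xi>. 1/10 \<le> norm \<xi> \<and> norm \<xi> \<le> 10}"
    and "test_function \<phi>"
    and "\<forall>\<xi>. norm \<xi> \<le> 2 \<longrightarrow> \<phi> \<xi> = 1"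
    and "supp \<phi> \<subseteq> {\<xi>. norm \<xi> \<le> 3}"
    and "schwartz \<Phi>" and "(LINT x|lborel. \<Phi> x) \<noteq> 0"
    and "\<exists>c>0. \<forall>j::nat. j \<ge> 1 \<longrightarrow>
           (\<forall>f g h :: real^'n \<Rightarrow> complex. schwartz f \<longrightarrow> schwartz g \<longrightarrow> schwartz h \<longrightarrow>
              ennreal (2 powr (real j * m)) *
              L1_norm (\<lambda>x.
                multiplier (\<lambda>\<xi>. cis (norm \<xi> powr s)) f x *
                multiplier (\<lambda>\<xi>. cis (norm \<xi> powr s) * \<phi> (\<xi> /\<^sub>R 2 ^ j)) g x *
                multiplier (\<lambda>\<xi>. cis (norm \<xi> powr s) * \<theta> (\<xi> /\<^sub>R 2 ^ j)) h x)
              \<le> ennreal c * Linf_norm f * Linf_norm g * h1_norm \<Phi> h)"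
  shows "m \<le> - (real CARD('n) * s / 2) - real CARD('n) * s * (1 - s)"
proof -
  note s = assms(1,2)
  define n where "n = CARD('n)"
  obtain c0 where c0: "c0 > 0" and bound: "\<And>j f g h. j \<ge> 1 \<Longrightarrow> schwartz f \<Longrightarrow> schwartz g \<Longrightarrow> schwartz h \<Longrightarrow>
      ennreal (2 powr (real j * m)) *
      L1_norm (\<lambda>x.
        multiplier (\<lambda>\<xi>. cis (norm \<xi> powr s)) f x *
        multiplier (\<lambda>\<xi>. cis (norm \<xi> powr s) * \<phi> (\<xi> /\<^sub>R 2 ^ j)) g x *
        multiplier (\<lambda>\<xi>. cis (norm \<xi> powr s) * \<theta> (\<xi> /\<^sub>R 2 ^ j)) h x)
      \<le> ennreal c0 * Linf_norm f * Linf_norm g * h1_norm \<Phi> h"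
    using assms(11) by auto
  obtain B1 where B1: "\<And>\<xi>. norm (\<theta> \<xi>) \<le> B1"
    using test_function_bounded[OF assms(3)] by auto
  obtain B2 where B2: "\<And>\<xi>. norm (\<phi> \<xi>) \<le> B2"
    using test_function_bounded[OF assms(6)] by auto
  \<comment> \<open>At least 1, so that \<open>B\<close> also bounds the symbol factor 1 of the
    operator applied to \<open>f\<close>.\<close>
  define B where "B = max 1 (max B1 B2)"
  have B: "1 \<le> B" "norm (\<theta> \<xi>) \<le> B" "norm (\<phi> \<xi>) \<le> B" for \<xi>
    using B1[of \<xi>] B2[of \<xi>] by (auto simp: B_def)
  have meas: "\<theta> \<in> borel_measurable borel" "\<phi> \<in> borel_measurable borel"
    using assms(3,6) by (auto simp: test_function_def intro: smooth_measurable)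
  note [measurable] = meas
  define G where "G = gauss_moment TYPE(real^'n)"
  have G: "G \<ge> 0" unfolding G_def by (rule gauss_moment_nonneg)
  \<comment> \<open>The largest value of M |x| that \<open>multiplier_focusing_ge\<close>
    admits.\<close>
  define \<rho> where "\<rho> = 1 / (100 * (1 + G))"
  have \<rho>: "0 < \<rho>" "\<rho> \<le> 1" "100 * (1 + G) * \<rho> = 1" using G by (auto simp: \<rho>_def field_simps)
  obtain C c d where C: "C > 0" and c: "c > 0" and d: "d > 0" and scale:
    "\<And>M. M \<ge> 1 \<Longrightarrow> \<exists>K \<delta>. K \<ge> 1 \<and> \<delta> > 0 \<and> M = \<delta> * K * sqrt CARD('n) \<and>
      G * (10 * \<delta>\<^sup>2 * M powr (s - 2)) \<le> 1 / 100 \<and> d \<le> \<delta>\<^sup>2 * M powr (s - 2) \<and>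
      c * M powr (s / 2) \<le> real K \<and> (\<forall>x::real^'n. norm (focusing s \<delta> K x) \<le> C)"
    using focusing_scale[OF s, where 'n='n] unfolding G_def by metis
  \<comment> \<open>The largest frequency for which the focus, of radius \<open>\<rho> / M\<close>, contains the ball of radius \<open>2 N^(s-1)\<close>.\<close>
  define M where "M = (\<lambda>N. \<rho> / 2 * N powr (1 - s))"
  \<comment> \<open>The constant in the tail condition of \<open>multiplier_bump_ge\<close>, with
    the frequency width replaced by its lower bound sqrt d.\<close>
  define A where "A = B * (sqrt (2 * pi) / (sqrt d / sqrt 8)) ^ n"
  have "eventually (\<lambda>N. 1 \<le> M N) at_top"
    unfolding M_def using s \<rho>(1) by real_asymp
  moreover have "eventually (\<lambda>N. 100 * G * (2 * (B + 1)) / c \<le> M N powr (s / 2)) at_top"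
  proof -
    have "filterlim (\<lambda>N. M N powr (s / 2)) at_top at_top"
      unfolding M_def using s \<rho>(1) by real_asymp
    thus ?thesis by (simp add: filterlim_at_top)
  qed
  moreover have "eventually (\<lambda>N::real. 100 * G * (2 * (B + 1)) / c \<le> N powr (s / 2)) at_top"
  proof -
    have "filterlim (\<lambda>N::real. N powr (s / 2)) at_top at_top"
      using s by real_asymp
    thus ?thesis by (simp add: filterlim_at_top)
  qed
  moreover have "eventually (\<lambda>N::real. A * (N ^ n * exp (- (d * N powr s) / 4)) \<le> 1 / 36) at_top"
    using s d by (intro power_gauss_tail_small) auto
  ultimately have "eventually (\<lambda>N. 1 \<le> M N \<and> 100 * G * (2 * (B + 1)) / c \<le> M N powr (s / 2) \<and>
      100 * G * (2 * (B + 1)) / c \<le> N powr (s / 2) \<and> A * (N ^ n * exp (- (d * N powr s) / 4)) \<le> 1 / 36) at_top"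
    by eventually_elim auto
  then obtain N0 where N0: "\<And>N. N \<ge> N0 \<Longrightarrow> 1 \<le> M N \<and> 100 * G * (2 * (B + 1)) / c \<le> M N powr (s / 2) \<and>
      100 * G * (2 * (B + 1)) / c \<le> N powr (s / 2) \<and> A * (N ^ n * exp (- (d * N powr s) / 4)) \<le> 1 / 36"
    unfolding eventually_at_top_linorder by blast
  obtain j0 where j0: "N0 < 2 ^ j0" using real_arch_pow[of 2 N0] by auto
  define e where "e = real n * s * (1 - s) + real n * s / 2"
  have main: "m + e - \<epsilon> \<le> 0" if \<epsilon>: "0 < \<epsilon>" "\<epsilon> \<le> 1" for \<epsilon>
  proof -
    obtain Ch' where Ch': "\<And>N. N \<ge> 1 \<Longrightarrow> h1_norm \<Phi> (bump N) \<le> ennreal (Ch' * N powr \<epsilon>)"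
      using h1_norm_bump[OF assms(9) \<epsilon>] by blast
    \<comment> \<open>\<open>Ch'\<close> comes without a sign; the maximum with 0 makes it fit for
      products in \<open>ennreal\<close>.\<close>
    define Ch where "Ch = max Ch' 0"
    have Ch: "0 \<le> Ch" by (simp add: Ch_def)
    have h1: "h1_norm \<Phi> (bump N) \<le> ennreal (Ch * N powr \<epsilon>)" if "N \<ge> 1" for N
      by (rule order_trans[OF Ch'[OF that]]) (auto intro!: ennreal_leI mult_right_mono simp: Ch_def)
    \<comment> \<open>The square collects the constants of the two focused factors on the ball, the
      last factor those of the integral \<open>I\<close>.\<close>
    define a where "a = (c ^ n * (\<rho> / 2) powr (real n * s / 2) / 2)\<^sup>2 * (c ^ n / (36 * C))"
    have a: "a > 0" using c \<rho> C by (simp add: a_def)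
    have "(2 ^ j) powr (m + e - \<epsilon>) \<le> c0 * C * C * Ch / a" if j: "j \<ge> max j0 1" for j :: nat
    proof -
      define N where "N = (2::real) ^ j"
      have "(2::real) ^ j0 \<le> N" unfolding N_def using j by (intro power_increasing) auto
      hence NN0: "N \<ge> N0" using j0 by simp
      have N1: "N \<ge> 1" unfolding N_def by (rule one_le_power) simp
      hence Np: "N > 0" by simp
      note ev = N0[OF NN0]
      define L where "L = M N"
      have L1: "L \<ge> 1" using ev by (simp add: L_def)
      \<comment> \<open>The symbol \<phi>(\<xi> / N) is 1 for |\<xi>| \<le> 2 N, and
        \<open>multiplier_focusing_ge\<close> asks for this up to 4 L.\<close>
      have "N powr (1 - s) \<le> N powr 1" using N1 s by (intro powr_mono) auto
      hence "\<rho> * N powr (1 - s) \<le> 1 * N" using \<rho> Np by (intro mult_mono) auto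
      hence L4: "4 * L \<le> 2 * N" by (simp add: L_def M_def)
      obtain K1 \<delta>1 where K1: "K1 \<ge> 1" "\<delta>1 > 0" "L = \<delta>1 * K1 * sqrt CARD('n)"
        and GK1: "G * (10 * \<delta>1\<^sup>2 * L powr (s - 2)) \<le> 1 / 100"
        and cK1: "c * L powr (s / 2) \<le> real K1" and C1: "\<And>x::real^'n. norm (focusing s \<delta>1 K1 x) \<le> C"
        using scale[OF L1] by metis
      \<comment> \<open>The superposition at scale N is the function against which T h is tested;
        \<open>f\<close> is the one at scale L.\<close>
      obtain K2 \<delta>2 where K2: "K2 \<ge> 1" "\<delta>2 > 0" "N = \<delta>2 * K2 * sqrt CARD('n)"
        and GK2: "G * (10 * \<delta>2\<^sup>2 * N powr (s - 2)) \<le> 1 / 100" and d2: "d \<le> \<delta>2\<^sup>2 * N powr (s - 2)"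
        and cK2: "c * N powr (s / 2) \<le> real K2" and C2: "\<And>x::real^'n. norm (focusing s \<delta>2 K2 x) \<le> C"
        using scale[OF N1] by metis
      have KB1: "100 * G * (2 * (B + 1)) \<le> K1"
      proof -
        have "100 * G * (2 * (B + 1)) \<le> c * L powr (s / 2)"
          using ev c by (simp add: L_def divide_le_eq mult.commute)
        thus ?thesis using cK1 by simp
      qed
      have "G * (B + 1) \<le> G * (2 * (B + 1))" using G B(1) by (intro mult_left_mono) auto
      hence KB1': "100 * G * (B + 1) \<le> K1" using KB1 by simp
      have KB2: "100 * G * (2 * (B + 1)) \<le> K2"
      proof -
        have "100 * G * (2 * (B + 1)) \<le> c * N powr (s / 2)"
          using ev c by (simp add: divide_le_eq mult.commute)
        thus ?thesis using cK2 by simp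
      qed
      define f where "f = (focusing s \<delta>1 K1 :: real^'n \<Rightarrow> complex)"
      have fm: "f \<in> borel_measurable borel" unfolding f_def by (rule focusing_measurable)
      define S where "S = cball (0 :: real^'n) (2 * N powr (s - 1))"
      define T1 where "T1 = multiplier (\<lambda>\<xi>. cis (norm \<xi> powr s)) f"
      define T2 where "T2 = multiplier (\<lambda>\<xi>. cis (norm \<xi> powr s) * \<phi> (\<xi> /\<^sub>R 2 ^ j)) f"
      define T3 where "T3 = multiplier (\<lambda>\<xi>. cis (norm \<xi> powr s) * \<theta> (\<xi> /\<^sub>R 2 ^ j)) (bump N)"
      have T12: "real K1 ^ n / 2 \<le> norm (T1 x)" "real K1 ^ n / 2 \<le> norm (T2 x)" if x: "x \<in> S" for x
      proof -
        have "L * norm x \<le> L * (2 * N powr (s - 1))"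
          using x L1 by (intro mult_left_mono) (auto simp: S_def)
        also have "\<dots> = \<rho>" using Np by (simp add: L_def M_def powr_add[symmetric])
        finally have "100 * (1 + G) * (L * norm x) \<le> 100 * (1 + G) * \<rho>"
          using G by (intro mult_left_mono) auto
        hence Lx: "100 * (1 + G) * (L * norm x) \<le> 1" using \<rho> by simp
        have "real K1 ^ CARD('n) / 2 \<le> norm (multiplier (\<lambda>\<xi>. cis (norm \<xi> powr s) * (\<lambda>_. 1) \<xi>) (focusing s \<delta>1 K1) x)"
          by (rule multiplier_focusing_ge[OF s K1 L1 G_def GK1, where B=B]) (use B(1) KB1' Lx in auto)
        thus "real K1 ^ n / 2 \<le> norm (T1 x)" by (simp add: T1_def f_def n_def)
        have \<phi>1: "\<phi> (\<xi> /\<^sub>R 2 ^ j) = 1" if "norm \<xi> \<le> 4 * L" for \<xi>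
        proof -
          have "norm (\<xi> /\<^sub>R N) \<le> 2" using that L4 Np by (simp add: field_simps)
          thus ?thesis using assms(7) by (simp add: N_def)
        qed
        have "real K1 ^ CARD('n) / 2 \<le> norm (multiplier (\<lambda>\<xi>. cis (norm \<xi> powr s) * (\<lambda>\<xi>. \<phi> (\<xi> /\<^sub>R 2 ^ j)) \<xi>) (focusing s \<delta>1 K1) x)"
          by (rule multiplier_focusing_ge[OF s K1 L1 G_def GK1, where B=B]) (use B(3) \<phi>1 KB1' Lx in auto)
        thus "real K1 ^ n / 2 \<le> norm (T2 x)" by (simp add: T2_def f_def n_def)
      qed
      \<comment> \<open>Two consequences of \<open>d2\<close>: the exponent is at least d N^s, and
        \<open>\<delta>2\<close> is at least sqrt d because N^(s-2) \<le> 1.\<close>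
      have tail: "B * N ^ CARD('n) * (exp (- (\<delta>2\<^sup>2 * (N powr (s - 1))\<^sup>2) / 4) * (sqrt (2 * pi) / (\<delta>2 / sqrt 8)) ^ CARD('n)) \<le> 1 / 36"
      proof -
        have "(N powr (s - 1))\<^sup>2 = N powr (s - 2) * N powr s"
          unfolding power2_eq_square powr_add[symmetric] by (simp add: algebra_simps)
        hence 1: "d * N powr s \<le> \<delta>2\<^sup>2 * (N powr (s - 1))\<^sup>2"
          using mult_right_mono[OF d2, of "N powr s"] by (simp add: mult.assoc)
        have "N powr (s - 2) \<le> N powr 0" using N1 s by (intro powr_mono) auto
        hence "\<delta>2\<^sup>2 * N powr (s - 2) \<le> \<delta>2\<^sup>2 * 1" using Np by (intro mult_left_mono) auto
        hence "sqrt d \<le> sqrt (\<delta>2\<^sup>2)" using d2 by (intro real_sqrt_le_mono) auto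
        hence "sqrt d / sqrt 8 \<le> \<delta>2 / sqrt 8" using K2 by (intro divide_right_mono) auto
        hence "sqrt (2 * pi) / (\<delta>2 / sqrt 8) \<le> sqrt (2 * pi) / (sqrt d / sqrt 8)"
          using d K2 by (intro divide_left_mono) auto
        hence 2: "(sqrt (2 * pi) / (\<delta>2 / sqrt 8)) ^ n \<le> (sqrt (2 * pi) / (sqrt d / sqrt 8)) ^ n"
          using K2 by (intro power_mono) auto
        have "B * N ^ n * (exp (- (\<delta>2\<^sup>2 * (N powr (s - 1))\<^sup>2) / 4) * (sqrt (2 * pi) / (\<delta>2 / sqrt 8)) ^ n) \<le>
          B * N ^ n * (exp (- (d * N powr s) / 4) * (sqrt (2 * pi) / (sqrt d / sqrt 8)) ^ n)"
          using B(1) Np 1 2 K2 by (intro mult_left_mono mult_mono) auto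
        also have "\<dots> = A * (N ^ n * exp (- (d * N powr s) / 4))" by (simp add: A_def)
        also have "\<dots> \<le> 1 / 36" using ev by simp
        finally show ?thesis by (simp only: n_def)
      qed
      define I where "I = (LINT x|lborel. indicator S x * norm (T3 x))"
      have bge: "integrable lborel (\<lambda>x. indicator S x * norm (T3 x))" "real K2 ^ CARD('n) / 36 \<le> C * I"
        unfolding S_def T3_def I_def
        using multiplier_bump_ge[OF s K2 N1 G_def GK2 meas(1) B(2) assms(4)[rule_format, OF conjI] KB2 C2 tail]
        unfolding N_def by (auto simp: N_def)
      have Igt: "c ^ n * N powr (real n * s / 2) / (36 * C) \<le> I"
      proof -
        have "(c * N powr (s / 2)) ^ n \<le> real K2 ^ n" using cK2 c by (intro power_mono) auto
        moreover have "(c * N powr (s / 2)) ^ n = c ^ n * N powr (real n * s / 2)"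
          using Np by (simp add: power_mult_distrib powr_power mult.commute)
        ultimately have "c ^ n * N powr (real n * s / 2) / 36 \<le> C * I"
          using bge(2) by (simp add: n_def)
        thus ?thesis using C by (simp add: field_simps)
      qed
      have Kgt: "c ^ n * (\<rho> / 2) powr (real n * s / 2) * N powr ((1 - s) * (real n * s / 2)) \<le> real K1 ^ n"
      proof -
        have "(c * L powr (s / 2)) ^ n \<le> real K1 ^ n" using cK1 c by (intro power_mono) auto
        moreover have "(c * L powr (s / 2)) ^ n = c ^ n * L powr (real n * s / 2)"
          using L1 by (simp add: power_mult_distrib powr_power mult.commute)
        moreover have "L powr (real n * s / 2) = (\<rho> / 2) powr (real n * s / 2) * N powr ((1 - s) * (real n * s / 2))"
          unfolding L_def M_def using \<rho> by (simp only: powr_mult powr_powr)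
        ultimately show ?thesis by (simp add: mult.assoc)
      qed
      have I0: "0 \<le> I" unfolding I_def by (intro Bochner_Integration.integral_nonneg) auto
      \<comment> \<open>The exponent \<open>e\<close> is twice (1 - s) n s / 2 from the focused
        factors plus n s / 2 from \<open>I\<close>.\<close>
      have "a * N powr e \<le> (real K1 ^ n / 2)\<^sup>2 * I"
      proof -
        have "a * N powr e = ((c ^ n * (\<rho> / 2) powr (real n * s / 2) * N powr ((1 - s) * (real n * s / 2))) / 2)\<^sup>2 *
            (c ^ n * N powr (real n * s / 2) / (36 * C))"
        proof -
          have "(N powr ((1 - s) * (real n * s / 2)))\<^sup>2 * N powr (real n * s / 2) = N powr e"
            unfolding power2_eq_square powr_add[symmetric] e_def by (simp add: algebra_simps)
          thus ?thesis unfolding a_def power_mult_distrib power_divide by (simp add: field_simps)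
        qed
        also have "\<dots> \<le> (real K1 ^ n / 2)\<^sup>2 * I"
          using c C by (intro mult_mono power_mono divide_right_mono Kgt Igt) auto
        finally show ?thesis .
      qed
      also have "ennreal ((real K1 ^ n / 2)\<^sup>2 * I) \<le> L1_norm (\<lambda>x. T1 x * T2 x * T3 x)"
      proof -
        have "ennreal ((real K1 ^ n / 2)\<^sup>2 * I) = (\<integral>\<^sup>+x. ennreal ((real K1 ^ n / 2)\<^sup>2 * (indicator S x * norm (T3 x))) \<partial>lborel)"
          unfolding I_def integral_mult_right_zero[symmetric]
          by (rule nn_integral_eq_integral[symmetric]) (auto intro!: integrable_mult_right bge(1))
        also have "\<dots> \<le> (\<integral>\<^sup>+x. ennreal (norm (T1 x * T2 x * T3 x)) \<partial>lborel)"
        proof (intro nn_integral_mono ennreal_leI)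
          fix x
          show "(real K1 ^ n / 2)\<^sup>2 * (indicator S x * norm (T3 x)) \<le> norm (T1 x * T2 x * T3 x)"
          proof (cases "x \<in> S")
            case True
            have "(real K1 ^ n / 2) * (real K1 ^ n / 2) * norm (T3 x) \<le> norm (T1 x) * norm (T2 x) * norm (T3 x)"
              by (intro mult_right_mono mult_mono T12 True) auto
            thus ?thesis using True by (simp add: norm_mult power2_eq_square)
          qed simp
        qed
        finally show ?thesis by (simp add: L1_norm_def)
      qed
      finally have low: "ennreal (a * N powr e) \<le> L1_norm (\<lambda>x. T1 x * T2 x * T3 x)"
        by (auto intro: ennreal_leI order_trans)
      have Linf: "Linf_norm f \<le> ennreal C"
        using fm C1 by (intro Linf_norm_le) (auto simp: f_def)
      have Nm: "2 powr (real j * m) = N powr m"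
        by (simp add: N_def powr_realpow[symmetric] powr_powr)
      have "ennreal (N powr m) * ennreal (a * N powr e) \<le> ennreal (N powr m) * L1_norm (\<lambda>x. T1 x * T2 x * T3 x)"
        by (intro mult_left_mono low) auto
      also have "\<dots> \<le> ennreal c0 * Linf_norm f * Linf_norm f * h1_norm \<Phi> (bump N)"
        unfolding Nm[symmetric] T1_def T2_def T3_def
        using j K1 Np by (intro bound) (auto simp: f_def schwartz_focusing schwartz_bump)
      also have "\<dots> \<le> ennreal c0 * ennreal C * ennreal C * ennreal (Ch * N powr \<epsilon>)"
        by (intro mult_mono Linf h1 N1) auto
      finally have "ennreal (N powr m * (a * N powr e)) \<le> ennreal (c0 * C * C * (Ch * N powr \<epsilon>))"
        using c0 C Ch a by (simp add: ennreal_mult)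
      hence "N powr m * (a * N powr e) \<le> c0 * C * C * (Ch * N powr \<epsilon>)"
        using c0 C Ch by (subst (asm) ennreal_le_iff) auto
      hence "N powr (m + e) * a \<le> c0 * C * C * Ch * N powr \<epsilon>"
        by (simp add: powr_add mult_ac)
      moreover have "N powr \<epsilon> > 0" using Np by simp
      ultimately have "N powr (m + e) / N powr \<epsilon> \<le> c0 * C * C * Ch / a"
        using a by (simp add: field_simps)
      thus ?thesis by (simp add: powr_diff N_def)
    qed
    thus ?thesis by (rule exponent_nonpos)
  qed
  have "m + e \<le> 0"
  proof (rule field_le_epsilon)
    fix \<epsilon> :: real assume "\<epsilon> > 0"
    hence "m + e - min \<epsilon> 1 \<le> 0" by (intro main) auto
    thus "m + e \<le> 0 + \<epsilon>" by linarith
  qed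
  thus ?thesis by (simp add: e_def n_def)
qed

end
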